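(* Let $M>0$ and $0<e^2<M^2$. For every $H\in\mathbb{R}$, there is a TSS-CMC foliation of the maximally extended Reissner-Nordström spacetime of mass $M$ and charge $e$ such that every hypersurface of the foliation has mean curvature $H$.
   Context: **Spacetime.** Let $M>0$, $0<e^2<M^2$, $h(r)=1-\frac{2M}{r}+\frac{e^2}{r^2}$, with roots $r_\pm=M\pm\sqrt{M^2-e^2}$, so $0<r_-<r_+$. The Reissner-Nordström metric is $ds^2=-h\,dt^2+h^{-1}dr^2+r^2(d\theta^2+\sin^2\theta\,d\phi^2)$, regular on region I ($r>r_+$), region II ($r_-<r<r_+$) and region III ($0<r<r_-$). The maximally extended Reissner-Nordström spacetime is its standard maximal analytic extension (Hawking–Ellis, pp. 156–159): infinitely many copies of the regions I, II, III, together with time-reversed ("upside down") copies I$'$, II$'$, III$'$, are glued analytically across the coordinate singularities $r=r_\pm$. **Penrose diagram.** The quotient of the extended spacetime by the spherical symmetry is represented by its Penrose diagram, a domain in the $(T,X)$-plane, on which the metric has the form $\Omega^2(-dT^2+dX^2)+r^2(d\theta^2+\sin^2\theta\,d\phi^2)$ with $\Omega>0$ and $r$ a function of $(T,X)$; $\partial_T$ is the future time direction. The origin $(T,X)=(0,0)$ is a bifurcation sphere $r=r_+$: region I is to its right, I$'$ to its left, a region II directly above it (to its future), and a region II$'$ directly below it (to its past). Above each region II is a bifurcation sphere $r=r_-$ on the $T$-axis, with region III on its left, III$'$ on its right, and a new region II$'$ above it, above which comes a new bifurcation sphere $r=r_+$ on the $T$-axis with new regions I, I$'$, and so on; the pattern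 is repeated periodically in both $T$-directions. The diagram is symmetric under $X\mapsto -X$ and $T\mapsto -T$, and these reflections induce isometries of the spacetime. **Hypersurfaces.** A spherically symmetric hypersurface is given by a graph $\Sigma:(T=T(X),X,\theta,\phi)$; it is spacelike iff $1-(T'(X))^2>0$. The mean curvature is $H=\frac13\operatorname{div}\nu$, where $\nu$ is the future-directed unit timelike normal (so that, e.g., the cylinder $r=r_0\in(r_-,r_+)$ in region II has $H=\frac{1}{3\sqrt{-h(r_0)}}\big(\frac{2h(r_0)}{r_0}+\frac{h'(r_0)}{2}\big)$). A TSS-CMC hypersurface is a spacelike, spherically symmetric hypersurface of constant mean curvature that is $T$-axisymmetric, i.e. symmetric under $X\mapsto -X$; it is understood to be maximally extended. **Foliations.** A TSS-CMC foliation is a family of hypersurfaces $\{\Sigma_s\}$ such that (i) every $\Sigma_s$ is a TSS-CMC hypersurface, (ii) for any $s_1\ne s_2$, $\Sigma_{s_1}$ and $\Sigma_{s_2}$ are disjoint, and (iii) $\bigcup_s\Sigma_s$ covers the whole spacetime. *)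

theory Defs
  imports "HOL-Analysis.Analysis"
begin

section \<open>The extended Reissner--Nordstroem spacetime\<close>

definition rn_h :: "real \<Rightarrow> real \<Rightarrow> real \<Rightarrow> real" where
  "rn_h M e r = 1 - 2 * M / r + e\<^sup>2 / r\<^sup>2"

definition r_plus :: "real \<Rightarrow> real \<Rightarrow> real" where
  "r_plus M e = M + sqrt (M\<^sup>2 - e\<^sup>2)"

definition r_minus :: "real \<Rightarrow> real \<Rightarrow> real" where
  "r_minus M e = M - sqrt (M\<^sup>2 - e\<^sup>2)"

text \<open>Surface gravities of the two horizons: half of the absolute value of the derivative of
  \<open>rn_h\<close> at \<open>r_plus\<close> and at \<open>r_minus\<close>.\<close>

definition kappa_plus :: "real \<Rightarrow> real \<Rightarrow> real" where
  "kappa_plus M e = (r_plus M e - r_minus M e) / (2 * (r_plus M e)\<^sup>2)"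

definition kappa_minus :: "real \<Rightarrow> real \<Rightarrow> real" where
  "kappa_minus M e = (r_plus M e - r_minus M e) / (2 * (r_minus M e)\<^sup>2)"

text \<open>Twice the tortoise coordinate: an antiderivative of \<open>2 / h\<close> in each of the three regions.\<close>

definition tortoise2 :: "real \<Rightarrow> real \<Rightarrow> real \<Rightarrow> real" where
  "tortoise2 M e r = 2 * r + ln \<bar>r - r_plus M e\<bar> / kappa_plus M e
                           - ln \<bar>r - r_minus M e\<bar> / kappa_minus M e"

text \<open>
  The Penrose diagram uses the null coordinates \<open>p = T - X\<close> and \<open>q = T + X\<close>. The horizons
  are the lines on which \<open>p\<close> or \<open>q\<close> is a multiple of \<open>pi\<close>: even multiples give \<open>r = r_plus\<close>,
  odd multiples give \<open>r = r_minus\<close>. They cut the diagram into diamonds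
  \<open>i * pi < p < (i + 1) * pi\<close>, \<open>j * pi < q < (j + 1) * pi\<close>. With \<open>G = null_scale M e\<close>, each
  diamond carries the static coordinates \<open>(t, r)\<close> given, up to the orientation of \<open>t\<close>, by
    \<open>tortoise2 M e r = G p + G q\<close>,   \<open>2 * t = G q - G p\<close>,
  in which \<open>-h dt^2 + dr^2 / h = h * G' p * G' q dp dq\<close>.
  \<open>G\<close> is even, has period \<open>2 * pi\<close>, and maps \<open>{0<..<pi}\<close> increasingly onto the real line. Since
  \<open>exp (kappa_plus * G p)\<close> and \<open>exp (- kappa_minus * G p)\<close> are, up to sign, analytic with a
  simple zero at even resp. odd multiples of \<open>pi\<close>, the function \<open>r\<close> and the metric extend
  analytically across all horizons and bifurcation spheres.
\<close>

definition null_scale :: "real \<Rightarrow> real \<Rightarrow> real \<Rightarrow> real" where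
  "null_scale M e p = ln \<bar>sin (p / 2)\<bar> / kappa_plus M e - ln \<bar>cos (p / 2)\<bar> / kappa_minus M e"

text \<open>
  The two sign conditions select the region to which the diamond belongs; on a horizon they force
  \<open>r\<close> to be \<open>r_plus\<close> or \<open>r_minus\<close>. Diamonds and corners for which they are contradictory do not
  belong to the spacetime.
\<close>

definition is_radius :: "real \<Rightarrow> real \<Rightarrow> real \<times> real \<Rightarrow> real \<Rightarrow> bool" where
  "is_radius M e = (\<lambda>(T, X) r. let p = T - X; q = T + X in
      0 < r \<and>
      sgn (r_plus M e - r) = sgn (sin (p / 2) * sin (q / 2)) \<and>
      sgn (r - r_minus M e) = sgn (cos (p / 2) * cos (q / 2)) \<and>
      (r \<noteq> r_plus M e \<and> r \<noteq> r_minus M e \<longrightarrow>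
        tortoise2 M e r = null_scale M e p + null_scale M e q))"

text \<open>
  Points are written \<open>(T, X)\<close>. Among the diamonds with consistent signs, \<open>\<bar>X\<bar> < pi\<close> keeps those
  with \<open>\<bar>i - j\<bar> \<le> 1\<close>: II (\<open>i = j\<close> even), II' (\<open>i = j\<close> odd), I and I' around the even bifurcation
  spheres, III and III' around the odd ones. Here \<open>I\<close> is on the right of the origin,
  \<open>i = -1, j = 0\<close>. The remaining boundary of the diagram inside \<open>\<bar>X\<bar> < pi\<close> is the singularity
  \<open>r = 0\<close> in III and III' together with the conformal infinity of I and I' and the end points
  of the horizons.
\<close>

definition penrose_diagram :: "real \<Rightarrow> real \<Rightarrow> (real \<times> real) set" where
  "penrose_diagram M e = {x. \<bar>snd x\<bar> < pi \<and> (\<exists>r. is_radius M e x r)}"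

definition area_radius :: "real \<Rightarrow> real \<Rightarrow> real \<times> real \<Rightarrow> real" where
  "area_radius M e x = (THE r. is_radius M e x r)"

definition off_horizon :: "real \<Rightarrow> real \<Rightarrow> (real \<times> real) set" where
  "off_horizon M e =
     {x \<in> penrose_diagram M e. area_radius M e x \<noteq> r_plus M e \<and> area_radius M e x \<noteq> r_minus M e}"

text \<open>
  \<open>-dT^2 + dX^2 = - dp dq\<close>, hence the square of the conformal factor is \<open>- h * G' p * G' q\<close> off
  the horizons. On the horizons it is defined by continuous extension.
\<close>

definition static_conformal_sq :: "real \<Rightarrow> real \<Rightarrow> real \<times> real \<Rightarrow> real" where
  "static_conformal_sq M e = (\<lambda>(T, X).
     - rn_h M e (area_radius M e (T, X))
       * deriv (null_scale M e) (T - X) * deriv (null_scale M e) (T + X))"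

definition conformal_factor :: "real \<Rightarrow> real \<Rightarrow> real \<times> real \<Rightarrow> real" where
  "conformal_factor M e x = sqrt
     (if x \<in> off_horizon M e then static_conformal_sq M e x
      else Lim (at x within off_horizon M e) (static_conformal_sq M e))"

text \<open>The metric in the coordinates \<open>(T, X, \<theta>, \<phi>)\<close>.\<close>

definition rn_metric :: "real \<Rightarrow> real \<Rightarrow> real ^ 4 \<Rightarrow> real ^ 4 ^ 4" where
  "rn_metric M e x =
    (let \<Omega> = conformal_factor M e (x $ 1, x $ 2); r = area_radius M e (x $ 1, x $ 2) in
      \<chi> i j. if i \<noteq> j then 0
             else if i = 1 then - \<Omega>\<^sup>2
             else if i = 2 then \<Omega>\<^sup>2
             else if i = 3 then r\<^sup>2
             else r\<^sup>2 * (sin (x $ 3))\<^sup>2)"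

text \<open>The underlying set of the spacetime; the sphere factor is the unit sphere of \<open>real ^ 3\<close>.\<close>

definition rn_spacetime :: "real \<Rightarrow> real \<Rightarrow> ((real \<times> real) \<times> (real ^ 3)) set" where
  "rn_spacetime M e = penrose_diagram M e \<times> sphere 0 1"


section \<open>Mean curvature of spherically symmetric hypersurfaces\<close>

definition partial_deriv :: "'n::finite \<Rightarrow> (real ^ 'n \<Rightarrow> real) \<Rightarrow> real ^ 'n \<Rightarrow> real" where
  "partial_deriv i F x = deriv (\<lambda>s. F (x + s *\<^sub>R axis i 1)) 0"

text \<open>The divergence of a vector field with respect to a pseudo-Riemannian metric.\<close>

definition divergence ::
  "(real ^ 'n \<Rightarrow> real ^ 'n ^ 'n) \<Rightarrow> (real ^ 'n \<Rightarrow> real ^ 'n) \<Rightarrow> real ^ 'n::finite \<Rightarrow> real" where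
  "divergence g V x =
     (\<Sum>i\<in>UNIV. partial_deriv i (\<lambda>y. sqrt \<bar>det (g y)\<bar> * V y $ i) x) / sqrt \<bar>det (g x)\<bar>"

text \<open>
  The future-directed unit normal of the graph \<open>T = f X\<close>, extended to a vector field by taking at
  each point the normal of the \<open>T\<close>-translate of the graph through that point. As the extension
  is a unit field, its divergence at the points of the graph does not depend on the extension.
\<close>

definition unit_normal ::
  "real \<Rightarrow> real \<Rightarrow> (real \<Rightarrow> real) \<Rightarrow> real ^ 4 \<Rightarrow> real ^ 4" where
  "unit_normal M e f x =
     (1 / (conformal_factor M e (x $ 1, x $ 2) * sqrt (1 - (deriv f (x $ 2))\<^sup>2)))
       *\<^sub>R vector [1, deriv f (x $ 2), 0, 0]"

lemma vector_4 [simp]: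
  "(vector [a, b, c, d] :: ('a::zero) ^ 4) $ 1 = a"
  "(vector [a, b, c, d] :: ('a::zero) ^ 4) $ 2 = b"
  "(vector [a, b, c, d] :: ('a::zero) ^ 4) $ 3 = c"
  "(vector [a, b, c, d] :: ('a::zero) ^ 4) $ 4 = d"
  unfolding vector_def by simp_all

lemma unit_normal:
  fixes M e :: real and f :: "real \<Rightarrow> real" and x :: "real ^ 4"
  defines "\<nu> \<equiv> unit_normal M e f x" and "g \<equiv> rn_metric M e x"
  assumes "conformal_factor M e (x $ 1, x $ 2) > 0" and "1 - (deriv f (x $ 2))\<^sup>2 > 0"
  shows "\<nu> \<bullet> (g *v \<nu>) = -1"
    and "\<nu> \<bullet> (g *v vector [deriv f (x $ 2), 1, a, b]) = 0"
    and "\<nu> $ 1 > 0"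
proof -
  have 4: "(2::4) \<noteq> 1" "(3::4) \<noteq> 1" "(4::4) \<noteq> 1" "(3::4) \<noteq> 2" "(4::4) \<noteq> 2" "(4::4) \<noteq> 3"
    by simp_all
  define \<Omega> where "\<Omega> = conformal_factor M e (x $ 1, x $ 2)"
  define D where "D = deriv f (x $ 2)"
  define w where "w = 1 / (\<Omega> * sqrt (1 - D\<^sup>2))"
  have pos: "\<Omega> > 0" "1 - D\<^sup>2 > 0" using assms by (auto simp: \<Omega>_def D_def)
  have "(w * \<Omega>)\<^sup>2 * (1 - D\<^sup>2) = 1"
    using pos by (simp add: w_def power_mult_distrib power_divide)
  then have w2: "w * (w * (\<Omega>\<^sup>2 * D\<^sup>2)) - w * (w * \<Omega>\<^sup>2) = -1"
    by (simp add: algebra_simps power2_eq_square)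
  have \<nu>: "\<nu> = w *\<^sub>R vector [1, D, 0, 0]"
    by (simp add: \<nu>_def unit_normal_def w_def \<Omega>_def D_def)
  show "\<nu> \<bullet> (g *v \<nu>) = -1"
    using w2 4 unfolding \<nu> g_def rn_metric_def Let_def \<Omega>_def[symmetric]
    by (simp add: inner_vec_def matrix_vector_mult_def sum_4 vector_4 power2_eq_square
        algebra_simps)
  show "\<nu> \<bullet> (g *v vector [deriv f (x $ 2), 1, a, b]) = 0"
    using 4 unfolding \<nu> g_def rn_metric_def Let_def \<Omega>_def[symmetric] D_def[symmetric]
    by (simp add: inner_vec_def matrix_vector_mult_def sum_4 vector_4)
  show "\<nu> $ 1 > 0"
    using pos by (simp add: \<nu> w_def vector_4)
qed

definition mean_curvature :: "real \<Rightarrow> real \<Rightarrow> (real \<Rightarrow> real) \<Rightarrow> real ^ 4 \<Rightarrow> real" where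
  "mean_curvature M e f x = divergence (rn_metric M e) (unit_normal M e f) x / 3"

text \<open>A spacelike spherically symmetric hypersurface, as a graph \<open>T = f X\<close> of class \<open>C\<^sup>2\<close> over an
  open interval \<open>J\<close>; the values of \<open>f\<close> outside \<open>J\<close> are irrelevant.\<close>

definition spacelike_graph ::
  "real \<Rightarrow> real \<Rightarrow> real set \<Rightarrow> (real \<Rightarrow> real) \<Rightarrow> bool" where
  "spacelike_graph M e J f \<longleftrightarrow>
     open J \<and> is_interval J \<and> J \<noteq> {} \<and>
     f differentiable_on J \<and> deriv f differentiable_on J \<and> continuous_on J (deriv (deriv f)) \<and>
     (\<forall>X\<in>J. (f X, X) \<in> penrose_diagram M e \<and> 1 - (deriv f X)\<^sup>2 > 0)"

text \<open>The mean curvature is evaluated away from the poles of the spherical coordinates.\<close>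

definition cmc_graph ::
  "real \<Rightarrow> real \<Rightarrow> real \<Rightarrow> real set \<Rightarrow> (real \<Rightarrow> real) \<Rightarrow> bool" where
  "cmc_graph M e H J f \<longleftrightarrow>
     spacelike_graph M e J f \<and>
     (\<forall>X\<in>J. \<forall>\<theta>\<in>{0<..<pi}. \<forall>\<phi>. mean_curvature M e f (vector [f X, X, \<theta>, \<phi>]) = H)"

definition maximally_extended ::
  "real \<Rightarrow> real \<Rightarrow> real \<Rightarrow> real set \<Rightarrow> (real \<Rightarrow> real) \<Rightarrow> bool" where
  "maximally_extended M e H J f \<longleftrightarrow>
     (\<forall>J' f'. cmc_graph M e H J' f' \<and> J \<subseteq> J' \<and> (\<forall>X\<in>J. f' X = f X) \<longrightarrow> J' = J)"

definition T_axisymmetric :: "real set \<Rightarrow> (real \<Rightarrow> real) \<Rightarrow> bool" where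
  "T_axisymmetric J f \<longleftrightarrow> (\<forall>X\<in>J. -X \<in> J \<and> f (-X) = f X)"

definition graph_hypersurface ::
  "real set \<Rightarrow> (real \<Rightarrow> real) \<Rightarrow> ((real \<times> real) \<times> (real ^ 3)) set" where
  "graph_hypersurface J f = (\<lambda>X. (f X, X)) ` J \<times> sphere 0 1"

definition tss_cmc_hypersurface ::
  "real \<Rightarrow> real \<Rightarrow> real \<Rightarrow> ((real \<times> real) \<times> (real ^ 3)) set \<Rightarrow> bool" where
  "tss_cmc_hypersurface M e H \<Sigma> \<longleftrightarrow>
     (\<exists>J f. cmc_graph M e H J f \<and> T_axisymmetric J f \<and> maximally_extended M e H J f \<and>
            \<Sigma> = graph_hypersurface J f)"

definition tss_cmc_foliation ::
  "real \<Rightarrow> real \<Rightarrow> 'i set \<Rightarrow> ('i \<Rightarrow> ((real \<times> real) \<times> (real ^ 3)) set) \<Rightarrow> bool" where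
  "tss_cmc_foliation M e S \<Sigma> \<longleftrightarrow>
     (\<forall>s\<in>S. \<exists>H. tss_cmc_hypersurface M e H (\<Sigma> s)) \<and>
     (\<forall>s\<^sub>1\<in>S. \<forall>s\<^sub>2\<in>S. s\<^sub>1 \<noteq> s\<^sub>2 \<longrightarrow> \<Sigma> s\<^sub>1 \<inter> \<Sigma> s\<^sub>2 = {}) \<and>
     (\<Union>s\<in>S. \<Sigma> s) = rn_spacetime M e"

end

theory Submission
  imports Defs "HOL-Real_Asymp.Real_Asymp"
begin

text \<open>
  Seek the leaves as graphs \<open>T = f X\<close> with \<open>f' = tanh \<mu>\<close>. Constancy of the mean curvature
  is then a first-order system for \<open>(f, \<mu>)\<close> whose right-hand side is bounded and Lipschitz over
  compact parts of the diagram, horizons included, because near each horizon \<open>r\<close> and the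
  conformal factor are smooth functions of products of Kruskal-type coordinates.

  The leaves are the solutions with \<open>f 0 = T0\<close>, \<open>\<mu> 0 = 0\<close>. A point to the left of the axis
  sees a compact triangle of the diagram bounded by two null lines and the axis; every spacelike
  solution starting there stays in the triangle up to the axis. Shooting with all slopes yields by
  the intermediate value theorem one that meets the axis orthogonally, so the leaves cover.
  At such a solution the Jacobi operator has the positive potential
  \<open>\<bar>A\<bar>\<^sup>2 + Ric(\<nu>, \<nu>)\<close>, with \<open>Ric(\<nu>, \<nu>) = e\<^sup>2 / r\<^sup>4\<close>, so the slope at the axis crosses zero only
  upwards as a function of the shooting parameter. Hence the solution is unique and the leaves are
  disjoint.
\<close>

section \<open>Ordinary differential equations with Lipschitz right-hand side\<close>

text \<open>With \<open>f' = tanh \<mu>\<close> the mean curvature equation becomes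
  \<open>\<mu>' = c0 / cosh \<mu> + c1 + c2 * tanh \<mu>\<close>. Over a compact part of the diagram
  the right-hand side is bounded uniformly in \<open>\<mu>\<close>, so a graph cannot turn null
  there and a leaf ends only where it leaves the diagram; this gives maximality. The static
  expressions have poles on the horizons. The cure is to work with \<open>N = \<Omega>^2\<close> and
  \<open>\<xi> = 1 / G'\<close>, which has simple zeros there: identities such as
  \<open>N * \<xi> p * \<xi> q = - h\<close> and \<open>r_p = - \<xi> q * N / 2\<close> involve no
  division and hold across every horizon. Behind the sign of the crossing is the normal variation
  \<open>\<Omega> * cosh \<mu> * u\<close>, with \<open>u\<close> the variation of \<open>f\<close>.
  Its derivative by arc length is \<open>v = \<delta>\<mu> + \<kappa> * u\<close>. In the linear
  system for \<open>u\<close> and \<open>v\<close> the cross coefficients are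
  \<open>1 / (cosh \<mu>)^2\<close> and \<open>N\<close> times the Jacobi potential, both positive.
  So \<open>v\<close> stays positive up to the axis, where symmetry makes \<open>\<kappa>\<close>
  vanish and \<open>v\<close> is the variation of the final boost.\<close>

lemma antiderivative_real_line:
  fixes g :: "real \<Rightarrow> 'a::euclidean_space"
  assumes "continuous_on UNIV g"
  shows "\<exists>G. G x0 = 0 \<and> (\<forall>x. (G has_vector_derivative g x) (at x))"
proof -
  define G where "G x = (if x \<ge> x0 then integral {x0..x} g else - integral {x..x0} g)" for x
  have int: "g integrable_on {a..b}" for a b
    using assms continuous_on_subset integrable_continuous_real by blast
  have "(G has_vector_derivative g x) (at x)" for x
  proof -
    define a where "a = min x x0 - 1"
    define b where "b = max x x0 + 1"
    have ab: "a < x" "x < b" "a < x0" "x0 < b" unfolding a_def b_def by auto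
    have G_eq: "G y = integral {a..y} g - integral {a..x0} g" if "y \<in> {a..b}" for y
    proof (cases "y \<ge> x0")
      case True
      then show ?thesis
        using Henstock_Kurzweil_Integration.integral_combine[of a x0 y g] int ab
        by (simp add: G_def algebra_simps)
    next
      case False
      then show ?thesis
        using Henstock_Kurzweil_Integration.integral_combine[of a y x0 g] int ab that
        by (simp add: G_def algebra_simps)
    qed
    have "((\<lambda>y. integral {a..y} g) has_vector_derivative g x) (at x within {a..b})"
      using assms ab by (intro integral_has_vector_derivative) (auto intro: continuous_on_subset)
    then have "((\<lambda>y. integral {a..y} g - integral {a..x0} g) has_vector_derivative g x) (at x within {a..b})"
      by (auto intro!: derivative_eq_intros)
    then have "(G has_vector_derivative g x) (at x within {a..b})"
      by (rule has_vector_derivative_transform[rotated 2]) (use ab G_eq in auto)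
    then show ?thesis
      using ab by (simp add: at_within_Icc_at)
  qed
  moreover have "G x0 = 0" by (simp add: G_def)
  ultimately show ?thesis by blast
qed

text \<open>Integration reproduces the weight \<open>exp (c * \<bar>x - x0\<bar>)\<close> and gains
  the factor \<open>1 / c\<close>; a large \<open>c\<close> will turn the Picard operator into a
  contraction on the whole line. The half line left of \<open>x0\<close> follows by reflection in
  \<open>x0\<close>.\<close>

lemma exp_growth_bound:
  fixes G :: "real \<Rightarrow> 'a::euclidean_space"
  assumes G: "\<And>x. (G has_vector_derivative g x) (at x)" and "G x0 = 0"
    and g: "\<And>x. norm (g x) \<le> K * exp (c * \<bar>x - x0\<bar>)" and "c > 0"
  shows "norm (G x) \<le> K / c * exp (c * \<bar>x - x0\<bar>)"
proof -
  have K: "K \<ge> 0"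
    using g[of x0] norm_ge_zero[of "g x0"] by (simp del: norm_ge_zero)
  have fwd: "norm (G' x) \<le> K / c * exp (c * \<bar>x - x0\<bar>)"
    if G': "\<And>x. (G' has_vector_derivative g' x) (at x)" and "G' x0 = 0"
    and g': "\<And>x. norm (g' x) \<le> K * exp (c * \<bar>x - x0\<bar>)" and x: "x > x0"
    for G' :: "real \<Rightarrow> 'a" and g' x
  proof -
    define \<phi> where "\<phi> = (\<lambda>s. K / c * exp (c * (s - x0)))"
    have "norm (G' x - G' x0) \<le> \<phi> x - \<phi> x0"
    proof (rule differentiable_bound_general[OF x])
      show "continuous_on {x0..x} \<phi>" unfolding \<phi>_def by (intro continuous_intros)
      show "continuous_on {x0..x} G'"
        using G' by (meson continuous_at_imp_continuous_on has_vector_derivative_continuous)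
      show "(\<phi> has_vector_derivative K * exp (c * (s - x0))) (at s)" for s
        unfolding \<phi>_def has_real_derivative_iff_has_vector_derivative[symmetric]
        using \<open>c > 0\<close> by (auto intro!: derivative_eq_intros)
      show "norm (g' s) \<le> K * exp (c * (s - x0))" if "x0 < s" for s
        using g'[of s] that by simp
    qed (use G' in auto)
    then show ?thesis
      using x K \<open>c > 0\<close> \<open>G' x0 = 0\<close> by (simp add: \<phi>_def) (smt (verit) divide_nonneg_pos)
  qed
  consider "x > x0" | "x = x0" | "x < x0" by linarith
  then show ?thesis
  proof cases
    case 1
    show ?thesis by (rule fwd[OF G \<open>G x0 = 0\<close> g 1])
  next
    case 2
    then show ?thesis using K \<open>c > 0\<close> \<open>G x0 = 0\<close> by simp
  next
    case 3
    have "norm (G (2 * x0 - (2 * x0 - x))) \<le> K / c * exp (c * \<bar>(2 * x0 - x) - x0\<bar>)"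
    proof (rule fwd[where g' = "\<lambda>s. - g (2 * x0 - s)"])
      show "((\<lambda>s. G (2 * x0 - s)) has_vector_derivative - g (2 * x0 - s)) (at s)" for s
      proof -
        have "((\<lambda>s. 2 * x0 - s) has_vector_derivative -1) (at s)"
          by (auto intro!: derivative_eq_intros)
        from vector_diff_chain_at[OF this G] show ?thesis by (simp add: o_def)
      qed
      show "norm (- g (2 * x0 - s)) \<le> K * exp (c * \<bar>s - x0\<bar>)" for s
        using g[of "2 * x0 - s"] by (simp add: abs_minus_commute algebra_simps)
    qed (use 3 \<open>G x0 = 0\<close> in auto)
    then show ?thesis by (simp add: abs_minus_commute)
  qed
qed

text \<open>Solutions are sought as \<open>y0 + W * z\<close> with \<open>z\<close> bounded and
  continuous. Banach's fixed point theorem in the supremum norm of \<open>z\<close> (Bielecki's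
  weighted norm) then gives a solution on the whole line at once; the bound \<open>C\<close> keeps
  the weighted Picard image bounded.\<close>

lemma picard_lindelof_global:
  fixes F :: "real \<Rightarrow> 'a::euclidean_space \<Rightarrow> 'a"
  assumes cont: "continuous_on UNIV (\<lambda>(x, y). F x y)"
    and bound: "\<And>x y. norm (F x y) \<le> C"
    and lip: "\<And>x y z. norm (F x y - F x z) \<le> L * norm (y - z)" and "L > 0"
  shows "\<exists>y. y x0 = y0 \<and> (\<forall>x. (y has_vector_derivative F x (y x)) (at x))"
proof -
  \<comment> \<open>The rate \<open>2 * L\<close> is chosen so that integrating the Lipschitz bound
    against the weight gives the contraction factor \<open>L / (2 * L) = 1 / 2\<close>.\<close>
  define W where "W x = exp (2 * L * \<bar>x - x0\<bar>)" for x
  have W: "W x > 0" for x by (simp add: W_def)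
  have contW: "continuous_on S W" for S unfolding W_def by (intro continuous_intros)
  define g where "g z x = F x (y0 + W x *\<^sub>R apply_bcontfun z x)" for z :: "real \<Rightarrow>\<^sub>C 'a" and x
  have contg: "continuous_on UNIV (g z)" for z
  proof -
    have "continuous_on UNIV (\<lambda>x. (x, y0 + W x *\<^sub>R apply_bcontfun z x))"
      by (intro continuous_intros contW) auto
    from continuous_on_compose2[OF cont this] show ?thesis by (simp add: g_def)
  qed
  define G where "G z = (SOME G. G x0 = 0 \<and> (\<forall>x. (G has_vector_derivative g z x) (at x)))" for z
  have G: "G z x0 = 0" "(G z has_vector_derivative g z x) (at x)" for z x
    using someI_ex[OF antiderivative_real_line[OF contg[of z], of x0]] by (auto simp: G_def)
  define P where "P z x = (1 / W x) *\<^sub>R G z x" for z x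
  have "norm (P z x) \<le> C / (2 * L)" for z x
  proof -
    have "norm (g z s) \<le> C * exp (2 * L * \<bar>s - x0\<bar>)" for s
    proof -
      have "0 \<le> C" using bound norm_ge_zero order_trans by blast
      then have "C * 1 \<le> C * exp (2 * L * \<bar>s - x0\<bar>)"
        using \<open>L > 0\<close> by (intro mult_left_mono) auto
      then show ?thesis using bound[of s] unfolding g_def by (smt (verit))
    qed
    from exp_growth_bound[OF G(2) G(1) this] \<open>L > 0\<close>
    have "norm (G z x) \<le> C / (2 * L) * W x" by (simp add: W_def)
    then show ?thesis using W[of x] by (simp add: P_def pos_divide_le_eq)
  qed
  moreover have "continuous_on UNIV (P z)" for z
  proof -
    have "continuous_on UNIV (G z)"
      using G(2) by (meson continuous_at_imp_continuous_on has_vector_derivative_continuous)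
    then show ?thesis unfolding P_def using W
      by (intro continuous_intros contW) (auto simp: less_imp_neq[symmetric])
  qed
  ultimately have P: "P z \<in> bcontfun" for z
    unfolding bcontfun_def bounded_iff by blast
  define Q where "Q z = Bcontfun (P z)" for z
  have Q: "apply_bcontfun (Q z) = P z" for z
    unfolding Q_def by (rule Bcontfun_inverse[OF P])
  have "dist (Q z) (Q z') \<le> 1 / 2 * dist z z'" for z z'
  proof (rule dist_bound)
    fix x
    have "norm (G z x - G z' x) \<le> L * dist z z' / (2 * L) * exp (2 * L * \<bar>x - x0\<bar>)"
    proof (rule exp_growth_bound)
      show "((\<lambda>x. G z x - G z' x) has_vector_derivative g z x - g z' x) (at x)" for x
        using G(2) by (intro has_vector_derivative_diff)
      show "norm (g z s - g z' s) \<le> L * dist z z' * exp (2 * L * \<bar>s - x0\<bar>)" for s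
      proof -
        have "norm (g z s - g z' s) \<le> L * norm (W s *\<^sub>R z s - W s *\<^sub>R z' s)"
          unfolding g_def using lip by (smt (verit) add_diff_cancel_left)
        also have "norm (W s *\<^sub>R z s - W s *\<^sub>R z' s) = W s * dist (z s) (z' s)"
          unfolding scaleR_diff_right[symmetric] using W[of s] by (simp add: dist_norm)
        also have "L * (W s * dist (z s) (z' s)) \<le> L * (W s * dist z z')"
          using \<open>L > 0\<close> W[of s] dist_bounded[of z s z'] by simp
        finally show ?thesis by (simp add: W_def mult_ac)
      qed
    qed (use G \<open>L > 0\<close> in auto)
    then have "norm (G z x - G z' x) \<le> dist z z' / 2 * W x"
      using \<open>L > 0\<close> by (simp add: W_def)
    moreover have "dist (Q z x) (Q z' x) = norm (G z x - G z' x) / W x"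
      unfolding Q P_def dist_norm scaleR_diff_right[symmetric] using W[of x] by simp
    ultimately show "dist (Q z x) (Q z' x) \<le> 1 / 2 * dist z z'"
      using W[of x] by (simp add: pos_divide_le_eq)
  qed
  then obtain z where z: "Q z = z"
    using banach_fix_type[of "1/2" Q] by auto
  define y where "y x = y0 + W x *\<^sub>R apply_bcontfun z x" for x
  have y_eq: "y x = y0 + G z x" for x
    using fun_cong[OF Q[of z], of x] W[of x] by (simp add: y_def z P_def)
  have "(y has_vector_derivative F x (y x)) (at x)" for x
  proof -
    have "((\<lambda>x. y0 + G z x) has_vector_derivative g z x) (at x)"
      using G(2)[of z x] by (auto intro!: derivative_eq_intros)
    moreover have "g z x = F x (y x)" by (simp add: g_def y_def)
    moreover have "y = (\<lambda>x. y0 + G z x)" using y_eq by blast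
    ultimately show ?thesis by metis
  qed
  moreover have "y x0 = y0" using y_eq G(1) by simp
  ultimately show ?thesis by blast
qed

text \<open>The squared distance is used because the norm is not differentiable at 0. Multiplied by
  \<open>exp (- 2 * L * x)\<close> it is nonincreasing, multiplied by \<open>exp (2 * L * x)\<close>
  nondecreasing, which bounds the propagation in both directions from \<open>x0\<close>.\<close>

lemma gronwall_lipschitz:
  fixes y z :: "real \<Rightarrow> 'a::euclidean_space"
  assumes y: "\<And>x. x \<in> {a..b} \<Longrightarrow> (y has_vector_derivative F x (y x)) (at x within {a..b})"
    and z: "\<And>x. x \<in> {a..b} \<Longrightarrow> (z has_vector_derivative F x (z x)) (at x within {a..b})"
    and lip: "\<And>x. x \<in> {a..b} \<Longrightarrow> norm (F x (y x) - F x (z x)) \<le> L * norm (y x - z x)"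
    and x: "x0 \<in> {a..b}" "x \<in> {a..b}"
  shows "norm (y x - z x) \<le> exp (L * \<bar>x - x0\<bar>) * norm (y x0 - z x0)"
proof -
  define d where "d x = y x - z x" for x
  define d' where "d' x = F x (y x) - F x (z x)" for x
  have d: "(d has_vector_derivative d' x) (at x within {a..b})" if "x \<in> {a..b}" for x
    unfolding d_def d'_def using y z that by (intro has_vector_derivative_diff)
  have sq: "((\<lambda>x. d x \<bullet> d x * exp (k * x)) has_derivative
      (\<lambda>t. t * ((2 * (d x \<bullet> d' x) + k * (d x \<bullet> d x)) * exp (k * x)))) (at x within {a..b})"
    if "x \<in> {a..b}" for x k
    using d[OF that] unfolding has_vector_derivative_def
    by (auto intro!: derivative_eq_intros simp: inner_commute algebra_simps)
  have ip: "\<bar>d x \<bullet> d' x\<bar> \<le> L * (d x \<bullet> d x)" if "x \<in> {a..b}" for x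
  proof -
    have "\<bar>d x \<bullet> d' x\<bar> \<le> norm (d x) * norm (d' x)" by (rule Cauchy_Schwarz_ineq2)
    also have "\<dots> \<le> norm (d x) * (L * norm (d x))"
      using lip[OF that] by (intro mult_left_mono) (auto simp: d_def d'_def)
    finally show ?thesis by (simp add: dot_square_norm power2_eq_square mult_ac)
  qed
  have mono: "(d v \<bullet> d v) * exp (- 2 * L * v) \<le> (d u \<bullet> d u) * exp (- 2 * L * u) \<and>
       (d u \<bullet> d u) * exp (2 * L * u) \<le> (d v \<bullet> d v) * exp (2 * L * v)"
    if uv: "u \<in> {a..b}" "v \<in> {a..b}" "u < v" for u v
  proof -
    have sub: "{u..v} \<subseteq> {a..b}" using uv by auto
    have squv: "((\<lambda>x. d x \<bullet> d x * exp (k * x)) has_derivative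
      (\<lambda>t. t * ((2 * (d x \<bullet> d' x) + k * (d x \<bullet> d x)) * exp (k * x)))) (at x within {u..v})"
      if "u \<le> x" "x \<le> v" for x k
      by (rule has_derivative_subset[OF sq sub]) (use that sub in auto)
    obtain t where t: "t \<in> {u<..<v}" "(d v \<bullet> d v) * exp (- 2 * L * v) - (d u \<bullet> d u) * exp (- 2 * L * u)
        = (v - u) * ((2 * (d t \<bullet> d' t) + (- 2 * L) * (d t \<bullet> d t)) * exp (- 2 * L * t))"
      using mvt_simple[OF \<open>u < v\<close> squv[where k = "- 2 * L"]] by auto
    have "2 * (d t \<bullet> d' t) + (- 2 * L) * (d t \<bullet> d t) \<le> 0"
      using ip[of t] t(1) sub by auto
    then have 1: "(d v \<bullet> d v) * exp (- 2 * L * v) \<le> (d u \<bullet> d u) * exp (- 2 * L * u)"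
      using t(2) uv(3) by (smt (verit) exp_gt_zero mult_nonneg_nonpos mult_nonpos_nonneg)
    obtain t where t: "t \<in> {u<..<v}" "(d v \<bullet> d v) * exp (2 * L * v) - (d u \<bullet> d u) * exp (2 * L * u)
        = (v - u) * ((2 * (d t \<bullet> d' t) + (2 * L) * (d t \<bullet> d t)) * exp (2 * L * t))"
      using mvt_simple[OF \<open>u < v\<close> squv[where k = "2 * L"]] by auto
    have "2 * (d t \<bullet> d' t) + (2 * L) * (d t \<bullet> d t) \<ge> 0"
      using ip[of t] t(1) sub by auto
    then have "(d u \<bullet> d u) * exp (2 * L * u) \<le> (d v \<bullet> d v) * exp (2 * L * v)"
      using t(2) uv(3) by (smt (verit) exp_gt_zero mult_nonneg_nonneg)
    with 1 show ?thesis ..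
  qed
  have "d x \<bullet> d x \<le> exp (2 * L * \<bar>x - x0\<bar>) * (d x0 \<bullet> d x0)"
  proof -
    consider "x0 < x" | "x0 = x" | "x < x0" by linarith
    then show ?thesis
    proof cases
      case 1
      then have "(d x \<bullet> d x) * exp (- 2 * L * x) * exp (2 * L * x)
          \<le> (d x0 \<bullet> d x0) * exp (- 2 * L * x0) * exp (2 * L * x)"
        using mono[OF x] by (intro mult_right_mono) auto
      then show ?thesis using 1 by (simp add: mult.assoc exp_add[symmetric] algebra_simps)
    next
      case 3
      then have "(d x \<bullet> d x) * exp (2 * L * x) * exp (- 2 * L * x)
          \<le> (d x0 \<bullet> d x0) * exp (2 * L * x0) * exp (- 2 * L * x)"
        using mono[OF x(2,1)] by (intro mult_right_mono) auto
      then show ?thesis using 3 by (simp add: mult.assoc exp_add[symmetric] algebra_simps)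
    qed simp
  qed
  also have "\<dots> = (exp (L * \<bar>x - x0\<bar>) * norm (d x0))\<^sup>2"
    by (simp add: power_mult_distrib dot_square_norm exp_double[symmetric] mult.assoc)
  finally have "(norm (d x))\<^sup>2 \<le> (exp (L * \<bar>x - x0\<bar>) * norm (d x0))\<^sup>2"
    by (simp add: dot_square_norm)
  then show ?thesis unfolding d_def
    by (rule power2_le_imp_le) simp
qed

section \<open>Cooperative systems\<close>

lemma compact_Icc_preimage:
  fixes u :: "real \<Rightarrow> real"
  assumes "continuous_on {a..b} u" and "closed T"
  shows "compact {s \<in> {a..b}. u s \<in> T}"
proof -
  have "{s \<in> {a..b}. u s \<in> T} = {a..b} \<inter> u -` T" by auto
  then show ?thesis
    using continuous_closed_preimage[OF assms(1) _ assms(2)]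
    by (metis bounded_Int bounded_closed_interval closed_atLeastAtMost compact_eq_bounded_closed)
qed

lemma mvt_between:
  fixes f :: "real \<Rightarrow> real"
  assumes "\<And>t. t \<in> closed_segment x y \<Longrightarrow> (f has_real_derivative f' t) (at t)"
  shows "\<exists>z\<in>closed_segment x y. f y - f x = f' z * (y - x)"
proof -
  consider "x < y" | "x = y" | "y < x" by linarith
  then show ?thesis
  proof cases
    case 1
    then obtain z where "x < z" "z < y" "f y - f x = (y - x) * f' z"
      using MVT2[of x y f f'] assms by (auto simp: closed_segment_eq_real_ivl)
    then show ?thesis using 1 by (intro bexI[of _ z]) (auto simp: closed_segment_eq_real_ivl)
  next
    case 3
    then obtain z where "y < z" "z < x" "f x - f y = (x - y) * f' z"
      using MVT2[of y x f f'] assms by (auto simp: closed_segment_eq_real_ivl)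
    then show ?thesis using 3
      by (intro bexI[of _ z]) (auto simp: closed_segment_eq_real_ivl algebra_simps)
  qed auto
qed

lemma mono_from_derivative_within:
  fixes w :: "real \<Rightarrow> real"
  assumes w: "\<And>x. x \<in> {a..b} \<Longrightarrow> (w has_real_derivative w' x) (at x within {a..b})"
    and "s \<in> {a..b}" "t \<in> {a..b}" "s \<le> t"
    and "\<And>x. x \<in> {s<..<t} \<Longrightarrow> w' x \<ge> 0"
  shows "w s \<le> w t"
proof (cases "s = t")
  case False
  have "(w has_derivative (\<lambda>h. w' x * h)) (at x within {s..t})" if "s \<le> x" "x \<le> t" for x
    using has_derivative_subset[OF w[of x, unfolded has_field_derivative_def], of "{s..t}"] that assms
    by auto
  from mvt_simple[OF _ this] obtain x where "x \<in> {s<..<t}" "w t - w s = w' x * (t - s)"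
    using False \<open>s \<le> t\<close> by fastforce
  then show ?thesis using assms(5)[of x] \<open>s \<le> t\<close> by (smt (verit) mult_nonneg_nonneg)
qed simp

text \<open>Where \<open>u\<close> is negative the hypothesis reads \<open>u' \<ge> C * u\<close>,
  so \<open>u * exp (- C * x)\<close> cannot decrease; starting from the last point with
  \<open>u \<ge> 0\<close> this rules out negative values. Once \<open>u \<ge> 0\<close> is known,
  \<open>u * exp (C * x)\<close> is nondecreasing.\<close>

lemma linear_decay_bound:
  fixes u :: "real \<Rightarrow> real"
  assumes u: "\<And>x. x \<in> {a..b} \<Longrightarrow> (u has_real_derivative u' x) (at x within {a..b})"
    and decay: "\<And>x. x \<in> {a..b} \<Longrightarrow> u' x \<ge> - C * \<bar>u x\<bar>"
    and "u a \<ge> 0" and x: "x \<in> {a..b}"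
  shows "u x \<ge> u a * exp (- C * (x - a))"
proof -
  have cont: "continuous_on {a..b} u"
    using u DERIV_continuous_on by blast
  have nonneg: "u c \<ge> 0" if c: "c \<in> {a..b}" for c
  proof (rule ccontr)
    assume neg: "\<not> u c \<ge> 0"
    define Z where "Z = {s \<in> {a..c}. u s \<in> {0..}}"
    have "continuous_on {a..c} u" using cont c by (auto intro: continuous_on_subset)
    then have "compact Z" unfolding Z_def by (rule compact_Icc_preimage) simp
    moreover have "a \<in> Z" using c \<open>u a \<ge> 0\<close> by (auto simp: Z_def)
    ultimately obtain t where t: "t \<in> Z" "\<And>s. s \<in> Z \<Longrightarrow> s \<le> t"
      by (metis compact_attains_sup empty_iff)
    have tc: "t \<in> {a..b}" "t \<le> c" using t(1) c by (auto simp: Z_def)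
    have "u t * exp (- C * t) \<le> u c * exp (- C * c)"
    proof (rule mono_from_derivative_within[where w' = "\<lambda>x. (u' x - C * u x) * exp (- C * x)", OF _ tc(1) c tc(2)])
      show "((\<lambda>x. u x * exp (- C * x)) has_real_derivative (u' x - C * u x) * exp (- C * x)) (at x within {a..b})"
        if "x \<in> {a..b}" for x
        using u[OF that] by (auto intro!: derivative_eq_intros simp: algebra_simps)
      show "(u' x - C * u x) * exp (- C * x) \<ge> 0" if "x \<in> {t<..<c}" for x
      proof -
        have "x \<notin> Z" using t(2)[of x] that by auto
        then have "u x < 0" using that tc by (auto simp: Z_def)
        then have "u' x - C * u x \<ge> 0" using decay[of x] that tc c by auto
        then show ?thesis by simp
      qed
    qed
    moreover have "u t \<ge> 0" using t(1) by (simp add: Z_def)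
    ultimately show False using neg
      by (smt (verit) exp_gt_zero mult_neg_pos zero_le_mult_iff)
  qed
  have "u a * exp (C * a) \<le> u x * exp (C * x)"
  proof (rule mono_from_derivative_within[where a = a and b = b and w = "\<lambda>x. u x * exp (C * x)" and s = a and t = x and w' = "\<lambda>x. (u' x + C * u x) * exp (C * x)"])
    show "((\<lambda>x. u x * exp (C * x)) has_real_derivative (u' x + C * u x) * exp (C * x)) (at x within {a..b})"
      if "x \<in> {a..b}" for x
      using u[OF that] by (auto intro!: derivative_eq_intros simp: algebra_simps)
    show "(u' s + C * u s) * exp (C * s) \<ge> 0" if "s \<in> {a<..<x}" for s
      using nonneg[of s] decay[of s] that x by auto
  qed (use x in auto)
  then have "u a * exp (C * a) * exp (- C * x) \<le> u x * exp (C * x) * exp (- C * x)"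
    by (intro mult_right_mono) auto
  then show ?thesis by (simp add: mult.assoc exp_add[symmetric] algebra_simps)
qed

text \<open>Neither function can be driven through zero while the other is nonnegative. Up to the
  first point with \<open>v \<le> 0\<close> both are nonnegative, and then
  \<open>linear_decay_bound\<close> gives \<open>v > 0\<close> at that point as well.\<close>

lemma cooperative_positive:
  fixes u v :: "real \<Rightarrow> real"
  assumes u: "\<And>x. x \<in> {a..b} \<Longrightarrow> (u has_real_derivative u' x) (at x within {a..b})"
    and v: "\<And>x. x \<in> {a..b} \<Longrightarrow> (v has_real_derivative v' x) (at x within {a..b})"
    and u': "\<And>x. x \<in> {a..b} \<Longrightarrow> v x \<ge> 0 \<Longrightarrow> u' x \<ge> - C * \<bar>u x\<bar>"
    and v': "\<And>x. x \<in> {a..b} \<Longrightarrow> u x \<ge> 0 \<Longrightarrow> v' x \<ge> - C * \<bar>v x\<bar>"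
    and init: "u a \<ge> 0" "v a > 0" and "a \<le> b"
  shows "v b > 0"
proof (rule ccontr)
  assume "\<not> v b > 0"
  then have le: "v b \<le> 0" by simp
  have cont: "continuous_on {a..b} v"
    using v DERIV_continuous_on by blast
  define Z where "Z = {s \<in> {a..b}. v s \<in> {..0}}"
  have "compact Z" unfolding Z_def by (rule compact_Icc_preimage[OF cont]) simp
  moreover have "bounded Z" unfolding Z_def by (rule bounded_subset[of "{a..b}"]) auto
  moreover have "b \<in> Z" using \<open>a \<le> b\<close> le by (auto simp: Z_def)
  ultimately obtain t where t: "t \<in> Z" "\<And>s. s \<in> Z \<Longrightarrow> t \<le> s"
    by (metis compact_attains_inf empty_iff)
  have tab: "a \<le> t" "t \<le> b" "v t \<le> 0" using t(1) by (auto simp: Z_def)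
  have gt: "v s > 0" if "a \<le> s" "s < t" for s
    using t(2)[of s] that tab by (force simp: Z_def)
  have "v t \<ge> 0"
  proof (rule ccontr)
    assume "\<not> v t \<ge> 0"
    moreover have "continuous_on {a..t} v" using cont tab by (auto intro: continuous_on_subset)
    ultimately obtain s where "a \<le> s" "s \<le> t" "v s = 0"
      using IVT2'[of v t 0 a] init(2) tab by auto
    then show False using gt[of s] \<open>\<not> v t \<ge> 0\<close> by (cases "s = t") auto
  qed
  then have pos: "v s \<ge> 0" if "s \<in> {a..t}" for s
    using gt[of s] that by (cases "s = t") auto
  have sub: "{a..t} \<subseteq> {a..b}" using tab by auto
  have ut: "(u has_real_derivative u' x) (at x within {a..t})"
    and vt: "(v has_real_derivative v' x) (at x within {a..t})" if "x \<in> {a..t}" for x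
    using DERIV_subset[OF u sub] DERIV_subset[OF v sub] that sub by blast+
  have upos: "u s \<ge> 0" if "s \<in> {a..t}" for s
  proof -
    have "u s \<ge> u a * exp (- C * (s - a))"
      by (rule linear_decay_bound[where b = t and u' = u'])
        (use ut u' pos sub that init in auto)
    moreover have "u a * exp (- C * (s - a)) \<ge> 0" using init by simp
    ultimately show ?thesis by linarith
  qed
  have "v t \<ge> v a * exp (- C * (t - a))"
    by (rule linear_decay_bound[where b = t and u' = v'])
      (use vt v' upos sub tab init in auto)
  moreover have "v a * exp (- C * (t - a)) > 0" using init by simp
  ultimately show False using tab by linarith
qed

text \<open>All zeros are crossed upwards, so the function is positive just after \<open>m1\<close>
  and negative just before the next zero; the intermediate value theorem then produces a zero in
  between.\<close>

lemma upcrossing_zero_unique: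
  fixes S :: "real \<Rightarrow> real"
  assumes cont: "continuous_on UNIV S"
    and up: "\<And>m. S m = 0 \<Longrightarrow> \<exists>\<epsilon>>0. \<forall>m'. m' \<noteq> m \<and> \<bar>m' - m\<bar> < \<epsilon> \<longrightarrow> (m' - m) * S m' > 0"
    and "S m1 = 0" "S m2 = 0"
  shows "m1 = m2"
proof -
  have "\<not> m1 < m2" if S: "S m1 = 0" "S m2 = 0" for m1 m2
  proof
    assume less: "m1 < m2"
    obtain \<epsilon> where \<epsilon>: "\<epsilon> > 0" "\<And>m'. m' \<noteq> m1 \<Longrightarrow> \<bar>m' - m1\<bar> < \<epsilon> \<Longrightarrow> (m' - m1) * S m' > 0"
      using up[OF S(1)] by blast
    define c where "c = m1 + min \<epsilon> (m2 - m1) / 2"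
    have c: "m1 < c" "c < m2" "\<bar>c - m1\<bar> < \<epsilon>" using \<epsilon>(1) less by (auto simp: c_def min_def field_simps)
    have Sc: "S c > 0" using \<epsilon>(2)[of c] c by (simp add: zero_less_mult_iff)
    define Z where "Z = {s \<in> {c..m2}. S s \<in> {0}}"
    have "continuous_on {c..m2} S" using cont by (auto intro: continuous_on_subset)
    then have "compact Z" unfolding Z_def by (rule compact_Icc_preimage) simp
    moreover have "m2 \<in> Z" using c S by (auto simp: Z_def)
    ultimately obtain t where t: "t \<in> Z" "\<And>s. s \<in> Z \<Longrightarrow> t \<le> s"
      by (metis compact_attains_inf empty_iff)
    have tc: "c \<le> t" "t \<le> m2" "S t = 0" using t(1) by (auto simp: Z_def)
    then have "c < t" using Sc by (cases "c = t") auto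
    obtain \<delta> where \<delta>: "\<delta> > 0" "\<And>m'. m' \<noteq> t \<Longrightarrow> \<bar>m' - t\<bar> < \<delta> \<Longrightarrow> (m' - t) * S m' > 0"
      using up[OF tc(3)] by blast
    define d where "d = t - min \<delta> (t - c) / 2"
    have d: "c < d" "d < t" "\<bar>d - t\<bar> < \<delta>" using \<delta>(1) \<open>c < t\<close> by (auto simp: d_def min_def field_simps)
    have "S d < 0" using \<delta>(2)[of d] d by (simp add: zero_less_mult_iff)
    then obtain s where "c \<le> s" "s \<le> d" "S s = 0"
      using IVT2'[of S d 0 c] Sc d cont by (auto intro: continuous_on_subset)
    then have "s \<in> Z" using d tc by (auto simp: Z_def)
    then show False using t(2)[of s] \<open>s \<le> d\<close> d by linarith
  qed
  then show ?thesis using assms(3,4) by (meson linorder_less_linear)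
qed

section \<open>The shooting problem\<close>

text \<open>The partial derivatives in \<open>T\<close> and \<open>X\<close> are carried as named
  functions because the Riccati inequality is stated with them and their continuity is used on
  compact sets.\<close>

definition c1_on :: "(real \<times> real) set \<Rightarrow> (real \<times> real \<Rightarrow> real) \<Rightarrow> (real \<times> real \<Rightarrow> real) \<Rightarrow>
    (real \<times> real \<Rightarrow> real) \<Rightarrow> bool" where
  "c1_on D c c1 c2 \<longleftrightarrow> continuous_on D c1 \<and> continuous_on D c2 \<and>
     (\<forall>x\<in>D. (c has_derivative (\<lambda>h. c1 x * fst h + c2 x * snd h)) (at x))"

lemma c1_on_continuous: "c1_on D c c1 c2 \<Longrightarrow> continuous_on D c"
  unfolding c1_on_def continuous_on_eq_continuous_within
  using has_derivative_continuous has_derivative_at_withinI by blast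

lemma c1_on_bounded_lipschitz:
  assumes c: "c1_on D c c1 c2" and K: "compact K" "convex K" "K \<subseteq> D"
  shows "\<exists>B>0. (\<forall>x\<in>K. \<bar>c x\<bar> \<le> B) \<and> (\<forall>x\<in>K. \<forall>y\<in>K. \<bar>c x - c y\<bar> \<le> B * norm (x - y))"
proof -
  have bdd: "\<exists>B. \<forall>x\<in>K. \<bar>g x\<bar> \<le> B" if "continuous_on D g" for g :: "real \<times> real \<Rightarrow> real"
  proof -
    have "compact (g ` K)"
      using that K by (intro compact_continuous_image) (auto intro: continuous_on_subset)
    then show ?thesis using compact_imp_bounded bounded_real by fastforce
  qed
  obtain B0 where B0: "\<And>x. x \<in> K \<Longrightarrow> \<bar>c x\<bar> \<le> B0"
    using bdd[OF c1_on_continuous[OF c]] by blast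
  obtain B1 where B1: "\<And>x. x \<in> K \<Longrightarrow> \<bar>c1 x\<bar> \<le> B1"
    using bdd[of c1] c by (auto simp: c1_on_def)
  obtain B2 where B2: "\<And>x. x \<in> K \<Longrightarrow> \<bar>c2 x\<bar> \<le> B2"
    using bdd[of c2] c by (auto simp: c1_on_def)
  have lip: "norm (c x - c y) \<le> (\<bar>B1\<bar> + \<bar>B2\<bar>) * norm (x - y)" if "x \<in> K" "y \<in> K" for x y
  proof (rule differentiable_bound[OF K(2) _ _ that])
    show "(c has_derivative (\<lambda>h. c1 x * fst h + c2 x * snd h)) (at x within K)" if "x \<in> K" for x
      using c that K(3) by (auto simp: c1_on_def intro: has_derivative_at_withinI)
    show "onorm (\<lambda>h. c1 x * fst h + c2 x * snd h) \<le> \<bar>B1\<bar> + \<bar>B2\<bar>" if "x \<in> K" for x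
    proof (rule onorm_le)
      fix h :: "real \<times> real"
      have "norm (c1 x * fst h + c2 x * snd h) \<le> \<bar>c1 x\<bar> * \<bar>fst h\<bar> + \<bar>c2 x\<bar> * \<bar>snd h\<bar>"
        by (metis abs_mult abs_triangle_ineq real_norm_def)
      also have "\<dots> \<le> \<bar>B1\<bar> * norm h + \<bar>B2\<bar> * norm h"
        using B1[OF that] B2[OF that] norm_fst_le[of "fst h" "snd h"] norm_snd_le[of "snd h" "fst h"]
        by (intro add_mono mult_mono) (auto simp: real_norm_def)
      finally show "norm (c1 x * fst h + c2 x * snd h) \<le> (\<bar>B1\<bar> + \<bar>B2\<bar>) * norm h"
        by (simp add: algebra_simps)
    qed
  qed
  define B where "B = \<bar>B0\<bar> + \<bar>B1\<bar> + \<bar>B2\<bar> + 1"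
  have "\<bar>c x - c y\<bar> \<le> B * norm (x - y)" if "x \<in> K" "y \<in> K" for x y
  proof -
    have "(\<bar>B1\<bar> + \<bar>B2\<bar>) * norm (x - y) \<le> B * norm (x - y)"
      by (intro mult_right_mono) (auto simp: B_def)
    with lip[OF that] show ?thesis by simp
  qed
  moreover have "\<bar>c x\<bar> \<le> B" if "x \<in> K" for x using B0[OF that] by (simp add: B_def)
  moreover have "B > 0" by (simp add: B_def)
  ultimately show ?thesis by blast
qed

section \<open>Bounds for hyperbolic functions of the boost\<close>

lemma tanh_has_derivative: "(tanh has_real_derivative 1 / (cosh x)\<^sup>2) (at (x::real) within S)"
proof -
  have "1 - (tanh x)\<^sup>2 = 1 / (cosh x)\<^sup>2"
  proof -
    have "1 - (tanh x)\<^sup>2 = ((cosh x)\<^sup>2 - (sinh x)\<^sup>2) / (cosh x)\<^sup>2"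
      by (simp add: tanh_def power_divide diff_divide_distrib)
    then show ?thesis using cosh_square_eq[of x] by simp
  qed
  moreover have "(tanh has_real_derivative 1 - (tanh x)\<^sup>2) (at x within S)"
    by (auto intro!: derivative_eq_intros)
  ultimately show ?thesis by simp
qed

lemma sech_has_derivative:
  "((\<lambda>x. 1 / cosh x) has_real_derivative - sinh x / (cosh x)\<^sup>2) (at (x::real) within S)"
  by (auto intro!: derivative_eq_intros simp: power2_eq_square)

lemma abs_sinh_le_cosh: "\<bar>sinh (x::real)\<bar> \<le> cosh x"
  using cosh_square_eq[of x] by (intro abs_le_square_iff[THEN iffD2, of _ "cosh x", simplified]) simp

lemma tanh_lipschitz: "\<bar>tanh x - tanh (y::real)\<bar> \<le> \<bar>x - y\<bar>"
proof -
  obtain z where "tanh x - tanh y = 1 / (cosh z)\<^sup>2 * (x - y)"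
    using mvt_between[OF tanh_has_derivative, of y x] by blast
  moreover have "\<bar>1 / (cosh z)\<^sup>2\<bar> \<le> 1" using cosh_real_ge_1[of z] by (simp add: divide_simps)
  ultimately show ?thesis by (metis abs_ge_zero abs_mult mult_left_le_one_le)
qed

lemma sech_lipschitz: "\<bar>1 / cosh x - 1 / cosh (y::real)\<bar> \<le> \<bar>x - y\<bar>"
proof -
  obtain z where z: "1 / cosh x - 1 / cosh y = - sinh z / (cosh z)\<^sup>2 * (x - y)"
    using mvt_between[OF sech_has_derivative, of y x] by blast
  have "\<bar>sinh z\<bar> \<le> cosh z * cosh z"
    using abs_sinh_le_cosh[of z] cosh_real_ge_1[of z]
    by (smt (verit) mult_less_cancel_left2)
  then have "\<bar>- sinh z / (cosh z)\<^sup>2\<bar> \<le> 1"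
    by (simp add: power2_eq_square divide_simps)
  then show ?thesis unfolding z abs_mult by (intro mult_left_le_one_le) auto
qed

lemma sech_bounds: "\<bar>1 / cosh (x::real)\<bar> \<le> 1" "\<bar>tanh (x::real)\<bar> \<le> 1"
  using cosh_real_ge_1[of x] tanh_real_bounds[of x] by (auto simp: divide_simps abs_le_iff)

text \<open>\<open>F\<close> has the form of the mean curvature equation in the boost parameter,
  divided by \<open>cosh \<mu>\<close>. The functions \<open>1 / cosh\<close> and
  \<open>tanh\<close> in it are bounded by 1 and Lipschitz with constant 1, so estimates over a
  compact part of \<open>D\<close> are uniform in \<open>\<mu>\<close>, however close to null the
  graph is.\<close>

locale cmc_flow =
  fixes D :: "(real \<times> real) set"
    and c0 c1 c2 c0T c0X c1T c1X c2T c2X :: "real \<times> real \<Rightarrow> real"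
  assumes open_D: "open D"
    and c0: "c1_on D c0 c0T c0X" and c1: "c1_on D c1 c1T c1X" and c2: "c1_on D c2 c2T c2X"
begin

definition F :: "real \<times> real \<Rightarrow> real \<Rightarrow> real" where
  "F x \<mu> = c0 x * (1 / cosh \<mu>) + c1 x + c2 x * tanh \<mu>"

definition F_T :: "real \<times> real \<Rightarrow> real \<Rightarrow> real" where
  "F_T x \<mu> = c0T x * (1 / cosh \<mu>) + c1T x + c2T x * tanh \<mu>"

definition F_\<mu> :: "real \<times> real \<Rightarrow> real \<Rightarrow> real" where
  "F_\<mu> x \<mu> = c0 x * (- sinh \<mu> / (cosh \<mu>)\<^sup>2) + c2 x * (1 / (cosh \<mu>)\<^sup>2)"

definition sol :: "real set \<Rightarrow> (real \<Rightarrow> real) \<Rightarrow> (real \<Rightarrow> real) \<Rightarrow> bool" where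
  "sol I f \<mu> \<longleftrightarrow> (\<forall>X\<in>I. (f X, X) \<in> D \<and>
     (f has_real_derivative tanh (\<mu> X)) (at X within I) \<and>
     (\<mu> has_real_derivative F (f X, X) (\<mu> X)) (at X within I))"

text \<open>Projecting to \<open>K\<close> makes the right-hand side globally Lipschitz, hence solutions global.\<close>

definition ksol :: "(real \<times> real) set \<Rightarrow> real set \<Rightarrow> (real \<Rightarrow> real) \<Rightarrow> (real \<Rightarrow> real) \<Rightarrow> bool" where
  "ksol K I f \<mu> \<longleftrightarrow> (\<forall>X\<in>I.
     (f has_real_derivative tanh (\<mu> X)) (at X within I) \<and>
     (\<mu> has_real_derivative F (closest_point K (f X, X)) (\<mu> X)) (at X within I))"

lemma F_bounded_lipschitz:
  assumes K: "compact K" "convex K" "K \<subseteq> D"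
  shows "\<exists>B>0. (\<forall>x\<in>K. \<forall>\<mu>. \<bar>F x \<mu>\<bar> \<le> B) \<and>
     (\<forall>x\<in>K. \<forall>y\<in>K. \<forall>\<mu> \<nu>. \<bar>F x \<mu> - F y \<nu>\<bar> \<le> B * (norm (x - y) + \<bar>\<mu> - \<nu>\<bar>))"
proof -
  obtain B0 where B0: "B0 > 0" "\<And>x. x \<in> K \<Longrightarrow> \<bar>c0 x\<bar> \<le> B0"
    "\<And>x y. x \<in> K \<Longrightarrow> y \<in> K \<Longrightarrow> \<bar>c0 x - c0 y\<bar> \<le> B0 * norm (x - y)"
    using c1_on_bounded_lipschitz[OF c0 K] by blast
  obtain B1 where B1: "B1 > 0" "\<And>x. x \<in> K \<Longrightarrow> \<bar>c1 x\<bar> \<le> B1"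
    "\<And>x y. x \<in> K \<Longrightarrow> y \<in> K \<Longrightarrow> \<bar>c1 x - c1 y\<bar> \<le> B1 * norm (x - y)"
    using c1_on_bounded_lipschitz[OF c1 K] by blast
  obtain B2 where B2: "B2 > 0" "\<And>x. x \<in> K \<Longrightarrow> \<bar>c2 x\<bar> \<le> B2"
    "\<And>x y. x \<in> K \<Longrightarrow> y \<in> K \<Longrightarrow> \<bar>c2 x - c2 y\<bar> \<le> B2 * norm (x - y)"
    using c1_on_bounded_lipschitz[OF c2 K] by blast
  define B where "B = B0 + B1 + B2"
  have prod: "\<bar>a * g\<bar> \<le> b" if "\<bar>a\<bar> \<le> b" "\<bar>g\<bar> \<le> 1" for a b g :: real
    unfolding abs_mult using mult_mono[OF that] that by simp
  have prod2: "\<bar>a * g - a' * g'\<bar> \<le> b * n + b * \<bar>\<mu> - \<nu>\<bar>"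
    if "\<bar>a - a'\<bar> \<le> b * n" "\<bar>a'\<bar> \<le> b" "\<bar>g\<bar> \<le> 1" "\<bar>g - g'\<bar> \<le> \<bar>\<mu> - \<nu>\<bar>" for a a' g g' b n \<mu> \<nu> :: real
  proof -
    have "a * g - a' * g' = (a - a') * g + a' * (g - g')" by (simp add: algebra_simps)
    moreover have "\<bar>(a - a') * g\<bar> \<le> b * n" using prod that by blast
    moreover have "\<bar>a' * (g - g')\<bar> \<le> b * \<bar>\<mu> - \<nu>\<bar>"
      unfolding abs_mult using that by (intro mult_mono) auto
    ultimately show ?thesis by linarith
  qed
  have "\<bar>F x \<mu>\<bar> \<le> B" if "x \<in> K" for x \<mu>
    using prod[OF B0(2)[OF that] sech_bounds(1)[of \<mu>]] B1(2)[OF that]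
      prod[OF B2(2)[OF that] sech_bounds(2)[of \<mu>]] unfolding F_def B_def by linarith
  moreover have "\<bar>F x \<mu> - F y \<nu>\<bar> \<le> B * (norm (x - y) + \<bar>\<mu> - \<nu>\<bar>)" if "x \<in> K" "y \<in> K" for x y \<mu> \<nu>
  proof -
    have "\<bar>c0 x * (1 / cosh \<mu>) - c0 y * (1 / cosh \<nu>)\<bar> \<le> B0 * norm (x - y) + B0 * \<bar>\<mu> - \<nu>\<bar>"
      using that by (intro prod2 B0 sech_bounds sech_lipschitz)
    moreover have "\<bar>c2 x * tanh \<mu> - c2 y * tanh \<nu>\<bar> \<le> B2 * norm (x - y) + B2 * \<bar>\<mu> - \<nu>\<bar>"
      using that by (intro prod2 B2 sech_bounds tanh_lipschitz)
    moreover have "0 \<le> B1 * \<bar>\<mu> - \<nu>\<bar>" using B1(1) by simp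
    ultimately show ?thesis
      using B1(3)[OF that] unfolding F_def B_def distrib_left distrib_right by linarith
  qed
  moreover have "B > 0" using B0(1) B1(1) B2(1) by (simp add: B_def)
  ultimately show ?thesis by blast
qed

definition V :: "(real \<times> real) set \<Rightarrow> real \<Rightarrow> real \<times> real \<Rightarrow> real \<times> real" where
  "V K X y = (tanh (snd y), F (closest_point K (fst y, X)) (snd y))"

lemma V_bounds:
  assumes K: "compact K" "convex K" "K \<subseteq> D" "K \<noteq> {}"
  shows "\<exists>B L. L > 0 \<and> (\<forall>X y. norm (V K X y) \<le> B) \<and>
     (\<forall>X y z. norm (V K X y - V K X z) \<le> L * norm (y - z))"
    and "continuous_on UNIV (\<lambda>(X, y). V K X y)"
proof -
  have closed: "closed K" using K(1) by (rule compact_imp_closed)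
  have cp: "closest_point K x \<in> K" for x using closest_point_in_set closed K(4) by blast
  obtain B where B: "B > 0" "\<And>x \<mu>. x \<in> K \<Longrightarrow> \<bar>F x \<mu>\<bar> \<le> B"
    "\<And>x y \<mu> \<nu>. x \<in> K \<Longrightarrow> y \<in> K \<Longrightarrow> \<bar>F x \<mu> - F y \<nu>\<bar> \<le> B * (norm (x - y) + \<bar>\<mu> - \<nu>\<bar>)"
    using F_bounded_lipschitz[OF K(1-3)] by blast
  have np: "norm (a, b) \<le> \<bar>a\<bar> + \<bar>b\<bar>" for a b :: real
    using norm_Pair_le[of a b] by simp
  have "norm (V K X y) \<le> 1 + B" for X y
    unfolding V_def using np[of "tanh (snd y)"] sech_bounds(2)[of "snd y"] B(2)[OF cp]
    by (smt (verit))
  moreover have "norm (V K X y - V K X z) \<le> (1 + 2 * B) * norm (y - z)" for X y z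
  proof -
    \<comment> \<open>Projection to a convex set does not increase distances, so the Lipschitz bound
      on \<open>K\<close> carries over to all points.\<close>
    have "dist (closest_point K (fst y, X)) (closest_point K (fst z, X)) \<le> dist (fst y, X) (fst z, X)"
      using closest_point_lipschitz[OF K(2) closed K(4)] .
    also have "\<dots> = \<bar>fst (y - z)\<bar>" by (simp add: dist_Pair_Pair dist_norm)
    also have "\<dots> \<le> norm (y - z)" using norm_fst_le[of "fst (y - z)" "snd (y - z)"]
      by (simp only: prod.collapse real_norm_def)
    finally have 1: "norm (closest_point K (fst y, X) - closest_point K (fst z, X)) \<le> norm (y - z)"
      by (simp add: dist_norm)
    have "\<bar>snd (y - z)\<bar> \<le> norm (y - z)" using norm_snd_le[of "snd (y - z)" "fst (y - z)"]
      by (simp only: prod.collapse real_norm_def)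
    then have 2: "\<bar>snd y - snd z\<bar> \<le> norm (y - z)" by simp
    have "\<bar>F (closest_point K (fst y, X)) (snd y) - F (closest_point K (fst z, X)) (snd z)\<bar>
        \<le> B * (norm (y - z) + norm (y - z))"
      by (rule order_trans[OF B(3)[OF cp cp]]) (use 1 2 B(1) in \<open>intro mult_left_mono add_mono; simp\<close>)
    moreover have "\<bar>tanh (snd y) - tanh (snd z)\<bar> \<le> norm (y - z)"
      using tanh_lipschitz 2 order_trans by blast
    ultimately show ?thesis
      unfolding V_def using np[of "tanh (snd y) - tanh (snd z)"] by (simp add: algebra_simps) (smt (verit))
  qed
  moreover have "1 + 2 * B > 0" using B(1) by simp
  ultimately show "\<exists>B L. L > 0 \<and> (\<forall>X y. norm (V K X y) \<le> B) \<and>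
     (\<forall>X y z. norm (V K X y - V K X z) \<le> L * norm (y - z))" by blast
  have cc: "continuous_on UNIV (\<lambda>z::real \<times> real \<times> real. c (closest_point K (fst (snd z), fst z)))"
    if "continuous_on D c" for c :: "real \<times> real \<Rightarrow> real"
  proof -
    have "continuous_on UNIV (\<lambda>z::real \<times> real \<times> real. (fst (snd z), fst z))"
      by (intro continuous_intros)
    then have "continuous_on UNIV (\<lambda>z::real \<times> real \<times> real. closest_point K (fst (snd z), fst z))"
      by (rule continuous_on_compose2[OF continuous_on_closest_point[OF K(2) closed K(4)], where t = UNIV]) simp
    then show ?thesis
      by (rule continuous_on_compose2[OF that]) (rule image_subsetI, rule subsetD[OF K(3) cp])
  qed
  have ct: "continuous_on UNIV (\<lambda>z::real \<times> real \<times> real. tanh (snd (snd z)))"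
    by (intro continuous_on_tanh continuous_on_snd continuous_on_id) auto
  have ch: "continuous_on UNIV (\<lambda>z::real \<times> real \<times> real. cosh (snd (snd z)))"
    by (intro continuous_on_cosh continuous_on_snd continuous_on_id)
  show "continuous_on UNIV (\<lambda>(X, y). V K X y)"
    unfolding V_def F_def split_beta
    by (intro continuous_on_Pair continuous_on_add continuous_on_mult continuous_on_divide continuous_on_const
        ct ch cc c1_on_continuous[OF c0] c1_on_continuous[OF c1] c1_on_continuous[OF c2]) auto
qed

lemma ksol_iff: "ksol K I f \<mu> \<longleftrightarrow>
   (\<forall>X\<in>I. ((\<lambda>X. (f X, \<mu> X)) has_vector_derivative V K X (f X, \<mu> X)) (at X within I))"
proof -
  have "((\<lambda>X. (f X, \<mu> X)) has_vector_derivative (a, b)) (at X within I) \<longleftrightarrow>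
     (f has_real_derivative a) (at X within I) \<and> (\<mu> has_real_derivative b) (at X within I)" for a b X
    unfolding has_real_derivative_iff_has_vector_derivative
    by (auto intro!: has_vector_derivative_Pair dest: bounded_linear.has_vector_derivative[OF bounded_linear_fst]
        bounded_linear.has_vector_derivative[OF bounded_linear_snd])
  then show ?thesis unfolding ksol_def V_def by simp
qed

lemma ksol_exists:
  assumes K: "compact K" "convex K" "K \<subseteq> D" "K \<noteq> {}"
  shows "\<exists>f \<mu>. ksol K UNIV f \<mu> \<and> f X0 = T0 \<and> \<mu> X0 = \<mu>0"
proof -
  obtain B L where "L > 0" "\<And>X y. norm (V K X y) \<le> B"
     "\<And>X y z. norm (V K X y - V K X z) \<le> L * norm (y - z)"
    using V_bounds(1)[OF K] by blast
  with picard_lindelof_global[OF V_bounds(2)[OF K], of B L X0 "(T0, \<mu>0)"] obtain y where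
    y: "y X0 = (T0, \<mu>0)" "\<And>X. (y has_vector_derivative V K X (y X)) (at X)" by blast
  have "ksol K UNIV (\<lambda>X. fst (y X)) (\<lambda>X. snd (y X))"
    using y(2) by (simp add: ksol_iff)
  then show ?thesis
    using y(1) by (intro exI[of _ "\<lambda>X. fst (y X)"] exI[of _ "\<lambda>X. snd (y X)"]) simp
qed

text \<open>\<open>L\<close> depends on \<open>K\<close> alone. This uniformity is what makes the
  boost at the axis a continuous function of the shooting parameter.\<close>

lemma ksol_gronwall:
  assumes K: "compact K" "convex K" "K \<subseteq> D" "K \<noteq> {}"
  shows "\<exists>L>0. \<forall>a b f \<mu> g \<nu>. ksol K {a..b} f \<mu> \<longrightarrow> ksol K {a..b} g \<nu> \<longrightarrow>
     (\<forall>X0\<in>{a..b}. \<forall>X\<in>{a..b}. norm (f X - g X, \<mu> X - \<nu> X)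
        \<le> exp (L * \<bar>X - X0\<bar>) * norm (f X0 - g X0, \<mu> X0 - \<nu> X0))"
proof -
  obtain L where L: "L > 0" "\<And>X y z. norm (V K X y - V K X z) \<le> L * norm (y - z)"
    using V_bounds(1)[OF K] by blast
  have "norm ((f X, \<mu> X) - (g X, \<nu> X)) \<le> exp (L * \<bar>X - X0\<bar>) * norm ((f X0, \<mu> X0) - (g X0, \<nu> X0))"
    if "ksol K {a..b} f \<mu>" "ksol K {a..b} g \<nu>" "X0 \<in> {a..b}" "X \<in> {a..b}" for a b f \<mu> g \<nu> X X0
    by (rule gronwall_lipschitz[where y = "\<lambda>X. (f X, \<mu> X)" and z = "\<lambda>X. (g X, \<nu> X)" and F = "V K"])
      (use that L in \<open>auto simp: ksol_iff\<close>)
  then show ?thesis using L(1) by (intro exI[of _ L]) (simp del: atLeastAtMost_iff)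
qed

lemma ksol_subset: "ksol K I f \<mu> \<Longrightarrow> J \<subseteq> I \<Longrightarrow> ksol K J f \<mu>"
  unfolding ksol_def by (intro ballI conjI; rule DERIV_subset[where s = I]) auto

lemma sol_subset: "sol I f \<mu> \<Longrightarrow> J \<subseteq> I \<Longrightarrow> sol J f \<mu>"
  unfolding sol_def by (intro ballI conjI; (rule DERIV_subset[where s = I])?) auto

lemma sol_imp_ksol:
  "sol I f \<mu> \<Longrightarrow> (\<And>X. X \<in> I \<Longrightarrow> (f X, X) \<in> K) \<Longrightarrow> ksol K I f \<mu>"
  unfolding sol_def ksol_def by (simp add: closest_point_self)

lemma ksol_imp_sol:
  "ksol K I f \<mu> \<Longrightarrow> K \<subseteq> D \<Longrightarrow> (\<And>X. X \<in> I \<Longrightarrow> (f X, X) \<in> K) \<Longrightarrow> sol I f \<mu>"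
  unfolding sol_def ksol_def by (auto simp: closest_point_self)

text \<open>The slope never exceeds that of a null line, so the graph stays in the light cone of
  each of its points; this keeps graphs inside balls and triangles below.\<close>

lemma slope_lipschitz:
  assumes "convex I" "\<And>X. X \<in> I \<Longrightarrow> (f has_real_derivative tanh (\<mu> X)) (at X within I)"
    and "X \<in> I" "Y \<in> I"
  shows "\<bar>f X - f Y\<bar> \<le> \<bar>X - Y\<bar>"
  using field_differentiable_bound[OF assms(1,2) _ assms(3,4), where B = 1] sech_bounds(2) by simp

lemma sol_lipschitz: "sol I f \<mu> \<Longrightarrow> convex I \<Longrightarrow> X \<in> I \<Longrightarrow> Y \<in> I \<Longrightarrow> \<bar>f X - f Y\<bar> \<le> \<bar>X - Y\<bar>"
  using slope_lipschitz[of I f \<mu>] by (simp add: sol_def)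

lemma ksol_lipschitz: "ksol K I f \<mu> \<Longrightarrow> convex I \<Longrightarrow> X \<in> I \<Longrightarrow> Y \<in> I \<Longrightarrow> \<bar>f X - f Y\<bar> \<le> \<bar>X - Y\<bar>"
  using slope_lipschitz[of I f \<mu>] by (simp add: ksol_def)

lemma cball_subset_D:
  assumes "x \<in> D"
  obtains \<delta> where "\<delta> > 0" "cball x \<delta> \<subseteq> D"
proof -
  have "\<exists>\<delta>>0. cball x \<delta> \<subseteq> D"
    using open_D assms by (simp add: open_contains_cball)
  then show ?thesis using that by blast
qed

text \<open>\<open>F\<close> is Lipschitz only over compact convex parts of \<open>D\<close>, so the
  set of agreement is shown to be open and closed in the interval. Near a point of agreement both
  graphs lie in one closed ball inside \<open>D\<close>, where they solve the projected system and
  the Gronwall estimate applies.\<close>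

lemma sol_unique_Icc:
  assumes f: "sol {a..b} f \<mu>" and g: "sol {a..b} g \<nu>"
    and X0: "X0 \<in> {a..b}" "f X0 = g X0" "\<mu> X0 = \<nu> X0" and X: "X \<in> {a..b}"
  shows "f X = g X \<and> \<mu> X = \<nu> X"
proof -
  define S where "S = {X \<in> {a..b}. f X = g X \<and> \<mu> X = \<nu> X}"
  have cont: "continuous_on {a..b} f" "continuous_on {a..b} \<mu>"
    "continuous_on {a..b} g" "continuous_on {a..b} \<nu>"
    using f g unfolding sol_def by (auto intro: DERIV_continuous_on)
  have "closedin (top_of_set {a..b}) S"
  proof -
    have "S = {X \<in> {a..b}. f X - g X = 0} \<inter> {X \<in> {a..b}. \<mu> X - \<nu> X = 0}" by (auto simp: S_def)
    then show ?thesis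
      by (simp only:) (intro closedin_Int continuous_closedin_preimage_constant continuous_on_diff cont)
  qed
  moreover have "openin (top_of_set {a..b}) S"
    unfolding openin_contains_ball
  proof (intro conjI ballI)
    show "S \<subseteq> {a..b}" by (auto simp: S_def)
    fix X1 assume X1: "X1 \<in> S"
    then have X1': "X1 \<in> {a..b}" "f X1 = g X1" "\<mu> X1 = \<nu> X1" by (auto simp: S_def)
    have "(f X1, X1) \<in> D" using f X1'(1) unfolding sol_def by blast
    then obtain \<delta> where \<delta>: "\<delta> > 0" "cball (f X1, X1) \<delta> \<subseteq> D" by (rule cball_subset_D)
    define K where "K = cball (f X1, X1) \<delta>"
    have K: "compact K" "convex K" "K \<subseteq> D" "K \<noteq> {}" using \<delta> by (auto simp: K_def)
    \<comment> \<open>Half the radius suffices: over this range \<open>f\<close> also moves by at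
      most \<open>\<delta> / 2\<close>, and the two displacements add up to at most
      \<open>\<delta>\<close>.\<close>
    define a' where "a' = max a (X1 - \<delta> / 2)"
    define b' where "b' = min b (X1 + \<delta> / 2)"
    have sub: "{a'..b'} \<subseteq> {a..b}" "X1 \<in> {a'..b'}" using X1' \<delta> by (auto simp: a'_def b'_def)
    have inK: "(h X, X) \<in> K" if "sol {a..b} h \<eta>" "h X1 = f X1" "X \<in> {a'..b'}" for h \<eta> X
    proof -
      have "\<bar>h X - h X1\<bar> \<le> \<bar>X - X1\<bar>"
        using sol_lipschitz[OF that(1)] that(3) sub by auto
      moreover have "\<bar>X - X1\<bar> \<le> \<delta> / 2" using that(3) unfolding a'_def b'_def abs_le_iff by auto
      moreover have "norm (f X1 - h X, X1 - X) \<le> \<bar>f X1 - h X\<bar> + \<bar>X1 - X\<bar>"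
        using norm_Pair_le[of "f X1 - h X" "X1 - X"] by simp
      ultimately show ?thesis using that(2)
        unfolding K_def mem_cball dist_norm diff_Pair by linarith
    qed
    have kf: "ksol K {a'..b'} f \<mu>"
      using sol_imp_ksol[OF sol_subset[OF f sub(1)]] inK[OF f] by simp
    have kg: "ksol K {a'..b'} g \<nu>"
      using sol_imp_ksol[OF sol_subset[OF g sub(1)]] inK[OF g] X1' by simp
    obtain L where L: "\<And>X. X \<in> {a'..b'} \<Longrightarrow> norm (f X - g X, \<mu> X - \<nu> X)
        \<le> exp (L * \<bar>X - X1\<bar>) * norm (f X1 - g X1, \<mu> X1 - \<nu> X1)"
      using ksol_gronwall[OF K] kf kg sub(2) by blast
    have "X \<in> S" if "X \<in> ball X1 (\<delta> / 2) \<inter> {a..b}" for X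
    proof -
      have "X \<in> {a'..b'}" using that
        unfolding a'_def b'_def mem_ball dist_real_def Int_iff abs_less_iff by auto
      from L[OF this] X1' have "norm (f X - g X, \<mu> X - \<nu> X) \<le> 0" by (simp add: norm_Pair)
      then show ?thesis using that by (simp add: S_def zero_prod_def)
    qed
    then show "\<exists>e>0. ball X1 e \<inter> {a..b} \<subseteq> S"
      using \<delta>(1) by (intro exI[of _ "\<delta> / 2"]) auto
  qed
  ultimately have "S = {} \<or> S = {a..b}"
    using connected_Icc[of a b] unfolding connected_clopen by (elim allE[of _ S]) blast
  moreover have "X0 \<in> S" using X0 by (simp add: S_def)
  ultimately have "X \<in> S" using X by blast
  then show ?thesis unfolding S_def by blast
qed

lemma sol_unique:
  assumes "is_interval I" "sol I f \<mu>" "sol I g \<nu>"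
    and "X0 \<in> I" "f X0 = g X0" "\<mu> X0 = \<nu> X0" "X \<in> I"
  shows "f X = g X \<and> \<mu> X = \<nu> X"
proof -
  have sub: "{min X0 X..max X0 X} \<subseteq> I"
  proof
    fix Y assume Y: "Y \<in> {min X0 X..max X0 X}"
    show "Y \<in> I"
      using mem_is_interval_1_I[OF assms(1) assms(4,7), of Y] mem_is_interval_1_I[OF assms(1) assms(7,4), of Y] Y
      by (cases "X0 \<le> X") auto
  qed
  show ?thesis
    by (rule sol_unique_Icc[OF sol_subset[OF assms(2) sub] sol_subset[OF assms(3) sub]])
      (use assms in auto)
qed

lemma sol_open: "open I \<Longrightarrow> sol I f \<mu> \<longleftrightarrow> (\<forall>X\<in>I. (f X, X) \<in> D \<and>
     (f has_real_derivative tanh (\<mu> X)) (at X) \<and>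
     (\<mu> has_real_derivative F (f X, X) (\<mu> X)) (at X))"
  unfolding sol_def by (rule ball_cong[OF refl]) (simp only: at_within_open)

lemma sol_cong:
  assumes f: "sol I f \<mu>" and eq: "\<And>X. X \<in> I \<Longrightarrow> f X = g X \<and> \<mu> X = \<nu> X"
  shows "sol I g \<nu>"
  unfolding sol_def
proof (intro ballI)
  fix X assume X: "X \<in> I"
  have *: "(h has_real_derivative d) (at X within I)"
    if "(k has_real_derivative d) (at X within I)" "\<And>X. X \<in> I \<Longrightarrow> h X = k X" for h k d
    using has_derivative_transform[OF X that(2)] that(1) by (simp add: has_field_derivative_def)
  have "(f X, X) \<in> D" "(f has_real_derivative tanh (\<mu> X)) (at X within I)"
    "(\<mu> has_real_derivative F (f X, X) (\<mu> X)) (at X within I)"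
    using f X by (simp_all add: sol_def)
  with * eq X show "(g X, X) \<in> D \<and> (g has_real_derivative tanh (\<nu> X)) (at X within I) \<and>
      (\<nu> has_real_derivative F (g X, X) (\<nu> X)) (at X within I)" by simp
qed

lemma sol_glue:
  assumes "open I" "open J" "sol I f \<mu>" "sol J f \<mu>"
  shows "sol (I \<union> J) f \<mu>"
  using assms(3,4) unfolding sol_open[OF assms(1)] sol_open[OF assms(2)] sol_open[OF open_Un[OF assms(1,2)]]
  by blast

lemma F_T_deriv:
  assumes "(T, X) \<in> D"
  shows "((\<lambda>T. F (T, X) \<mu>) has_real_derivative F_T (T, X) \<mu>) (at T)"
proof -
  have *: "((\<lambda>T. c (T, X)) has_real_derivative c1 (T, X)) (at T)" if "c1_on D c c1 c2" for c c1 c2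
  proof -
    have "(c has_derivative (\<lambda>h. c1 (T, X) * fst h + c2 (T, X) * snd h)) (at (T, X))"
      using that assms by (auto simp: c1_on_def)
    then have "((\<lambda>T. c (T, X)) has_derivative (\<lambda>h. c1 (T, X) * fst (h, 0::real) + c2 (T, X) * snd (h, 0::real))) (at T)"
      by (rule has_derivative_compose[rotated]) (auto intro!: derivative_eq_intros)
    then show ?thesis by (simp add: has_field_derivative_def)
  qed
  show ?thesis unfolding F_def F_T_def
    by (intro DERIV_add DERIV_cmult_right *[OF c0] *[OF c1] *[OF c2])
qed

lemma F_\<mu>_deriv: "((\<lambda>\<mu>. F x \<mu>) has_real_derivative F_\<mu> x \<mu>) (at \<mu>)"
proof -
  have "((\<lambda>\<mu>. c0 x * (1 / cosh \<mu>) + c1 x + c2 x * tanh \<mu>) has_real_derivative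
      c0 x * (- sinh \<mu> / (cosh \<mu>)\<^sup>2) + 0 + c2 x * (1 / (cosh \<mu>)\<^sup>2)) (at \<mu>)"
    by (intro DERIV_add DERIV_cmult DERIV_const sech_has_derivative tanh_has_derivative)
  then show ?thesis unfolding F_def F_\<mu>_def by (simp only: add_0_right)
qed

lemma continuous_F_partials:
  "continuous_on (D \<times> UNIV) (\<lambda>(x, \<mu>). F_T x \<mu>)"
  "continuous_on (D \<times> UNIV) (\<lambda>(x, \<mu>). F_\<mu> x \<mu>)"
proof -
  have cc: "continuous_on (D \<times> UNIV) (\<lambda>z::(real \<times> real) \<times> real. c (fst z))" if "continuous_on D c" for c :: "real \<times> real \<Rightarrow> real"
    by (rule continuous_on_compose2[OF that continuous_on_fst[OF continuous_on_id]]) auto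
  have h: "continuous_on A (\<lambda>z::(real \<times> real) \<times> real. cosh (snd z))"
      "continuous_on A (\<lambda>z::(real \<times> real) \<times> real. sinh (snd z))"
      "continuous_on A (\<lambda>z::(real \<times> real) \<times> real. tanh (snd z))" for A
    by (intro continuous_on_cosh continuous_on_sinh continuous_on_tanh continuous_on_snd continuous_on_id; simp)+
  note cs = continuous_on_add continuous_on_mult continuous_on_divide continuous_on_const continuous_on_minus continuous_on_power h
  have "continuous_on D c0T" "continuous_on D c1T" "continuous_on D c2T"
    using c0 c1 c2 by (auto simp: c1_on_def)
  then show "continuous_on (D \<times> UNIV) (\<lambda>(x, \<mu>). F_T x \<mu>)"
    unfolding F_T_def split_beta by (intro cs cc; simp)
  show "continuous_on (D \<times> UNIV) (\<lambda>(x, \<mu>). F_\<mu> x \<mu>)"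
    unfolding F_\<mu>_def split_beta
    by (intro cs cc c1_on_continuous[OF c0] c1_on_continuous[OF c2]; simp)
qed

end

text \<open>\<open>triangle\<close> is the causal shape of the left half: a spacelike graph cannot
  leave \<open>D\<close> on its way to the axis. \<open>riccati\<close> concerns the coefficient
  with which the height variation \<open>u\<close> drives
  \<open>v = \<delta>\<mu> + \<kappa> * u\<close>. Being strict and continuous along a compact piece
  of a solution, it tolerates the replacement of derivatives by nearby mean values.\<close>

locale cmc_foliation = cmc_flow +
  fixes \<kappa> \<kappa>' :: "real \<times> real \<Rightarrow> real \<Rightarrow> real"
  assumes sym_D: "(T, X) \<in> D \<Longrightarrow> (T, - X) \<in> D"
    and c_sym: "(T, X) \<in> D \<Longrightarrow> c0 (T, - X) = c0 (T, X) \<and> c1 (T, - X) = c1 (T, X) \<and> c2 (T, - X) = - c2 (T, X)"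
    and triangle: "(T, X) \<in> D \<Longrightarrow> X \<le> X' \<Longrightarrow> X' \<le> 0 \<Longrightarrow> \<bar>T' - T\<bar> \<le> X' - X \<Longrightarrow> (T', X') \<in> D"
    and axis: "(T, 0) \<in> D"
    and \<kappa>_axis: "\<kappa> (T, 0) 0 = 0"
    and \<kappa>_deriv: "sol I f \<mu> \<Longrightarrow> X \<in> I \<Longrightarrow>
      ((\<lambda>X. \<kappa> (f X, X) (\<mu> X)) has_real_derivative \<kappa>' (f X, X) (\<mu> X)) (at X within I)"
    and \<kappa>'_cont: "continuous_on (D \<times> UNIV) (\<lambda>(x, m). \<kappa>' x m)"
    and riccati: "x \<in> D \<Longrightarrow> \<kappa>' x m + F_T x m - \<kappa> x m * F_\<mu> x m - (\<kappa> x m)\<^sup>2 * (1 / (cosh m)\<^sup>2) > 0"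
begin

text \<open>Passing from \<open>m1\<close> to \<open>m2\<close> at height \<open>t1\<close> and then
  from \<open>t1\<close> to \<open>t2\<close> at boost \<open>m2\<close> needs one-variable mean
  values only. The intermediate points lie between the two solutions, hence are close to both when
  these are close to each other.\<close>

lemma mean_value_coefficients:
  assumes K: "convex K" "K \<subseteq> D" and t: "(t1, X) \<in> K" "(t2, X) \<in> K"
  shows "\<exists>z\<in>closed_segment t1 t2. \<exists>m\<in>closed_segment m1 m2. (z, X) \<in> K \<and>
    F (t2, X) m2 - F (t1, X) m1 = F_T (z, X) m2 * (t2 - t1) + F_\<mu> (t1, X) m * (m2 - m1)"
proof -
  have seg: "(z, X) \<in> K" if zs: "z \<in> closed_segment t1 t2" for z
  proof -
    obtain u where "0 \<le> u" "u \<le> 1" "z = (1 - u) *\<^sub>R t1 + u *\<^sub>R t2"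
      using zs by (auto simp: in_segment)
    moreover have "(1 - u) * X + u * X = X" by (simp add: left_diff_distrib)
    ultimately have "(z, X) = (1 - u) *\<^sub>R (t1, X) + u *\<^sub>R (t2, X)"
      by (simp only: scaleR_Pair add_Pair real_scaleR_def)
    then have "(z, X) \<in> closed_segment (t1, X) (t2, X)"
      using \<open>0 \<le> u\<close> \<open>u \<le> 1\<close> by (simp only: in_segment) (intro exI[of _ u] conjI refl)
    then show ?thesis using closed_segment_subset[OF t K(1)] by blast
  qed
  obtain z where z: "z \<in> closed_segment t1 t2" "F (t2, X) m2 - F (t1, X) m2 = F_T (z, X) m2 * (t2 - t1)"
    using mvt_between[of t1 t2 "\<lambda>T. F (T, X) m2" "\<lambda>T. F_T (T, X) m2"] F_T_deriv seg K(2) by blast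
  obtain m where m: "m \<in> closed_segment m1 m2" "F (t1, X) m2 - F (t1, X) m1 = F_\<mu> (t1, X) m * (m2 - m1)"
    using mvt_between[of m1 m2 "\<lambda>m. F (t1, X) m" "\<lambda>m. F_\<mu> (t1, X) m"] F_\<mu>_deriv by blast
  have "F (t2, X) m2 - F (t1, X) m1 = F_T (z, X) m2 * (t2 - t1) + F_\<mu> (t1, X) m * (m2 - m1)"
    using z(2) m(2) by simp
  then show ?thesis using z(1) m(1) seg by blast
qed

lemma bounded_on_Icc:
  fixes g :: "real \<Rightarrow> real"
  assumes "continuous_on {a..b} g"
  obtains M where "M \<ge> 0" "\<And>x. x \<in> {a..b} \<Longrightarrow> \<bar>g x\<bar> \<le> M"
proof -
  have "bounded (g ` {a..b})" by (intro compact_imp_bounded compact_continuous_image assms) auto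
  then obtain M where "\<And>x. x \<in> {a..b} \<Longrightarrow> \<bar>g x\<bar> \<le> M" unfolding bounded_real by blast
  then show ?thesis using that[of "\<bar>M\<bar>"] by force
qed

lemma continuous_along_sol:
  assumes "sol I f \<mu>" "continuous_on (D \<times> UNIV) (\<lambda>(x, \<mu>). G x \<mu>)"
  shows "continuous_on I (\<lambda>X. G (f X, X) (\<mu> X))"
proof -
  have "continuous_on I f" "continuous_on I \<mu>"
    using assms(1) unfolding sol_def by (auto intro: DERIV_continuous_on)
  then have "continuous_on I (\<lambda>X. ((f X, X), \<mu> X))" by (intro continuous_on_Pair continuous_on_id)
  then have "continuous_on I (\<lambda>X. (\<lambda>(x, \<mu>). G x \<mu>) ((f X, X), \<mu> X))"
    by (rule continuous_on_compose2[OF assms(2)]) (use assms(1) in \<open>auto simp: sol_def\<close>)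
  then show ?thesis by simp
qed

text \<open>Local uniqueness of the shooting parameter: with \<open>\<kappa>\<close> the logarithmic derivative of the normal
  variation, the Riccati condition turns the equation for the difference of two solutions into
  a cooperative system.\<close>

lemma shooting_upcrossing:
  assumes K: "compact K" "convex K" "K \<subseteq> D" "K \<noteq> {}" and "a \<le> 0"
    and f: "sol {a..0} f \<mu>" and fK: "\<And>X. X \<in> {a..0} \<Longrightarrow> (f X, X) \<in> K" and "\<mu> 0 = 0"
  shows "\<exists>\<epsilon>>0. \<forall>g \<nu>. sol {a..0} g \<nu> \<longrightarrow> (\<forall>X\<in>{a..0}. (g X, X) \<in> K) \<longrightarrow> g a = f a \<longrightarrow>
     \<nu> a \<noteq> \<mu> a \<longrightarrow> \<bar>\<nu> a - \<mu> a\<bar> < \<epsilon> \<longrightarrow> (\<nu> a - \<mu> a) * \<nu> 0 > 0"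
proof -
  have cont: "continuous_on {a..0} \<mu>"
    using f unfolding sol_def by (auto intro: DERIV_continuous_on)
  obtain M where M: "M \<ge> 0" "\<And>X. X \<in> {a..0} \<Longrightarrow> \<bar>\<mu> X\<bar> \<le> M" by (rule bounded_on_Icc[OF cont]) blast
  \<comment> \<open>The margin 1 makes room for the boosts of all competitors, which will be
    \<open>\<delta> / 2\<close>-close with \<open>\<delta> \<le> 1\<close>.\<close>
  define Q where "Q = {-(M + 1)..M + 1}"
  define P where "P = K \<times> Q"
  have P: "compact P" "P \<subseteq> D \<times> UNIV" using K by (auto simp: P_def Q_def intro: compact_Times)
  define k where "k X = \<kappa> (f X, X) (\<mu> X)" for X
  define k' where "k' X = \<kappa>' (f X, X) (\<mu> X)" for X
  have k: "(k has_real_derivative k' X) (at X within {a..0})" if "X \<in> {a..0}" for X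
    unfolding k_def k'_def by (rule \<kappa>_deriv[OF f that])
  then have contk: "continuous_on {a..0} k" by (rule DERIV_continuous_on)
  obtain B where B: "B \<ge> 0" "\<And>X. X \<in> {a..0} \<Longrightarrow> \<bar>k X\<bar> \<le> B" by (rule bounded_on_Icc[OF contk]) blast
  have uc: "uniformly_continuous_on P (\<lambda>(x, \<mu>). F_T x \<mu>)" "uniformly_continuous_on P (\<lambda>(x, \<mu>). F_\<mu> x \<mu>)"
    using continuous_F_partials P by (auto intro!: compact_uniformly_continuous intro: continuous_on_subset)
  have ucs: "uniformly_continuous_on Q (\<lambda>x. 1 / (cosh x)\<^sup>2)"
    unfolding Q_def by (intro compact_uniformly_continuous continuous_intros) auto
  have "bounded ((\<lambda>(x, \<mu>). F_\<mu> x \<mu>) ` P)"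
    using continuous_F_partials(2) P
    by (intro compact_imp_bounded compact_continuous_image) (auto intro: continuous_on_subset)
  then obtain B\<mu> where B\<mu>: "\<And>x m. (x, m) \<in> P \<Longrightarrow> \<bar>F_\<mu> x m\<bar> \<le> B\<mu>"
    unfolding bounded_real by fastforce
  \<comment> \<open>The Riccati expression along the given solution. Its minimum over the compact
    interval is the room left for perturbing the coefficients.\<close>
  define R where "R X = k' X + F_T (f X, X) (\<mu> X) - k X * F_\<mu> (f X, X) (\<mu> X) - (k X)\<^sup>2 * (1 / (cosh (\<mu> X))\<^sup>2)" for X
  have "continuous_on {a..0} R"
    unfolding R_def k'_def
    by (intro continuous_on_add continuous_on_diff continuous_on_mult continuous_on_power contk cont
        continuous_along_sol[OF f] continuous_F_partials \<kappa>'_cont continuous_on_divide continuous_on_const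
        continuous_on_cosh) auto
  then obtain X\<rho> where X\<rho>: "X\<rho> \<in> {a..0}" "\<And>X. X \<in> {a..0} \<Longrightarrow> R X\<rho> \<le> R X"
    using continuous_attains_inf[of "{a..0}" R] \<open>a \<le> 0\<close> by auto
  define \<rho> where "\<rho> = R X\<rho>"
  have "\<rho> > 0" unfolding \<rho>_def R_def k_def k'_def
    using riccati[of "(f X\<rho>, X\<rho>)" "\<mu> X\<rho>"] fK[OF X\<rho>(1)] K(3) by blast
  \<comment> \<open>Errors in \<open>F_T\<close>, \<open>F_\<mu>\<close> and the derivative of
    \<open>tanh\<close> enter with factors 1, \<open>k\<close> and \<open>k^2\<close>; errors below
    \<open>\<eta>\<close> therefore cost at most
    \<open>\<eta> * (1 + B + B^2) = \<rho>\<close>.\<close>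
  define \<eta> where "\<eta> = \<rho> / (1 + B + B\<^sup>2)"
  have dn: "1 + B + B\<^sup>2 > 0" using B(1) by (simp add: add_pos_nonneg)
  then have "\<eta> > 0" and \<eta>B: "\<eta> * (1 + B + B\<^sup>2) = \<rho>" using \<open>\<rho> > 0\<close> by (auto simp: \<eta>_def)
  obtain \<delta>1 where \<delta>1: "\<delta>1 > 0" "\<And>x m x' m'. (x, m) \<in> P \<Longrightarrow> (x', m') \<in> P \<Longrightarrow> dist (x', m') (x, m) < \<delta>1 \<Longrightarrow> \<bar>F_T x' m' - F_T x m\<bar> < \<eta>"
    using uc(1)[unfolded uniformly_continuous_on_def, rule_format, OF \<open>\<eta> > 0\<close>] by (fastforce simp: dist_real_def)
  obtain \<delta>2 where \<delta>2: "\<delta>2 > 0" "\<And>x m x' m'. (x, m) \<in> P \<Longrightarrow> (x', m') \<in> P \<Longrightarrow> dist (x', m') (x, m) < \<delta>2 \<Longrightarrow> \<bar>F_\<mu> x' m' - F_\<mu> x m\<bar> < \<eta>"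
    using uc(2)[unfolded uniformly_continuous_on_def, rule_format, OF \<open>\<eta> > 0\<close>] by (fastforce simp: dist_real_def)
  obtain \<delta>3 where \<delta>3: "\<delta>3 > 0" "\<And>m m'. m \<in> Q \<Longrightarrow> m' \<in> Q \<Longrightarrow> \<bar>m' - m\<bar> < \<delta>3 \<Longrightarrow> \<bar>1 / (cosh m')\<^sup>2 - 1 / (cosh m)\<^sup>2\<bar> < \<eta>"
    using ucs[unfolded uniformly_continuous_on_def, rule_format, OF \<open>\<eta> > 0\<close>] unfolding dist_real_def by blast
  define \<delta> where "\<delta> = Min {1, \<delta>1, \<delta>2, \<delta>3}"
  have \<delta>: "\<delta> > 0" "\<delta> \<le> 1" "\<delta> \<le> \<delta>1" "\<delta> \<le> \<delta>2" "\<delta> \<le> \<delta>3" using \<delta>1(1) \<delta>2(1) \<delta>3(1) by (auto simp: \<delta>_def)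
  obtain L where L: "L > 0" "\<And>f \<mu> g \<nu> X0 X. ksol K {a..0} f \<mu> \<Longrightarrow> ksol K {a..0} g \<nu> \<Longrightarrow> X0 \<in> {a..0} \<Longrightarrow> X \<in> {a..0} \<Longrightarrow>
     norm (f X - g X, \<mu> X - \<nu> X) \<le> exp (L * \<bar>X - X0\<bar>) * norm (f X0 - g X0, \<mu> X0 - \<nu> X0)"
    using ksol_gronwall[OF K] by metis
  \<comment> \<open>The exponential is the Gronwall factor from \<open>a\<close> to the axis, so
    initial boosts this close keep the solutions \<open>\<delta> / 2\<close>-close
    throughout.\<close>
  define \<epsilon> where "\<epsilon> = \<delta> / 2 / exp (L * \<bar>a\<bar>)"
  have "\<epsilon> > 0" using \<delta> by (simp add: \<epsilon>_def)
  moreover have "(\<nu> a - \<mu> a) * \<nu> 0 > 0"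
    if g: "sol {a..0} g \<nu>" and gK: "\<And>X. X \<in> {a..0} \<Longrightarrow> (g X, X) \<in> K" and "g a = f a"
      and ne: "\<nu> a \<noteq> \<mu> a" and close: "\<bar>\<nu> a - \<mu> a\<bar> < \<epsilon>" for g \<nu>
  proof -
    have near: "\<bar>g X - f X\<bar> < \<delta> / 2" "\<bar>\<nu> X - \<mu> X\<bar> < \<delta> / 2" if X: "X \<in> {a..0}" for X
    proof -
      have "norm (g X - f X, \<nu> X - \<mu> X) \<le> exp (L * \<bar>X - a\<bar>) * norm (g a - f a, \<nu> a - \<mu> a)"
        by (rule L(2)) (use f g fK gK X \<open>a \<le> 0\<close> in \<open>auto intro!: sol_imp_ksol\<close>)
      also have "\<dots> \<le> exp (L * \<bar>a\<bar>) * \<bar>\<nu> a - \<mu> a\<bar>"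
        using X L(1) \<open>g a = f a\<close> mult_left_mono[of "X - a" "- a" L]
        by (intro mult_mono) (auto simp: norm_Pair)
      also have "\<dots> < exp (L * \<bar>a\<bar>) * \<epsilon>" using close by simp
      also have "\<dots> = \<delta> / 2" by (simp add: \<epsilon>_def)
      finally have n: "norm (g X - f X, \<nu> X - \<mu> X) < \<delta> / 2" .
      show "\<bar>g X - f X\<bar> < \<delta> / 2" "\<bar>\<nu> X - \<mu> X\<bar> < \<delta> / 2"
        using n norm_fst_le[of "g X - f X" "\<nu> X - \<mu> X"] norm_snd_le[of "\<nu> X - \<mu> X" "g X - f X"]
        by (auto simp: real_norm_def)
    qed
    \<comment> \<open>The sign of the initial difference is factored out, so that \<open>v\<close>
      starts positive in both cases, while \<open>u\<close> starts at 0.\<close>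
    define \<sigma> where "\<sigma> = sgn (\<nu> a - \<mu> a)"
    define u where "u X = \<sigma> * (g X - f X)" for X
    \<comment> \<open>To first order this is the arc length derivative of the normal variation.
      Without the correction \<open>k * u\<close> the coefficient of \<open>u\<close> in the second
      equation would be a mean value of \<open>F_T\<close>, whose sign is not controlled.\<close>
    define v where "v X = \<sigma> * (\<nu> X - \<mu> X) + k X * u X" for X
    define u' where "u' X = \<sigma> * (tanh (\<nu> X) - tanh (\<mu> X))" for X
    define v' where "v' X = \<sigma> * (F (g X, X) (\<nu> X) - F (f X, X) (\<mu> X)) + (k' X * u X + u' X * k X)" for X
    \<comment> \<open>The exact differences satisfy a linear system with mean values as
      coefficients. Its diagonal entries are bounded; its off-diagonal entries,
      \<open>\<alpha>\<close> and the bracket in front of \<open>u X\<close>, are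
      nonnegative.\<close>
    have coeff: "\<exists>\<alpha> b1 b2. u' X = \<alpha> * (v X - k X * u X) \<and> 0 \<le> \<alpha> \<and> \<alpha> \<le> 1 \<and>
        v' X = (b1 + k' X - k X * b2 - (k X)\<^sup>2 * \<alpha>) * u X + (b2 + k X * \<alpha>) * v X \<and>
        \<bar>b2\<bar> \<le> B\<mu> \<and> b1 + k' X - k X * b2 - (k X)\<^sup>2 * \<alpha> \<ge> 0" if X: "X \<in> {a..0}" for X
    proof -
      obtain m0 where m0: "m0 \<in> closed_segment (\<mu> X) (\<nu> X)" "tanh (\<nu> X) - tanh (\<mu> X) = 1 / (cosh m0)\<^sup>2 * (\<nu> X - \<mu> X)"
        using mvt_between[OF tanh_has_derivative] by blast
      obtain z m where zm: "z \<in> closed_segment (f X) (g X)" "m \<in> closed_segment (\<mu> X) (\<nu> X)" "(z, X) \<in> K"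
        "F (g X, X) (\<nu> X) - F (f X, X) (\<mu> X) = F_T (z, X) (\<nu> X) * (g X - f X) + F_\<mu> (f X, X) m * (\<nu> X - \<mu> X)"
        using mean_value_coefficients[OF K(2,3) fK[OF X] gK[OF X], of "\<mu> X" "\<nu> X"] by blast
      have seg: "\<bar>w - x\<bar> \<le> \<bar>y - x\<bar>" if "w \<in> closed_segment x y" for w x y :: real
        using that by (auto simp: closed_segment_eq_real_ivl split: if_splits)
      have d: "\<bar>z - f X\<bar> < \<delta> / 2" "\<bar>m - \<mu> X\<bar> < \<delta> / 2" "\<bar>m0 - \<mu> X\<bar> < \<delta> / 2"
        using seg[OF zm(1)] seg[OF zm(2)] seg[OF m0(1)] near[OF X] by linarith+
      have inQ: "\<mu> X \<in> Q" "\<nu> X \<in> Q" "m \<in> Q" "m0 \<in> Q"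
        using M(2)[OF X] d near[OF X] \<delta>(1,2) unfolding Q_def atLeastAtMost_iff by linarith+
      define \<alpha> where "\<alpha> = 1 / (cosh m0)\<^sup>2"
      define b1 where "b1 = F_T (z, X) (\<nu> X)"
      define b2 where "b2 = F_\<mu> (f X, X) m"
      have ds: "dist ((p, X), q) ((p', X), q') \<le> \<bar>p - p'\<bar> + \<bar>q - q'\<bar>" for p q p' q' :: real
        using norm_Pair_le[of "(p - p', 0::real)" "q - q'"] by (simp add: dist_norm norm_Pair)
      have b1: "\<bar>b1 - F_T (f X, X) (\<mu> X)\<bar> < \<eta>" unfolding b1_def
        by (rule \<delta>1(2)) (use zm(3) fK[OF X] inQ ds[of z "\<nu> X" "f X" "\<mu> X"] d near[OF X] \<delta> in \<open>auto simp: P_def\<close>)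
      have b2: "\<bar>b2 - F_\<mu> (f X, X) (\<mu> X)\<bar> < \<eta>" unfolding b2_def
        by (rule \<delta>2(2)) (use zm(3) fK[OF X] inQ ds[of "f X" m "f X" "\<mu> X"] d near[OF X] \<delta> in \<open>auto simp: P_def\<close>)
      have \<alpha>: "\<bar>\<alpha> - 1 / (cosh (\<mu> X))\<^sup>2\<bar> < \<eta>" unfolding \<alpha>_def
        by (rule \<delta>3(2)) (use inQ d \<delta> in auto)
      have \<alpha>01: "0 \<le> \<alpha>" "\<alpha> \<le> 1" using cosh_real_ge_1[of m0] by (auto simp: \<alpha>_def divide_simps)
      have u'_eq: "u' X = \<alpha> * (v X - k X * u X)"
        unfolding u'_def m0(2) \<alpha>_def[symmetric] by (simp add: v_def algebra_simps)
      have v'_eq: "v' X = (b1 + k' X - k X * b2 - (k X)\<^sup>2 * \<alpha>) * u X + (b2 + k X * \<alpha>) * v X"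
        unfolding v'_def u'_eq zm(4) b1_def[symmetric] b2_def[symmetric]
        by (simp add: v_def u_def algebra_simps power2_eq_square)
      have "\<bar>k X * (b2 - F_\<mu> (f X, X) (\<mu> X))\<bar> \<le> B * \<eta>"
        unfolding abs_mult using B(2)[OF X] b2 B(1) by (intro mult_mono) auto
      moreover have "\<bar>(k X)\<^sup>2 * (\<alpha> - 1 / (cosh (\<mu> X))\<^sup>2)\<bar> \<le> B\<^sup>2 * \<eta>"
        unfolding abs_mult using B(2)[OF X] \<alpha> B(1)
        by (intro mult_mono) (auto simp: abs_le_square_iff[symmetric])
      moreover have "R X \<ge> \<eta> + B * \<eta> + B\<^sup>2 * \<eta>"
        using X\<rho>(2)[OF X] \<eta>B by (simp add: \<rho>_def algebra_simps)
      moreover have "b1 + k' X - k X * b2 - (k X)\<^sup>2 * \<alpha> = R X + (b1 - F_T (f X, X) (\<mu> X))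
          - k X * (b2 - F_\<mu> (f X, X) (\<mu> X)) - (k X)\<^sup>2 * (\<alpha> - 1 / (cosh (\<mu> X))\<^sup>2)"
        by (simp add: R_def algebra_simps)
      ultimately have "b1 + k' X - k X * b2 - (k X)\<^sup>2 * \<alpha> \<ge> 0" using b1 by linarith
      moreover have "\<bar>b2\<bar> \<le> B\<mu>" unfolding b2_def
        by (rule B\<mu>) (use fK[OF X] inQ in \<open>auto simp: P_def\<close>)
      ultimately show ?thesis using u'_eq v'_eq \<alpha>01 by blast
    qed
    have ud: "(u has_real_derivative u' X) (at X within {a..0})" if "X \<in> {a..0}" for X
      unfolding u_def u'_def using f g that unfolding sol_def by (intro DERIV_cmult DERIV_diff) auto
    have vd: "(v has_real_derivative v' X) (at X within {a..0})" if "X \<in> {a..0}" for X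
      unfolding v_def v'_def using f g that ud[OF that] k[OF that] unfolding sol_def
      by (intro DERIV_cmult DERIV_diff DERIV_add DERIV_mult) auto
    \<comment> \<open>The constant \<open>\<bar>B\<mu>\<bar> + B\<close> bounds both diagonal
      coefficients, \<open>- k * \<alpha>\<close> and \<open>b2 + k * \<alpha>\<close>.\<close>
    have "v 0 > 0"
    proof (rule cooperative_positive[OF ud vd, where C = "\<bar>B\<mu>\<bar> + B"])
      fix X assume X: "X \<in> {a..0}"
      obtain \<alpha> b1 b2 where c: "u' X = \<alpha> * (v X - k X * u X)" "0 \<le> \<alpha>" "\<alpha> \<le> 1"
        "v' X = (b1 + k' X - k X * b2 - (k X)\<^sup>2 * \<alpha>) * u X + (b2 + k X * \<alpha>) * v X"
        "\<bar>b2\<bar> \<le> B\<mu>" "b1 + k' X - k X * b2 - (k X)\<^sup>2 * \<alpha> \<ge> 0"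
        using coeff[OF X] by blast
      have k\<alpha>: "\<bar>k X * \<alpha>\<bar> \<le> B" using B(2)[OF X] c(2,3) unfolding abs_mult
        by (metis abs_ge_zero abs_of_nonneg mult_left_le order_trans)
      show "u' X \<ge> - (\<bar>B\<mu>\<bar> + B) * \<bar>u X\<bar>" if "v X \<ge> 0"
      proof -
        have "\<bar>(k X * \<alpha>) * u X\<bar> \<le> (\<bar>B\<mu>\<bar> + B) * \<bar>u X\<bar>"
          unfolding abs_mult[of _ "u X"] using k\<alpha> by (intro mult_right_mono) auto
        moreover have "\<alpha> * v X \<ge> 0" using that c by simp
        ultimately show ?thesis unfolding c(1) by (simp add: algebra_simps)
      qed
      show "v' X \<ge> - (\<bar>B\<mu>\<bar> + B) * \<bar>v X\<bar>" if "u X \<ge> 0"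
      proof -
        have "\<bar>(b2 + k X * \<alpha>) * v X\<bar> \<le> (\<bar>B\<mu>\<bar> + B) * \<bar>v X\<bar>"
          unfolding abs_mult[of _ "v X"] using k\<alpha> c(5) by (intro mult_right_mono) auto
        moreover have "(b1 + k' X - k X * b2 - (k X)\<^sup>2 * \<alpha>) * u X \<ge> 0" using that c(6) by simp
        ultimately show ?thesis unfolding c(4) by linarith
      qed
    next
      show "u a \<ge> 0" using \<open>g a = f a\<close> by (simp add: u_def)
      show "v a > 0" using \<open>g a = f a\<close> ne
        by (simp add: v_def u_def \<sigma>_def sgn_mult_abs[symmetric] abs_sgn[symmetric] sgn_if)
    qed (use \<open>a \<le> 0\<close> in auto)
    \<comment> \<open>Here the symmetry enters: with \<open>k 0 = 0\<close> the quantity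
      \<open>v 0\<close> is the signed boost at the axis itself.\<close>
    moreover have "k 0 = 0" by (simp add: k_def \<open>\<mu> 0 = 0\<close> \<kappa>_axis)
    ultimately have "\<sigma> * \<nu> 0 > 0" by (simp add: v_def \<open>\<mu> 0 = 0\<close>)
    then show ?thesis using ne by (auto simp: \<sigma>_def sgn_if zero_less_mult_iff split: if_splits)
  qed
  ultimately show ?thesis by blast
qed

end

section \<open>Leaves\<close>

context cmc_foliation begin

definition leafsol :: "real \<Rightarrow> real \<Rightarrow> (real \<Rightarrow> real) \<Rightarrow> (real \<Rightarrow> real) \<Rightarrow> bool" where
  "leafsol T0 B f \<mu> \<longleftrightarrow> B > 0 \<and> sol {-B<..<B} f \<mu> \<and> f 0 = T0 \<and> \<mu> 0 = 0"

text \<open>Solutions on symmetric intervals are united over all \<open>B\<close>. By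
  \<open>leafsol_unique\<close> they agree where both exist, so the values chosen by
  \<open>SOME\<close> below do not depend on the representative.\<close>

definition leaf_domain :: "real \<Rightarrow> real set" where
  "leaf_domain T0 = {X. \<exists>B f \<mu>. leafsol T0 B f \<mu> \<and> \<bar>X\<bar> < B}"

definition leaf_height :: "real \<Rightarrow> real \<Rightarrow> real" where
  "leaf_height T0 X = (SOME t. \<exists>B f \<mu>. leafsol T0 B f \<mu> \<and> \<bar>X\<bar> < B \<and> t = f X)"

definition leaf_boost :: "real \<Rightarrow> real \<Rightarrow> real" where
  "leaf_boost T0 X = (SOME m. \<exists>B f \<mu>. leafsol T0 B f \<mu> \<and> \<bar>X\<bar> < B \<and> m = \<mu> X)"

lemma leafsol_unique:
  assumes "leafsol T0 B f \<mu>" "leafsol T0 B' g \<nu>" "\<bar>X\<bar> < B" "\<bar>X\<bar> < B'"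
  shows "f X = g X \<and> \<mu> X = \<nu> X"
proof (rule sol_unique[where I = "{- min B B'<..<min B B'}" and f = f and \<mu> = \<mu> and g = g and \<nu> = \<nu> and ?X0.0 = 0])
  show "sol {- min B B'<..<min B B'} f \<mu>" "sol {- min B B'<..<min B B'} g \<nu>"
    using assms(1,2) unfolding leafsol_def by (auto elim!: sol_subset)
  show "f 0 = g 0" "\<mu> 0 = \<nu> 0" "0 \<in> {- min B B'<..<min B B'}"
    using assms(1,2) by (simp_all add: leafsol_def)
  show "X \<in> {- min B B'<..<min B B'}" using assms(3,4) by auto
qed (auto simp: is_interval_1)

lemma leaf_eq:
  assumes "leafsol T0 B f \<mu>" "\<bar>X\<bar> < B"
  shows "X \<in> leaf_domain T0" "leaf_height T0 X = f X" "leaf_boost T0 X = \<mu> X"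
proof -
  show "X \<in> leaf_domain T0" unfolding leaf_domain_def using assms by blast
  have "\<exists>t. \<exists>B f \<mu>. leafsol T0 B f \<mu> \<and> \<bar>X\<bar> < B \<and> t = f X" using assms by blast
  from someI_ex[OF this] obtain B' g \<nu> where "leafsol T0 B' g \<nu>" "\<bar>X\<bar> < B'" "leaf_height T0 X = g X"
    unfolding leaf_height_def[symmetric] by (elim exE conjE)
  then show "leaf_height T0 X = f X" using leafsol_unique[OF _ assms(1) _ assms(2)] by simp
  have "\<exists>m. \<exists>B f \<mu>. leafsol T0 B f \<mu> \<and> \<bar>X\<bar> < B \<and> m = \<mu> X" using assms by blast
  from someI_ex[OF this] obtain B' g \<nu> where "leafsol T0 B' g \<nu>" "\<bar>X\<bar> < B'" "leaf_boost T0 X = \<nu> X"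
    unfolding leaf_boost_def[symmetric] by (elim exE conjE)
  then show "leaf_boost T0 X = \<mu> X" using leafsol_unique[OF _ assms(1) _ assms(2)] by simp
qed

lemma reflect_at:
  assumes "(f X, X) \<in> D" "(f has_real_derivative tanh (\<mu> X)) (at X)"
    "(\<mu> has_real_derivative F (f X, X) (\<mu> X)) (at X)"
  shows "(f X, - X) \<in> D" "((\<lambda>X. f (- X)) has_real_derivative tanh (- \<mu> X)) (at (- X))"
    "((\<lambda>X. - \<mu> (- X)) has_real_derivative F (f X, - X) (- \<mu> X)) (at (- X))"
proof -
  show "(f X, - X) \<in> D" using sym_D assms(1) .
  have neg: "((\<lambda>X::real. - X) has_real_derivative - 1) (at (- X))" by (auto intro!: derivative_eq_intros)
  show "((\<lambda>X. f (- X)) has_real_derivative tanh (- \<mu> X)) (at (- X))"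
    using DERIV_chain2[OF _ neg, of f] assms(2) by simp
  have "F (f X, - X) (- \<mu> X) = F (f X, X) (\<mu> X)"
    using c_sym[OF assms(1)] by (simp add: F_def)
  then show "((\<lambda>X. - \<mu> (- X)) has_real_derivative F (f X, - X) (- \<mu> X)) (at (- X))"
    using DERIV_minus[OF DERIV_chain2[OF _ neg, of \<mu>]] assms(3) by simp
qed

lemma sol_reflect:
  assumes "open I" "sol I f \<mu>"
  shows "sol (uminus ` I) (\<lambda>X. f (- X)) (\<lambda>X. - \<mu> (- X))"
proof -
  have "open (uminus ` I)" using assms(1) open_negations by blast
  then show ?thesis
    using assms(2) reflect_at[of f _ \<mu>] unfolding sol_open[OF assms(1)]
    by (simp add: sol_open)
qed

lemma leafsol_reflect: "leafsol T0 B f \<mu> \<Longrightarrow> leafsol T0 B (\<lambda>X. f (- X)) (\<lambda>X. - \<mu> (- X))"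
  using sol_reflect[of "{-B<..<B}" f \<mu>] unfolding leafsol_def by simp

lemma leaf_domain_le: "X \<in> leaf_domain T0 \<Longrightarrow> \<bar>Y\<bar> \<le> \<bar>X\<bar> \<Longrightarrow> Y \<in> leaf_domain T0"
  unfolding leaf_domain_def by force

lemma leaf_domain_neg: "X \<in> leaf_domain T0 \<Longrightarrow> - X \<in> leaf_domain T0"
  by (erule leaf_domain_le) simp

text \<open>The mirror image of a solution is a solution with the same data at the axis, since the
  boost 0 is its own negative; uniqueness does the rest.\<close>

lemma leaf_even:
  assumes "X \<in> leaf_domain T0"
  shows "leaf_height T0 (- X) = leaf_height T0 X" "leaf_boost T0 (- X) = - leaf_boost T0 X"
proof -
  obtain B f \<mu> where *: "leafsol T0 B f \<mu>" "\<bar>X\<bar> < B"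
    using assms unfolding leaf_domain_def by blast
  have **: "\<bar>- X\<bar> < B" using *(2) by simp
  show "leaf_height T0 (- X) = leaf_height T0 X" "leaf_boost T0 (- X) = - leaf_boost T0 X"
    using leaf_eq[OF leafsol_reflect[OF *(1)] **] leaf_eq[OF *] by simp_all
qed

lemma open_leaf_domain: "open (leaf_domain T0)"
proof -
  have "leaf_domain T0 = \<Union> {{-B<..<B} | B. \<exists>f \<mu>. leafsol T0 B f \<mu>}"
    unfolding leaf_domain_def by (auto simp: abs_less_iff; force)
  then show ?thesis by (simp only:) (rule open_Union, auto)
qed

lemma leaf_domain_interval: "is_interval (leaf_domain T0)"
  unfolding is_interval_1
proof (intro ballI allI impI)
  fix a b x assume *: "a \<in> leaf_domain T0" "b \<in> leaf_domain T0" "a \<le> x \<and> x \<le> b"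
  then have "\<bar>x\<bar> \<le> \<bar>a\<bar> \<or> \<bar>x\<bar> \<le> \<bar>b\<bar>" by linarith
  then show "x \<in> leaf_domain T0" using leaf_domain_le * by blast
qed

lemma leafsol_exists: "\<exists>B f \<mu>. leafsol T0 B f \<mu>"
proof -
  obtain \<delta> where \<delta>: "\<delta> > 0" "cball (T0, 0) \<delta> \<subseteq> D" using axis by (rule cball_subset_D)
  define K where "K = cball (T0, 0::real) \<delta>"
  have K: "compact K" "convex K" "K \<subseteq> D" "K \<noteq> {}" using \<delta> by (auto simp: K_def)
  obtain f \<mu> where f: "ksol K UNIV f \<mu>" "f 0 = T0" "\<mu> 0 = 0" using ksol_exists[OF K] by blast
  have "sol {- (\<delta> / 2)<..<\<delta> / 2} f \<mu>"
  proof (rule ksol_imp_sol[OF ksol_subset[OF f(1)] K(3)])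
    fix X assume X: "X \<in> {- (\<delta> / 2)<..<\<delta> / 2}"
    have "\<bar>f X - T0\<bar> \<le> \<bar>X\<bar>" using ksol_lipschitz[OF f(1), of X 0] f(2) by simp
    moreover have "\<bar>X\<bar> \<le> \<delta> / 2" using X by auto
    moreover have "norm (T0 - f X, 0 - X) \<le> \<bar>T0 - f X\<bar> + \<bar>0 - X\<bar>"
      using norm_Pair_le[of "T0 - f X" "0 - X"] by simp
    ultimately show "(f X, X) \<in> K" unfolding K_def mem_cball dist_norm diff_Pair by linarith
  qed simp
  then have "leafsol T0 (\<delta> / 2) f \<mu>" using \<delta>(1) f(2,3) by (simp add: leafsol_def)
  then show ?thesis by blast
qed

lemma leaf_zero: "0 \<in> leaf_domain T0" "leaf_height T0 0 = T0" "leaf_boost T0 0 = 0"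
proof -
  obtain B f \<mu> where *: "leafsol T0 B f \<mu>" using leafsol_exists by blast
  then have "\<bar>0\<bar> < B" "f 0 = T0" "\<mu> 0 = 0" by (auto simp: leafsol_def)
  with leaf_eq[OF *, of 0] show "0 \<in> leaf_domain T0" "leaf_height T0 0 = T0" "leaf_boost T0 0 = 0" by auto
qed

lemma leaf_sol: "sol (leaf_domain T0) (leaf_height T0) (leaf_boost T0)"
  unfolding sol_open[OF open_leaf_domain]
proof
  fix X assume "X \<in> leaf_domain T0"
  then obtain B f \<mu> where *: "leafsol T0 B f \<mu>" "\<bar>X\<bar> < B" unfolding leaf_domain_def by blast
  have eq: "leaf_height T0 Y = f Y" "leaf_boost T0 Y = \<mu> Y" if "Y \<in> {-B<..<B}" for Y
    using leaf_eq[OF *(1), of Y] that by auto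
  have "sol {-B<..<B} (leaf_height T0) (leaf_boost T0)"
    by (rule sol_cong[of _ f \<mu>]) (use * eq in \<open>auto simp: leafsol_def\<close>)
  moreover have "X \<in> {-B<..<B}" using *(2) by auto
  ultimately show "(leaf_height T0 X, X) \<in> D \<and>
      (leaf_height T0 has_real_derivative tanh (leaf_boost T0 X)) (at X) \<and>
      (leaf_boost T0 has_real_derivative F (leaf_height T0 X, X) (leaf_boost T0 X)) (at X)"
    unfolding sol_open[OF open_greaterThanLessThan] by blast
qed

text \<open>\<open>F\<close> is bounded over a ball around the limit point uniformly in the boost.
  Hence a solution restarted from a point of the leaf near its end exists on a window of fixed
  length, whatever boost the leaf has there, and so passes the end. Its mirror image extends the
  leaf on the right.\<close>

lemma leaf_no_interior_end:
  assumes J: "leaf_domain T0 = {-b<..<b}" and lim: "(leaf_height T0 \<longlongrightarrow> t) (at_right (- b))"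
  shows "(t, - b) \<notin> D"
proof
  assume "(t, - b) \<in> D"
  then obtain \<delta> where \<delta>: "\<delta> > 0" "cball (t, - b) \<delta> \<subseteq> D" by (rule cball_subset_D)
  define K where "K = cball (t, - b) \<delta>"
  have K: "compact K" "convex K" "K \<subseteq> D" "K \<noteq> {}" using \<delta> by (auto simp: K_def)
  let ?f = "leaf_height T0" and ?\<mu> = "leaf_boost T0"
  have "b > 0" using leaf_zero(1)[of T0] unfolding J by simp
  have "eventually (\<lambda>X. dist (?f X) t < \<delta> / 8) (at_right (- b))"
    by (rule tendstoD[OF lim]) (use \<delta>(1) in simp)
  moreover have "eventually (\<lambda>X. X < min 0 (- b + \<delta> / 8)) (at_right (- b))"
    using \<open>b > 0\<close> \<delta>(1) by (intro eventually_at_right_less[THEN eventually_mono] eventually_at_rightI[of "- b" "min 0 (- b + \<delta> / 8)"]) auto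
  moreover have "eventually (\<lambda>X. X > - b) (at_right (- b))" by (rule eventually_at_right_less)
  ultimately have "eventually (\<lambda>X. dist (?f X) t < \<delta> / 8 \<and> X < min 0 (- b + \<delta> / 8) \<and> X > - b) (at_right (- b))"
    by eventually_elim auto
  then obtain X1 where X1: "dist (?f X1) t < \<delta> / 8" "X1 < 0" "X1 < - b + \<delta> / 8" "X1 > - b"
    using eventually_happens'[OF trivial_limit_at_right_real[of "- b"]] by fastforce
  obtain g \<nu> where g: "ksol K UNIV g \<nu>" "g X1 = ?f X1" "\<nu> X1 = ?\<mu> X1" using ksol_exists[OF K] by blast
  \<comment> \<open>The restarting point is within \<open>\<delta> / 8\<close> of the end point in
    each coordinate and the window adds less than \<open>\<delta> / 4\<close> to each, so the graph
    stays in the ball. To the left the window reaches beyond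
    \<open>- b - \<delta> / 8\<close>.\<close>
  have gsol: "sol {X1 - \<delta> / 4<..<X1 + \<delta> / 4} g \<nu>"
  proof (rule ksol_imp_sol[OF ksol_subset[OF g(1)] K(3)])
    fix X assume X: "X \<in> {X1 - \<delta> / 4<..<X1 + \<delta> / 4}"
    have "\<bar>g X - ?f X1\<bar> \<le> \<bar>X - X1\<bar>" using ksol_lipschitz[OF g(1), of X X1] g(2) by simp
    moreover have "norm (t - g X, - b - X) \<le> \<bar>t - g X\<bar> + \<bar>- b - X\<bar>"
      using norm_Pair_le[of "t - g X" "- b - X"] by simp
    moreover have "\<bar>X - X1\<bar> < \<delta> / 4" using X unfolding abs_less_iff greaterThanLessThan_iff by linarith
    ultimately show "(g X, X) \<in> K" unfolding K_def mem_cball dist_norm diff_Pair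
      using X1 unfolding dist_real_def by linarith
  qed simp
  define B where "B = b + \<delta> / 8"
  have fsol: "sol {-b<..<b} ?f ?\<mu>" using leaf_sol[of T0] J by simp
  have agree: "?f X = g X \<and> ?\<mu> X = \<nu> X" if "X \<in> {-b<..X1}" for X
  proof (rule sol_unique[where I = "{-b<..X1}" and f = ?f and \<mu> = ?\<mu> and g = g and \<nu> = \<nu> and ?X0.0 = X1])
    show "sol {-b<..X1} ?f ?\<mu>" by (rule sol_subset[OF fsol]) (use X1 \<open>b > 0\<close> in auto)
    show "sol {-b<..X1} g \<nu>" by (rule sol_subset[OF gsol]) (use X1 \<delta>(1) in auto)
  qed (use X1 g that in \<open>auto simp: is_interval_1\<close>)
  \<comment> \<open>The old leaf in the middle, the restarted solution on its left, the mirror image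
    of the latter on its right. By \<open>agree\<close> each piece describes the same function on an
    open overlap.\<close>
  define f1 where "f1 X = (if X \<in> {-b<..<b} then ?f X else if X < 0 then g X else g (- X))" for X
  define m1 where "m1 X = (if X \<in> {-b<..<b} then ?\<mu> X else if X < 0 then \<nu> X else - \<nu> (- X))" for X
  have 1: "sol {-b<..<b} f1 m1" by (rule sol_cong[OF fsol]) (auto simp: f1_def m1_def)
  have gl: "sol {-B<..<X1} g \<nu>" by (rule sol_subset[OF gsol]) (use X1 \<delta>(1) in \<open>auto simp: B_def\<close>)
  have 2: "sol {-B<..<X1} f1 m1"
  proof (rule sol_cong[OF gl])
    fix X assume "X \<in> {-B<..<X1}"
    then show "g X = f1 X \<and> \<nu> X = m1 X"
      using agree[of X] X1 by (auto simp: f1_def m1_def)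
  qed
  have gr: "sol {-X1<..<B} (\<lambda>X. g (- X)) (\<lambda>X. - \<nu> (- X))"
    using sol_reflect[OF _ gl] by simp
  have 3: "sol {-X1<..<B} f1 m1"
  proof (rule sol_cong[OF gr])
    fix X assume X: "X \<in> {-X1<..<B}"
    show "g (- X) = f1 X \<and> - \<nu> (- X) = m1 X"
    proof (cases "X < b")
      case True
      then have "- X \<in> {-b<..X1}" "X \<in> leaf_domain T0" using X X1 unfolding J by auto
      then show ?thesis
        using agree[of "- X"] leaf_even[of X T0] True X X1 by (auto simp: f1_def m1_def)
    next
      case False
      then show ?thesis using \<open>b > 0\<close> by (auto simp: f1_def m1_def)
    qed
  qed
  have "{-B<..<B} \<subseteq> ({-b<..<b} \<union> {-B<..<X1}) \<union> {-X1<..<B}" using X1 by auto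
  then have "sol {-B<..<B} f1 m1"
    by (rule sol_subset[OF sol_glue[OF _ _ sol_glue[OF _ _ 1 2] 3], rotated 4]) auto
  moreover have "f1 0 = T0" "m1 0 = 0" using leaf_zero[of T0] \<open>b > 0\<close> by (simp_all add: f1_def m1_def)
  ultimately have "leafsol T0 B f1 m1" using \<open>b > 0\<close> \<delta>(1) by (simp add: leafsol_def B_def)
  then have "b \<in> leaf_domain T0" by (rule leaf_eq(1)) (use \<open>b > 0\<close> \<delta>(1) in \<open>simp add: B_def\<close>)
  then show False unfolding J by simp
qed

lemma leaf_domain_bounded:
  assumes "X \<notin> leaf_domain T0"
  obtains b where "b > 0" "b \<le> \<bar>X\<bar>" "leaf_domain T0 = {-b<..<b}"
proof -
  let ?J = "leaf_domain T0"
  have bdd: "Y < \<bar>X\<bar>" if "Y \<in> ?J" for Y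
    using leaf_domain_le[OF that, of X] assms by linarith
  then have bdda: "bdd_above ?J" by (intro bdd_aboveI[of _ "\<bar>X\<bar>"]) (simp add: less_imp_le)
  define b where "b = Sup ?J"
  have "\<exists>z\<in>?J. y < z" if "y \<in> ?J" for y
  proof -
    obtain e where "e > 0" "ball y e \<subseteq> ?J" using open_leaf_domain \<open>y \<in> ?J\<close> open_contains_ball by metis
    then have "y + e / 2 \<in> ?J" by (auto simp: subset_iff dist_real_def)
    then show ?thesis using \<open>e > 0\<close> by (intro bexI) auto
  qed
  then have lt: "y < b" if "y \<in> ?J" for y
    unfolding b_def using cSup_upper[OF _ bdda] that by (meson less_le_trans)
  have "?J = {-b<..<b}"
  proof (intro equalityI subsetI)
    fix y assume "y \<in> ?J"
    then show "y \<in> {-b<..<b}" using lt[of y] lt[of "- y"] leaf_domain_neg by auto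
  next
    fix y assume "y \<in> {-b<..<b}"
    then have "\<bar>y\<bar> < b" by auto
    then obtain z where "z \<in> ?J" "\<bar>y\<bar> < z"
      unfolding b_def using less_cSup_iff[OF _ bdda] leaf_zero(1) by blast
    then show "y \<in> ?J" using leaf_domain_le by force
  qed
  moreover have "b > 0" using lt leaf_zero(1) by blast
  moreover have "b \<le> \<bar>X\<bar>" unfolding b_def
    using bdd leaf_zero(1) by (intro cSup_least) (auto simp: less_imp_le)
  ultimately show ?thesis using that by blast
qed

text \<open>A continuous graph in \<open>D\<close> over a larger interval would give the leaf a
  limit inside \<open>D\<close> at one of its ends; the right end is reduced to the left one by
  reflection.\<close>

theorem leaf_maximal:
  assumes J: "is_interval J" "leaf_domain T0 \<subseteq> J" and cont: "continuous_on J g" and "open J"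
    and g: "\<And>X. X \<in> J \<Longrightarrow> (g X, X) \<in> D" "\<And>X. X \<in> leaf_domain T0 \<Longrightarrow> g X = leaf_height T0 X"
  shows "J = leaf_domain T0"
proof (rule ccontr)
  assume "J \<noteq> leaf_domain T0"
  then obtain X where X: "X \<in> J" "X \<notin> leaf_domain T0" using J(2) by blast
  obtain b where b: "b > 0" "b \<le> \<bar>X\<bar>" "leaf_domain T0 = {-b<..<b}"
    using leaf_domain_bounded[OF X(2)] by blast
  have 0: "0 \<in> J" using leaf_zero(1) J(2) by blast
  have right: "eventually (\<lambda>Y. Y \<in> leaf_domain T0) (at_right (- b))"
    using b(1) unfolding b(3) by (intro eventually_at_rightI[of "- b" b]) auto
  have cont_at: "isCont g Y" if "Y \<in> J" for Y
    using cont \<open>open J\<close> that by (simp add: continuous_on_eq_continuous_at)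
  consider "- b \<in> J" | "b \<in> J"
    using mem_is_interval_1_I[OF J(1) X(1) 0, of "- b"] mem_is_interval_1_I[OF J(1) 0 X(1), of b] b by linarith
  then show False
  proof cases
    case 1
    have "(g \<longlongrightarrow> g (- b)) (at_right (- b))"
      using cont_at[OF 1] by (auto simp: isCont_def intro: filterlim_mono at_le)
    then have "(leaf_height T0 \<longlongrightarrow> g (- b)) (at_right (- b))"
      by (rule Lim_transform_eventually) (use right g(2) in \<open>auto elim: eventually_mono\<close>)
    then show False using leaf_no_interior_end[OF b(3)] g(1)[OF 1] by blast
  next
    case 2
    have "isCont (\<lambda>Y. g (- Y)) (- b)"
      using cont_at[OF 2] by (intro isCont_o2[where g = g and f = uminus] continuous_intros) simp
    then have "((\<lambda>Y. g (- Y)) \<longlongrightarrow> g b) (at_right (- b))"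
      by (auto simp: isCont_def intro: filterlim_mono at_le)
    moreover have "eventually (\<lambda>Y. g (- Y) = leaf_height T0 Y) (at_right (- b))"
      using right by eventually_elim (simp add: g(2) leaf_domain_neg leaf_even)
    ultimately have "(leaf_height T0 \<longlongrightarrow> g b) (at_right (- b))"
      by (rule Lim_transform_eventually)
    then show False using leaf_no_interior_end[OF b(3)] sym_D[OF g(1)[OF 2]] by blast
  qed
qed

section \<open>Shooting to the axis, covering and disjointness\<close>

definition axis_triangle :: "real \<Rightarrow> real \<Rightarrow> (real \<times> real) set" where
  "axis_triangle T X = {(T', X'). X \<le> X' \<and> X' \<le> 0 \<and> \<bar>T' - T\<bar> \<le> X' - X}"

lemma axis_triangle:
  assumes "(T, X) \<in> D" "X \<le> 0"
  shows "compact (axis_triangle T X)" "convex (axis_triangle T X)" "axis_triangle T X \<subseteq> D" "axis_triangle T X \<noteq> {}"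
proof -
  have P: "axis_triangle T X = {z. - snd z \<le> - X} \<inter> {z. snd z \<le> 0} \<inter> {z. fst z - snd z \<le> T - X} \<inter> {z. - fst z - snd z \<le> - T - X}"
    unfolding axis_triangle_def by (auto simp: abs_le_iff)
  have "closed (axis_triangle T X)" unfolding P
    by (intro closed_Int closed_Collect_le continuous_intros)
  moreover have "axis_triangle T X \<subseteq> {T + X..T - X} \<times> {X..0}"
    unfolding axis_triangle_def by (auto simp: abs_le_iff)
  then have "bounded (axis_triangle T X)"
    by (rule bounded_subset[rotated]) (intro bounded_Times bounded_closed_interval)
  ultimately show "compact (axis_triangle T X)" by (simp add: compact_eq_bounded_closed)
  have hs: "convex {z :: real \<times> real. a * fst z + b * snd z \<le> c}" for a b c
    using convex_halfspace_le[of "(a, b)" c] by (simp add: inner_prod_def)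
  show "convex (axis_triangle T X)" unfolding P
    using hs[of 0 "-1" "- X"] hs[of 0 1 0] hs[of 1 "-1" "T - X"] hs[of "-1" "-1" "- T - X"]
    by (intro convex_Int) simp_all
  show "axis_triangle T X \<subseteq> D" unfolding axis_triangle_def using triangle[OF assms(1)] by auto
  have "(T, X) \<in> axis_triangle T X" using assms(2) by (simp add: axis_triangle_def)
  then show "axis_triangle T X \<noteq> {}" by blast
qed

text \<open>Uniqueness is stated for the height on the axis because that height is the label of a
  leaf.\<close>

lemma shooting:
  assumes "(T, X) \<in> D" "X \<le> 0"
  shows "\<exists>f \<mu>. sol {X..0} f \<mu> \<and> f X = T \<and> \<mu> 0 = 0 \<and>
    (\<forall>g \<nu>. sol {X..0} g \<nu> \<longrightarrow> g X = T \<longrightarrow> \<nu> 0 = 0 \<longrightarrow> g 0 = f 0)"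
proof -
  define K where "K = axis_triangle T X"
  have K: "compact K" "convex K" "K \<subseteq> D" "K \<noteq> {}" using axis_triangle[OF assms] by (simp_all add: K_def)
  have "\<forall>m. \<exists>f \<mu>. ksol K UNIV f \<mu> \<and> f X = T \<and> \<mu> X = m" using ksol_exists[OF K] by blast
  then obtain f \<mu> where f: "\<And>m. ksol K UNIV (f m) (\<mu> m)" "\<And>m. f m X = T" "\<And>m. \<mu> m X = m" by metis
  \<comment> \<open>The slope bound keeps the solutions of the projected system in the triangle, so
    they solve the original system up to the axis.\<close>
  have inK: "(f m Y, Y) \<in> K" if "Y \<in> {X..0}" for m Y
    using ksol_lipschitz[OF f(1) convex_UNIV, of Y X m] that f(2) by (simp add: K_def axis_triangle_def)
  have fK: "ksol K {X..0} (f m) (\<mu> m)" for m by (rule ksol_subset[OF f(1)]) simp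
  have fsol: "sol {X..0} (f m) (\<mu> m)" for m
    by (rule ksol_imp_sol[OF fK K(3)]) (use inK in auto)
  obtain L where L: "L > 0" "\<And>f \<mu> g \<nu> X0 Y. ksol K {X..0} f \<mu> \<Longrightarrow> ksol K {X..0} g \<nu> \<Longrightarrow> X0 \<in> {X..0} \<Longrightarrow> Y \<in> {X..0} \<Longrightarrow>
     norm (f Y - g Y, \<mu> Y - \<nu> Y) \<le> exp (L * \<bar>Y - X0\<bar>) * norm (f X0 - g X0, \<mu> X0 - \<nu> X0)"
    using ksol_gronwall[OF K] by metis
  have X0: "X \<in> {X..0}" "0 \<in> {X..0}" using assms(2) by auto
  define S where "S m = \<mu> m 0" for m
  have "\<bar>S m - S m'\<bar> \<le> exp (L * \<bar>X\<bar>) * \<bar>m - m'\<bar>" for m m'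
  proof -
    have "\<bar>S m - S m'\<bar> \<le> norm (f m 0 - f m' 0, S m - S m')"
      using norm_snd_le[of "S m - S m'" "f m 0 - f m' 0"] by (simp add: real_norm_def)
    also have "\<dots> \<le> exp (L * \<bar>0 - X\<bar>) * norm (f m X - f m' X, \<mu> m X - \<mu> m' X)"
      unfolding S_def by (rule L(2)[OF fK fK X0])
    finally show ?thesis by (simp add: f norm_Pair)
  qed
  then have "dist (S m) (S m') \<le> exp (L * \<bar>X\<bar>) * dist m m'" for m m' by (simp add: dist_real_def)
  then have "(exp (L * \<bar>X\<bar>))-lipschitz_on UNIV S" by (intro lipschitz_onI) auto
  then have contS: "continuous_on UNIV S" by (rule lipschitz_on_continuous_on)
  obtain B where B: "B > 0" "\<And>x m. x \<in> K \<Longrightarrow> \<bar>F x m\<bar> \<le> B" using F_bounded_lipschitz[OF K(1-3)] by blast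
  \<comment> \<open>On the triangle \<open>F\<close> is bounded by \<open>B\<close>, so the boost
    changes by at most \<open>B * \<bar>X\<bar>\<close> before the axis. Initial boosts
    \<open>c\<close> and \<open>- c\<close> with this bound as \<open>c\<close> therefore bracket a
    zero of \<open>S\<close>.\<close>
  have far: "\<bar>S m - m\<bar> \<le> B * \<bar>X\<bar>" for m
  proof -
    have "norm (\<mu> m 0 - \<mu> m X) \<le> B * norm (0 - X)"
    proof (rule field_differentiable_bound[where S = "{X..0}" and f' = "\<lambda>Y. F (f m Y, Y) (\<mu> m Y)"])
      show "(\<mu> m has_field_derivative F (f m Y, Y) (\<mu> m Y)) (at Y within {X..0})" if "Y \<in> {X..0}" for Y
        using fsol[of m] that unfolding sol_def by blast
      show "norm (F (f m Y, Y) (\<mu> m Y)) \<le> B" if "Y \<in> {X..0}" for Y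
        using B(2)[OF inK[OF that]] by simp
    qed (use X0 in auto)
    then show ?thesis by (simp add: S_def f)
  qed
  define c where "c = B * \<bar>X\<bar>"
  have c: "c \<ge> 0" "S (- c) \<le> 0" "S c \<ge> 0"
    using far[of "- c"] far[of c] B(1) unfolding c_def[symmetric] abs_le_iff by (simp_all add: c_def)
  have "\<exists>m\<ge>- c. m \<le> c \<and> S m = 0"
    by (rule IVT') (use c contS in \<open>auto intro: continuous_on_subset\<close>)
  then obtain m where m: "S m = 0" by blast
  have unique: "m1 = m2" if "S m1 = 0" "S m2 = 0" for m1 m2
  proof (rule upcrossing_zero_unique[OF contS _ that])
    fix m0 assume "S m0 = 0"
    then have "\<mu> m0 0 = 0" by (simp add: S_def)
    then obtain \<epsilon> where \<epsilon>: "\<epsilon> > 0" "\<And>g \<nu>. sol {X..0} g \<nu> \<Longrightarrow> \<forall>Y\<in>{X..0}. (g Y, Y) \<in> K \<Longrightarrow> g X = f m0 X \<Longrightarrow>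
        \<nu> X \<noteq> \<mu> m0 X \<Longrightarrow> \<bar>\<nu> X - \<mu> m0 X\<bar> < \<epsilon> \<Longrightarrow> (\<nu> X - \<mu> m0 X) * \<nu> 0 > 0"
      using shooting_upcrossing[OF K assms(2) fsol[of m0]] inK by metis
    show "\<exists>\<epsilon>>0. \<forall>m'. m' \<noteq> m0 \<and> \<bar>m' - m0\<bar> < \<epsilon> \<longrightarrow> (m' - m0) * S m' > 0"
    proof (intro exI[of _ \<epsilon>] conjI allI impI)
      fix m' assume "m' \<noteq> m0 \<and> \<bar>m' - m0\<bar> < \<epsilon>"
      then show "(m' - m0) * S m' > 0"
        using \<epsilon>(2)[OF fsol[of m']] inK[of _ m'] by (simp add: f S_def)
    qed (rule \<epsilon>(1))
  qed
  show ?thesis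
  proof (rule exI[of _ "f m"], rule exI[of _ "\<mu> m"], intro conjI allI impI)
    show "sol {X..0} (f m) (\<mu> m)" "f m X = T" by (rule fsol, rule f(2))
    show "\<mu> m 0 = 0" using m by (simp add: S_def)
    \<comment> \<open>A competitor stays in the triangle too, so it coincides at the axis with the
      member of the family that has the same initial boost.\<close>
    fix g \<nu> assume g: "sol {X..0} g \<nu>" "g X = T" "\<nu> 0 = 0"
    have "(g Y, Y) \<in> K" if "Y \<in> {X..0}" for Y
      using sol_lipschitz[OF g(1), of Y X] that g(2) X0 by (simp add: K_def axis_triangle_def)
    then have gK: "ksol K {X..0} g \<nu>" by (intro sol_imp_ksol[OF g(1)])
    have "norm (g 0 - f (\<nu> X) 0, \<nu> 0 - \<mu> (\<nu> X) 0)
        \<le> exp (L * \<bar>0 - X\<bar>) * norm (g X - f (\<nu> X) X, \<nu> X - \<mu> (\<nu> X) X)"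
      by (rule L(2)[OF gK fK X0])
    then have eq: "g 0 = f (\<nu> X) 0" "\<nu> 0 = \<mu> (\<nu> X) 0"
      by (simp_all add: f g(2) norm_Pair sum_power2_le_zero_iff)
    then have "S (\<nu> X) = 0" using g(3) by (simp add: S_def)
    then have "\<nu> X = m" using unique m by blast
    then show "g 0 = f m 0" using eq(1) by simp
  qed
qed

text \<open>The shooting solution and the leaf with the same height on the axis agree while both
  exist. Were the leaf to end before \<open>X\<close>, the shooting solution would supply a limit
  point in \<open>D\<close>, against \<open>leaf_no_interior_end\<close>.\<close>

lemma leaf_through_left:
  assumes x: "(T, X) \<in> D" "X \<le> 0"
  shows "\<exists>T0. X \<in> leaf_domain T0 \<and> leaf_height T0 X = T"
proof -
  obtain f \<mu> where f: "sol {X..0} f \<mu>" "f X = T" "\<mu> 0 = 0" using shooting[OF x] by (elim exE conjE)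
  define T0 where "T0 = f 0"
  let ?J = "leaf_domain T0"
  have agree: "leaf_height T0 Y = f Y" if "Y \<in> ?J" "Y \<in> {X..0}" for Y
  proof -
    have sub: "{Y..0} \<subseteq> ?J" using leaf_domain_le[OF that(1)] by auto
    have "leaf_height T0 Y = f Y \<and> leaf_boost T0 Y = \<mu> Y"
      by (rule sol_unique_Icc[OF sol_subset[OF leaf_sol sub] sol_subset[OF f(1)], where ?X0.0 = 0])
        (use that leaf_zero f(3) in \<open>auto simp: T0_def\<close>)
    then show ?thesis ..
  qed
  have "X \<in> ?J"
  proof (rule ccontr)
    assume "X \<notin> ?J"
    then obtain b where b: "b > 0" "b \<le> \<bar>X\<bar>" "?J = {-b<..<b}" using leaf_domain_bounded by blast
    have bX: "- b \<in> {X..0}" using b x(2) by auto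
    have "continuous_on {X..0} f" using f(1) unfolding sol_def by (auto intro: DERIV_continuous_on)
    then have "continuous_on {-b..0} f" using bX by (auto intro: continuous_on_subset)
    then have "(f \<longlongrightarrow> f (- b)) (at_right (- b))"
      using continuous_on_Icc_at_rightD b(1) by fastforce
    moreover have "eventually (\<lambda>Y. f Y = leaf_height T0 Y) (at_right (- b))"
      using b(1) bX agree unfolding b(3) by (intro eventually_at_rightI[of "- b" 0]) auto
    ultimately have "(leaf_height T0 \<longlongrightarrow> f (- b)) (at_right (- b))" by (rule Lim_transform_eventually)
    moreover have "(f (- b), - b) \<in> D" using f(1) bX unfolding sol_def by blast
    ultimately show False using leaf_no_interior_end[OF b(3)] by blast
  qed
  then show ?thesis using agree[of X] f(2) x(2) by auto
qed

theorem leaf_through: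
  assumes "(T, X) \<in> D"
  shows "\<exists>T0. X \<in> leaf_domain T0 \<and> leaf_height T0 X = T"
proof (cases "X \<le> 0")
  case False
  then obtain T0 where "- X \<in> leaf_domain T0" "leaf_height T0 (- X) = T"
    using leaf_through_left[OF sym_D[OF assms]] by auto
  then show ?thesis using leaf_even[of "- X" T0] leaf_domain_neg[of "- X" T0] by auto
qed (use leaf_through_left assms in blast)

text \<open>By evenness the common point may be taken on the left. Both leaves then solve the same
  shooting problem, which determines the height on the axis.\<close>

theorem leaf_disjoint:
  assumes "X \<in> leaf_domain T1" "X \<in> leaf_domain T2" "leaf_height T1 X = leaf_height T2 X"
  shows "T1 = T2"
proof -
  define Y where "Y = - \<bar>X\<bar>"
  have Y: "Y \<le> 0" "Y \<in> leaf_domain T1" "Y \<in> leaf_domain T2" "leaf_height T1 Y = leaf_height T2 Y"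
    using assms leaf_domain_le[OF assms(1), of Y] leaf_domain_le[OF assms(2), of Y]
      leaf_even[OF assms(1)] leaf_even[OF assms(2)] by (auto simp: Y_def abs_if)
  have s: "sol {Y..0} (leaf_height T) (leaf_boost T)" if "Y \<in> leaf_domain T" for T
    by (rule sol_subset[OF leaf_sol]) (use leaf_domain_le[OF that] in auto)
  have "(leaf_height T1 Y, Y) \<in> D" using s[OF Y(2)] Y(1) by (simp add: sol_def)
  from shooting[OF this Y(1)] obtain f where
    f: "\<forall>g \<nu>. sol {Y..0} g \<nu> \<longrightarrow> g Y = leaf_height T1 Y \<longrightarrow> \<nu> 0 = 0 \<longrightarrow> g 0 = f 0"
    by (elim exE conjE)
  show ?thesis
    using f[rule_format, OF s[OF Y(2)] refl leaf_zero(3)] f[rule_format, OF s[OF Y(3)] Y(4)[symmetric] leaf_zero(3)]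
    by (simp add: leaf_zero)
qed

end

section \<open>Horizon charts\<close>

text \<open>\<open>a\<close> and \<open>b\<close> are the partial derivatives by the null
  coordinates \<open>p = T - X\<close> and \<open>q = T + X\<close>.\<close>

definition null_partials :: "(real \<times> real \<Rightarrow> real) \<Rightarrow> real \<Rightarrow> real \<Rightarrow> real \<times> real \<Rightarrow> bool" where
  "null_partials f a b x \<longleftrightarrow> (f has_derivative (\<lambda>d. a * (fst d - snd d) + b * (fst d + snd d))) (at x)"

lemma null_partials_const: "null_partials (\<lambda>x. c) 0 0 x"
  unfolding null_partials_def by simp

lemma null_partials_add: "null_partials f a b x \<Longrightarrow> null_partials g a' b' x \<Longrightarrow> null_partials (\<lambda>x. f x + g x) (a + a') (b + b') x"
  unfolding null_partials_def by (drule (1) has_derivative_add) (simp add: algebra_simps)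

lemma null_partials_diff: "null_partials f a b x \<Longrightarrow> null_partials g a' b' x \<Longrightarrow> null_partials (\<lambda>x. f x - g x) (a - a') (b - b') x"
  unfolding null_partials_def by (drule (1) has_derivative_diff) (simp add: algebra_simps)

lemma null_partials_mult: "null_partials f a b x \<Longrightarrow> null_partials g a' b' x \<Longrightarrow>
    null_partials (\<lambda>x. f x * g x) (a * g x + f x * a') (b * g x + f x * b') x"
  unfolding null_partials_def by (drule (1) has_derivative_mult) (simp add: algebra_simps)

lemma null_partials_cmult: "null_partials f a b x \<Longrightarrow> null_partials (\<lambda>x. c * f x) (c * a) (c * b) x"
  using null_partials_mult[OF null_partials_const] by simp

lemma null_partials_comp:
  assumes "null_partials f a b x" "(g has_real_derivative g') (at (f x))"
  shows "null_partials (\<lambda>x. g (f x)) (g' * a) (g' * b) x"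
  using has_derivative_compose[OF assms(1)[unfolded null_partials_def] assms(2)[unfolded has_field_derivative_def]]
  unfolding null_partials_def by (simp add: algebra_simps)

lemma null_partials_p:
  assumes "(g has_real_derivative g') (at (fst x - snd x))"
  shows "null_partials (\<lambda>x. g (fst x - snd x)) g' 0 x"
proof -
  have "((\<lambda>x::real \<times> real. fst x - snd x) has_derivative (\<lambda>d. fst d - snd d)) (at x)"
    by (auto intro!: derivative_eq_intros)
  from has_derivative_compose[OF this assms[unfolded has_field_derivative_def]]
  show ?thesis unfolding null_partials_def by simp
qed

lemma null_partials_q:
  assumes "(g has_real_derivative g') (at (fst x + snd x))"
  shows "null_partials (\<lambda>x. g (fst x + snd x)) 0 g' x"
proof -
  have "((\<lambda>x::real \<times> real. fst x + snd x) has_derivative (\<lambda>d. fst d + snd d)) (at x)"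
    by (auto intro!: derivative_eq_intros)
  from has_derivative_compose[OF this assms[unfolded has_field_derivative_def]]
  show ?thesis unfolding null_partials_def by simp
qed

lemma null_partials_cong:
  assumes "null_partials f a b x" "open U" "x \<in> U" "\<And>y. y \<in> U \<Longrightarrow> f y = g y"
  shows "null_partials g a b x"
  using has_derivative_transform_within_open[OF assms(1)[unfolded null_partials_def] assms(2-4)]
  unfolding null_partials_def .

lemma null_partials_unique:
  assumes "null_partials f a b x" "null_partials f a' b' x"
  shows "a = a'" "b = b'"
proof -
  have eq: "(\<lambda>d. a * (fst d - snd d) + b * (fst d + snd d)) = (\<lambda>d. a' * (fst d - snd d) + b' * (fst d + snd d))"
    using has_derivative_unique assms unfolding null_partials_def by blast
  show "a = a'" using fun_cong[OF eq, of "(1/2, -1/2)"] by simp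
  show "b = b'" using fun_cong[OF eq, of "(1/2, 1/2)"] by simp
qed

lemma null_partials_isCont: "null_partials f a b x \<Longrightarrow> isCont f x"
  unfolding null_partials_def by (rule has_derivative_continuous)

text \<open>A horizon chart: the root \<open>ra\<close> of the metric function is inside the chart, the other root
  \<open>rb\<close> is on its boundary. Both kinds of charts are covered, with
  \<open>(sa, sb) = (sin (p / 2), cos (p / 2))\<close> or the other way round, and \<open>\<eta>\<close> records which.\<close>

locale horizon_chart =
  fixes ra rb ka kb \<eta> :: real and sa sb :: "real \<Rightarrow> real" and I :: "real set"
    and U :: "(real \<times> real) set" and \<rho> :: "real \<times> real \<Rightarrow> real"
  assumes ra: "ra > 0" and rb: "rb > 0" and \<eta>2: "\<eta> * \<eta> = 1" and \<eta>: "\<eta> * (ra - rb) > 0"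
    and ka: "ka = (ra - rb) / (2 * ra\<^sup>2)" and kb: "kb = (rb - ra) / (2 * rb\<^sup>2)"
    and ss: "\<And>p. (sa p)\<^sup>2 + (sb p)\<^sup>2 = 1"
    and sa: "\<And>p. (sa has_real_derivative \<eta> * sb p / 2) (at p)"
    and sb: "\<And>p. (sb has_real_derivative - \<eta> * sa p / 2) (at p)"
    and I: "open I" "convex I" "I \<subseteq> {0<..}" "\<And>r. r \<in> I \<Longrightarrow> \<eta> * (r - rb) > 0"
    and open_U: "open U"
    and U: "\<And>x. x \<in> U \<Longrightarrow> \<rho> x \<in> I" "\<And>x. x \<in> U \<Longrightarrow> sb (fst x - snd x) * sb (fst x + snd x) > 0"
    and radius: "\<And>x. x \<in> U \<Longrightarrow>
      - \<eta> * ((\<rho> x - ra) * exp (2 * ka * \<rho> x + ka / kb * ln \<bar>\<rho> x - rb\<bar>)) =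
      (sa (fst x - snd x) * exp (ka / kb * ln \<bar>sb (fst x - snd x)\<bar>)) *
      (sa (fst x + snd x) * exp (ka / kb * ln \<bar>sb (fst x + snd x)\<bar>))"
begin

definition h where "h r = (r - ra) * (r - rb) / r\<^sup>2"
definition h1 where "h1 r = (ra + rb) / r\<^sup>2 - 2 * ra * rb / r ^ 3"
definition h2 where "h2 r = 6 * ra * rb / r ^ 4 - 2 * (ra + rb) / r ^ 3"
definition \<beta> where "\<beta> = ka / kb"
text \<open>Up to sign, \<open>\<Phi>\<close> is \<open>exp (ka * R)\<close> with \<open>R\<close>
  twice the tortoise coordinate, and \<open>A\<close> is \<open>exp (ka * G)\<close> with
  \<open>G\<close> the null scale: Kruskal-type functions. The factor \<open>ka\<close>, half the
  derivative of \<open>h\<close> at \<open>ra\<close>, turns the logarithmic pole at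
  \<open>ra\<close> into a simple zero.\<close>

definition \<Phi> where "\<Phi> r = (r - ra) * exp (2 * ka * r + \<beta> * ln \<bar>r - rb\<bar>)"
definition A where "A p = sa p * exp (\<beta> * ln \<bar>sb p\<bar>)"
definition Dn where "Dn p = \<eta> * (ka * (sa p)\<^sup>2 - kb * (sb p)\<^sup>2)"
text \<open>The reciprocal of the derivative of the null scale \<open>G\<close>. The poles of that
  derivative become simple zeros, and as \<open>Dn\<close> never vanishes, \<open>\<xi>\<close> is
  smooth everywhere.\<close>

definition \<xi> where "\<xi> p = - 2 * ka * kb * (sa p * sb p) / Dn p"
definition \<xi>' where "\<xi>' p = - 2 * ka * kb * (\<eta> * ((sb p)\<^sup>2 - (sa p)\<^sup>2) / 2 / Dn p - (ka + kb) * (sa p * sb p)\<^sup>2 / (Dn p)\<^sup>2)"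

lemma signs: "\<eta> * ka > 0" "\<eta> * kb < 0" "ka \<noteq> 0" "kb \<noteq> 0"
proof -
  have "\<eta> * ka = \<eta> * (ra - rb) / (2 * ra\<^sup>2)" "\<eta> * kb = - (\<eta> * (ra - rb) / (2 * rb\<^sup>2))"
    by (simp_all add: ka kb algebra_simps diff_divide_distrib)
  then show "\<eta> * ka > 0" "\<eta> * kb < 0" using \<eta> ra rb by simp_all
  then show "ka \<noteq> 0" "kb \<noteq> 0" by auto
qed

lemma \<beta>_eq: "\<beta> = - rb\<^sup>2 / ra\<^sup>2"
proof -
  have "ra - rb \<noteq> 0" using \<eta> by auto
  then have "ka / kb = - rb\<^sup>2 / ra\<^sup>2"
    using ra rb unfolding ka kb by (simp add: divide_simps) (simp add: algebra_simps)
  then show ?thesis unfolding \<beta>_def .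
qed

lemma Dn_pos: "Dn p > 0"
proof -
  have "Dn p = (\<eta> * ka) * (sa p)\<^sup>2 + (- (\<eta> * kb)) * (sb p)\<^sup>2" by (simp add: Dn_def algebra_simps)
  moreover have "(sa p)\<^sup>2 > 0 \<or> (sb p)\<^sup>2 > 0" using ss[of p] zero_le_power2 by (smt (verit))
  ultimately show ?thesis using signs
    by (smt (verit) mult_nonneg_nonneg mult_pos_pos zero_le_power2)
qed

lemma Dn_eq: "(sb p)\<^sup>2 - \<beta> * (sa p)\<^sup>2 = - \<eta> * Dn p / kb"
proof -
  have "- \<eta> * Dn p = (\<eta> * \<eta>) * (kb * (sb p)\<^sup>2 - ka * (sa p)\<^sup>2)" by (simp add: Dn_def algebra_simps)
  then show ?thesis using signs(4) \<eta>2 by (simp add: \<beta>_def divide_simps algebra_simps)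
qed

lemma Dn_deriv: "(Dn has_real_derivative (ka + kb) * (sa p * sb p)) (at p)"
proof -
  have "((\<lambda>p. \<eta> * (ka * (sa p * sa p) - kb * (sb p * sb p))) has_real_derivative (\<eta> * \<eta>) * ((ka + kb) * (sa p * sb p))) (at p)"
    using sa[of p] sb[of p] by (auto intro!: derivative_eq_intros simp: algebra_simps)
  then show ?thesis unfolding Dn_def \<eta>2 power2_eq_square by simp
qed

lemma \<xi>_deriv: "(\<xi> has_real_derivative \<xi>' p) (at p)"
proof -
  have "((\<lambda>p. - 2 * ka * kb * ((sa p * sb p) / Dn p)) has_real_derivative
     - 2 * ka * kb * (((\<eta> * sb p / 2 * sb p + - \<eta> * sa p / 2 * sa p) * Dn p - sa p * sb p * ((ka + kb) * (sa p * sb p))) / (Dn p * Dn p))) (at p)"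
    using Dn_pos[of p] DERIV_mult[OF sa[of p] sb[of p]]
    by (intro DERIV_cmult DERIV_divide Dn_deriv) (auto simp: algebra_simps)
  moreover have eq: "((\<eta> * sb p / 2 * sb p + - \<eta> * sa p / 2 * sa p) * Dn p - sa p * sb p * ((ka + kb) * (sa p * sb p))) / (Dn p * Dn p)
     = \<eta> * ((sb p)\<^sup>2 - (sa p)\<^sup>2) / 2 / Dn p - (ka + kb) * (sa p * sb p)\<^sup>2 / (Dn p)\<^sup>2"
    using Dn_pos[of p] by (simp add: field_simps power2_eq_square)
  ultimately have "((\<lambda>p. - 2 * ka * kb * ((sa p * sb p) / Dn p)) has_real_derivative \<xi>' p) (at p)"
    unfolding \<xi>'_def eq by simp
  moreover have "\<xi> = (\<lambda>p. - 2 * ka * kb * ((sa p * sb p) / Dn p))" by (simp add: \<xi>_def fun_eq_iff)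
  ultimately show ?thesis by simp
qed

lemma abs_ln_deriv: "x \<noteq> 0 \<Longrightarrow> ((\<lambda>x. ln \<bar>x\<bar>) has_real_derivative 1 / x) (at x)"
  for x :: real
proof (cases "x > 0")
  case True
  have "(ln has_real_derivative 1 / x) (at x)" using True by (auto intro!: derivative_eq_intros simp: inverse_eq_divide)
  then show ?thesis
    by (rule has_field_derivative_transform_within_open[where S = "{0<..}"]) (use True in auto)
next
  case False
  assume "x \<noteq> 0"
  have "((\<lambda>x. ln (- x)) has_real_derivative 1 / x) (at x)"
    using False \<open>x \<noteq> 0\<close> by (auto intro!: derivative_eq_intros simp: inverse_eq_divide)
  then show ?thesis
    by (rule has_field_derivative_transform_within_open[where S = "{..<0}"]) (use False \<open>x \<noteq> 0\<close> in auto)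
qed

lemma ln_sb_deriv: "sb p \<noteq> 0 \<Longrightarrow> ((\<lambda>p. ln \<bar>sb p\<bar>) has_real_derivative - \<eta> * sa p / (2 * sb p)) (at p)"
  by (rule DERIV_cong[OF DERIV_chain2[where f = "\<lambda>x. ln \<bar>x\<bar>", OF abs_ln_deriv sb]]) auto

text \<open>In \<open>A' = ka * G' * A\<close> the pole of \<open>G'\<close> cancels the zero of
  \<open>sa\<close>, so the derivative stays away from 0 also on the horizon inside the
  chart.\<close>

lemma A_deriv:
  assumes "sb p \<noteq> 0"
  shows "(A has_real_derivative - exp (\<beta> * ln \<bar>sb p\<bar>) * Dn p / (2 * kb * sb p)) (at p)"
proof -
  have "(A has_real_derivative \<eta> * sb p / 2 * exp (\<beta> * ln \<bar>sb p\<bar>) +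
     exp (\<beta> * ln \<bar>sb p\<bar>) * (\<beta> * (- \<eta> * sa p / (2 * sb p))) * sa p) (at p)"
    unfolding A_def by (intro DERIV_mult sa DERIV_fun_exp DERIV_cmult ln_sb_deriv assms)
  moreover have "\<eta> * sb p / 2 * exp (\<beta> * ln \<bar>sb p\<bar>) + exp (\<beta> * ln \<bar>sb p\<bar>) * (\<beta> * (- \<eta> * sa p / (2 * sb p))) * sa p
     = - exp (\<beta> * ln \<bar>sb p\<bar>) * Dn p / (2 * kb * sb p)"
  proof -
    have "\<eta> * sb p / 2 * exp (\<beta> * ln \<bar>sb p\<bar>) + exp (\<beta> * ln \<bar>sb p\<bar>) * (\<beta> * (- \<eta> * sa p / (2 * sb p))) * sa p
      = exp (\<beta> * ln \<bar>sb p\<bar>) * \<eta> / (2 * sb p) * ((sb p)\<^sup>2 - \<beta> * (sa p)\<^sup>2)"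
      using assms by (simp add: field_simps power2_eq_square)
    also have "\<dots> = exp (\<beta> * ln \<bar>sb p\<bar>) / (2 * sb p) * (- (\<eta> * \<eta>) * Dn p / kb)"
      unfolding Dn_eq by simp
    also have "\<dots> = - exp (\<beta> * ln \<bar>sb p\<bar>) * Dn p / (2 * kb * sb p)" unfolding \<eta>2 by simp
    finally show ?thesis .
  qed
  ultimately show ?thesis by (simp only:)
qed

text \<open>From \<open>\<Phi>' / \<Phi> = 2 * ka / h\<close>, where the zero of \<open>h\<close> at
  \<open>ra\<close> cancels the zero of \<open>\<Phi>\<close>.\<close>

lemma \<Phi>_deriv:
  assumes r: "r \<in> I"
  shows "(\<Phi> has_real_derivative exp (2 * ka * r + \<beta> * ln \<bar>r - rb\<bar>) * (2 * ka * r\<^sup>2 / (r - rb))) (at r)"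
proof -
  have ne: "r - rb \<noteq> 0" "r > 0" using I(4)[OF r] I(3) r by auto
  have l: "((\<lambda>r. ln \<bar>r - rb\<bar>) has_real_derivative 1 / (r - rb)) (at r)"
    by (rule DERIV_cong[OF DERIV_chain2[where f = "\<lambda>x. ln \<bar>x\<bar>" and g = "\<lambda>r. r - rb", OF abs_ln_deriv[OF ne(1)]]])
      (auto intro!: derivative_eq_intros)
  have d: "(\<Phi> has_real_derivative 1 * exp (2 * ka * r + \<beta> * ln \<bar>r - rb\<bar>) +
     exp (2 * ka * r + \<beta> * ln \<bar>r - rb\<bar>) * (2 * ka + \<beta> * (1 / (r - rb))) * (r - ra)) (at r)"
    unfolding \<Phi>_def
    by (intro DERIV_mult DERIV_fun_exp DERIV_add DERIV_cmult l) (auto intro!: derivative_eq_intros)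
  have e: "1 + (2 * ka + \<beta> * (1 / (r - rb))) * (r - ra) = 2 * ka * r\<^sup>2 / (r - rb)"
  proof -
    have "1 + (2 * ((ra - rb) / (2 * ra\<^sup>2)) + (- rb\<^sup>2 / ra\<^sup>2) * (1 / (r - rb))) * (r - ra)
        = 2 * ((ra - rb) / (2 * ra\<^sup>2)) * r\<^sup>2 / (r - rb)"
      using ne ra by (simp add: divide_simps) (simp add: algebra_simps power2_eq_square)
    then show ?thesis unfolding \<beta>_eq[symmetric] ka[symmetric] .
  qed
  have "1 * X + X * Y * Z = X * (1 + Y * Z)" for X Y Z :: real by (simp add: algebra_simps)
  from d[unfolded this e] show ?thesis .
qed

definition E where "E p = exp (\<beta> * ln \<bar>sb p\<bar>)"
definition Er where "Er r = exp (2 * ka * r + \<beta> * ln \<bar>r - rb\<bar>)"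
definition g where "g = 1 - \<beta>"

text \<open>The logarithm of \<open>- h * G' p * G' q\<close> after the factors vanishing at
  \<open>ra\<close> have been cancelled with the help of the radius equation. What remains is finite
  on the chart, horizon included; \<open>g\<close> combines the original power 1 with the power
  \<open>\<beta>\<close> left by that cancellation.\<close>

definition lnN where "lnN x = g * ln \<bar>\<rho> x - rb\<bar> - g * ln \<bar>sb (fst x - snd x)\<bar> - g * ln \<bar>sb (fst x + snd x)\<bar>
   + ln (Dn (fst x - snd x)) + ln (Dn (fst x + snd x)) - 2 * ka * \<rho> x - 2 * ln (\<rho> x) - ln (4 * ka\<^sup>2 * kb\<^sup>2)"

definition N where "N x = exp (lnN x)"

lemma U_facts:
  assumes "x \<in> U"
  shows "\<rho> x > 0" "\<eta> * (\<rho> x - rb) > 0" "\<rho> x \<noteq> rb"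
    "sb (fst x - snd x) \<noteq> 0" "sb (fst x + snd x) \<noteq> 0" "sb (fst x - snd x) * sb (fst x + snd x) > 0"
    "\<bar>\<rho> x - rb\<bar> = \<eta> * (\<rho> x - rb)"
proof -
  show "\<rho> x > 0" using U(1)[OF assms] I(3) by auto
  show *: "\<eta> * (\<rho> x - rb) > 0" using U(1)[OF assms] I(4) by auto
  then show "\<rho> x \<noteq> rb" by auto
  show "sb (fst x - snd x) * sb (fst x + snd x) > 0" using U(2)[OF assms] .
  then show "sb (fst x - snd x) \<noteq> 0" "sb (fst x + snd x) \<noteq> 0" by auto
  have "\<bar>\<eta>\<bar> = 1" using \<eta>2 by (metis abs_mult_self_eq abs_1 abs_mult mult_1 mult_cancel_left2 real_sqrt_abs2 real_sqrt_one)
  then show "\<bar>\<rho> x - rb\<bar> = \<eta> * (\<rho> x - rb)"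
    using * by (metis abs_mult abs_of_pos mult_1)
qed

lemma N_eq:
  assumes "x \<in> U"
  shows "N x = \<eta> * (\<rho> x - rb) * (E (fst x - snd x) * E (fst x + snd x)) * (Dn (fst x - snd x) * Dn (fst x + snd x)) /
     (sb (fst x - snd x) * sb (fst x + snd x) * Er (\<rho> x) * (4 * ka\<^sup>2 * kb\<^sup>2) * (\<rho> x)\<^sup>2)"
proof -
  let ?p = "fst x - snd x" and ?q = "fst x + snd x"
  note f = U_facts[OF assms]
  have c: "4 * ka\<^sup>2 * kb\<^sup>2 > 0" using signs by simp
  have "lnN x = (ln \<bar>\<rho> x - rb\<bar> + (\<beta> * ln \<bar>sb ?p\<bar> + \<beta> * ln \<bar>sb ?q\<bar>) + (ln (Dn ?p) + ln (Dn ?q)))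
     - (ln \<bar>sb ?p\<bar> + ln \<bar>sb ?q\<bar> + (2 * ka * \<rho> x + \<beta> * ln \<bar>\<rho> x - rb\<bar>) + ln (4 * ka\<^sup>2 * kb\<^sup>2) + (ln (\<rho> x) + ln (\<rho> x)))"
    by (simp add: lnN_def g_def algebra_simps)
  then have "N x = \<bar>\<rho> x - rb\<bar> * (E ?p * E ?q) * (Dn ?p * Dn ?q) / (\<bar>sb ?p\<bar> * \<bar>sb ?q\<bar> * Er (\<rho> x) * (4 * ka\<^sup>2 * kb\<^sup>2) * (\<rho> x * \<rho> x))"
    unfolding N_def E_def Er_def
    using f(1,3,4,5) Dn_pos c by (simp only: exp_add exp_diff exp_ln right_minus_eq not_False_eq_True zero_less_abs_iff)
  moreover have "\<bar>sb ?p\<bar> * \<bar>sb ?q\<bar> = sb ?p * sb ?q" using f(6) by (simp add: abs_mult[symmetric])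
  ultimately show ?thesis unfolding f(7) by (simp add: power2_eq_square)
qed

lemma N_pos: "N x > 0" by (simp add: N_def)

lemma radius': "x \<in> U \<Longrightarrow> (\<rho> x - ra) * Er (\<rho> x) = - \<eta> * (sa (fst x - snd x) * sa (fst x + snd x) * (E (fst x - snd x) * E (fst x + snd x)))"
proof -
  assume "x \<in> U"
  from arg_cong[OF radius[OF this], of "\<lambda>y. - \<eta> * y"]
  have "(\<eta> * \<eta>) * ((\<rho> x - ra) * Er (\<rho> x)) = - \<eta> * (sa (fst x - snd x) * sa (fst x + snd x) * (E (fst x - snd x) * E (fst x + snd x)))"
    unfolding Er_def E_def \<beta>_def by (simp add: algebra_simps)
  then show ?thesis unfolding \<eta>2 by simp
qed

text \<open>Since \<open>\<xi> = 1 / G'\<close>, this identifies \<open>N\<close> off the horizon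
  with the square of the conformal factor; cleared of denominators it also holds on the
  horizon.\<close>

lemma N_\<xi>_\<xi>:
  assumes x: "x \<in> U"
  shows "N x * \<xi> (fst x - snd x) * \<xi> (fst x + snd x) = - h (\<rho> x)"
proof -
  let ?p = "fst x - snd x" and ?q = "fst x + snd x"
  note f = U_facts[OF x]
  have Er: "Er (\<rho> x) \<noteq> 0" by (simp add: Er_def)
  have "N x * \<xi> ?p * \<xi> ?q = \<eta> * (\<rho> x - rb) * (sa ?p * sa ?q * (E ?p * E ?q)) / (Er (\<rho> x) * (\<rho> x)\<^sup>2)"
    unfolding N_eq[OF x] \<xi>_def using f signs Er Dn_pos[of ?p] Dn_pos[of ?q]
    by (simp add: field_simps power2_eq_square)
  also have "\<dots> = (\<rho> x - rb) * (\<eta> * (sa ?p * sa ?q * (E ?p * E ?q))) / (Er (\<rho> x) * (\<rho> x)\<^sup>2)"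
    by (simp add: mult_ac)
  also have "\<eta> * (sa ?p * sa ?q * (E ?p * E ?q)) = - ((\<rho> x - ra) * Er (\<rho> x))"
    using radius'[OF x] by simp
  also have "(\<rho> x - rb) * \<dots> / (Er (\<rho> x) * (\<rho> x)\<^sup>2) = - h (\<rho> x)"
    using Er f(1) by (simp add: h_def)
  finally show ?thesis .
qed

lemma inj_\<Phi>: "inj_on \<Phi> I"
proof (rule inj_onI)
  fix r s assume rs: "r \<in> I" "s \<in> I" "\<Phi> r = \<Phi> s"
  have seg: "closed_segment r s \<subseteq> I" using I(2) rs by (simp add: closed_segment_subset)
  obtain z where z: "z \<in> closed_segment r s"
    "\<Phi> s - \<Phi> r = exp (2 * ka * z + \<beta> * ln \<bar>z - rb\<bar>) * (2 * ka * z\<^sup>2 / (z - rb)) * (s - r)"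
    using mvt_between[of r s \<Phi>, OF \<Phi>_deriv] seg by blast
  have "z \<in> I" using z(1) seg by blast
  then have "z > 0" "z - rb \<noteq> 0" using I(3) I(4)[OF \<open>z \<in> I\<close>] by auto
  then show "r = s" using z(2) rs(3) signs(3) by simp
qed

text \<open>Off the horizon the derivatives are \<open>h * G' / 2\<close>, rewritten by
  \<open>N_\<xi>_\<xi>\<close>. To include the horizon, \<open>\<rho>\<close> is expressed as the
  inverse of \<open>\<Phi>\<close> applied to a product of values of \<open>A\<close>, and the
  inverse function theorem is applied to \<open>\<Phi>\<close>.\<close>

lemma \<rho>_null_partials:
  assumes x: "x \<in> U"
  shows "null_partials \<rho> (- \<xi> (fst x + snd x) * N x / 2) (- \<xi> (fst x - snd x) * N x / 2) x"
proof -
  let ?p = "fst x - snd x" and ?q = "fst x + snd x"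
  note f = U_facts[OF x]
  have Er: "Er (\<rho> x) \<noteq> 0" by (simp add: Er_def)
  define G where "G = the_inv_into I \<Phi>"
  have G: "G (\<Phi> r) = r" if "r \<in> I" for r unfolding G_def by (rule the_inv_into_f_f[OF inj_\<Phi> that])
  define d where "d = Er (\<rho> x) * (2 * ka * (\<rho> x)\<^sup>2 / (\<rho> x - rb))"
  have d: "d \<noteq> 0" using f Er signs(3) by (simp add: d_def)
  have "(G has_derivative (\<lambda>y. y / d)) (at (\<Phi> (\<rho> x)))"
  proof (rule has_derivative_inverse_strong[where f = \<Phi> and S = I and f' = "\<lambda>y. d * y"])
    show "continuous_on I \<Phi>" using \<Phi>_deriv by (meson DERIV_isCont continuous_at_imp_continuous_on)
    show "(\<Phi> has_derivative (*) d) (at (\<rho> x))"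
      using \<Phi>_deriv[OF U(1)[OF x]] unfolding d_def Er_def has_field_derivative_def .
    show "(*) d \<circ> (\<lambda>y. y / d) = id" using d by (auto simp: o_def)
  qed (use I U x G in auto)
  then have GD: "(G has_real_derivative 1 / d) (at (\<Phi> (\<rho> x)))"
    unfolding has_field_derivative_def by (rule has_derivative_eq_rhs) (simp add: fun_eq_iff)
  define P where "P y = - \<eta> * (A (fst y - snd y) * A (fst y + snd y))" for y :: "real \<times> real"
  have P: "P y = \<Phi> (\<rho> y)" if "y \<in> U" for y
    using radius'[OF that] by (simp add: P_def A_def \<Phi>_def E_def Er_def algebra_simps)
  define a where "a p = - E p * Dn p / (2 * kb * sb p)" for p
  have AD: "(A has_real_derivative a ?p) (at ?p)" "(A has_real_derivative a ?q) (at ?q)"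
    unfolding a_def E_def using A_deriv f(4,5) by blast+
  have "null_partials P (- \<eta> * (a ?p * A ?q + A ?p * 0)) (- \<eta> * (0 * A ?q + A ?p * a ?q)) x"
    unfolding P_def by (intro null_partials_cmult null_partials_mult null_partials_p null_partials_q AD)
  then have "null_partials (\<lambda>y. G (P y)) (1 / d * (- \<eta> * (a ?p * A ?q + A ?p * 0))) (1 / d * (- \<eta> * (0 * A ?q + A ?p * a ?q))) x"
    by (rule null_partials_comp) (use GD P[OF x] in simp)
  then have "null_partials \<rho> (1 / d * (- \<eta> * (a ?p * A ?q + A ?p * 0))) (1 / d * (- \<eta> * (0 * A ?q + A ?p * a ?q))) x"
    by (rule null_partials_cong[OF _ open_U x]) (simp add: P G U)
  moreover have "1 / d * (- \<eta> * (a ?p * A ?q + A ?p * 0)) = - \<xi> ?q * N x / 2"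
    unfolding N_eq[OF x] \<xi>_def d_def a_def A_def E_def[symmetric] using f Er signs Dn_pos[of ?p] Dn_pos[of ?q]
    by (simp add: divide_simps) (simp add: algebra_simps power2_eq_square)
  moreover have "1 / d * (- \<eta> * (0 * A ?q + A ?p * a ?q)) = - \<xi> ?p * N x / 2"
    unfolding N_eq[OF x] \<xi>_def d_def a_def A_def E_def[symmetric] using f Er signs Dn_pos[of ?p] Dn_pos[of ?q]
    by (simp add: divide_simps) (simp add: algebra_simps power2_eq_square)
  ultimately show ?thesis by (simp only:)
qed

text \<open>Up to a constant, \<open>lnN\<close> is a function of \<open>p\<close>, plus the same
  function of \<open>q\<close>, plus a function of the radius. \<open>\<nu>\<close> and
  \<open>\<epsilon>\<close> are the derivatives of these parts, and \<open>n\<close>,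
  \<open>m\<close> the resulting null partials of \<open>lnN\<close>.\<close>

definition \<nu> where "\<nu> p = g * \<eta> * sa p / (2 * sb p) + (ka + kb) * (sa p * sb p) / Dn p"
definition \<nu>' where "\<nu>' p = g / (4 * (sb p)\<^sup>2) +
  ((ka + kb) * (\<eta> * ((sb p)\<^sup>2 - (sa p)\<^sup>2) / 2) * Dn p - ((ka + kb) * (sa p * sb p))\<^sup>2) / (Dn p)\<^sup>2"
definition \<epsilon> where "\<epsilon> r = g / (r - rb) - 2 * ka - 2 / r"
definition \<epsilon>' where "\<epsilon>' r = 2 / r\<^sup>2 - g / (r - rb)\<^sup>2"

definition n where "n x = \<nu> (fst x - snd x) + \<epsilon> (\<rho> x) * (- \<xi> (fst x + snd x) * N x / 2)"
definition m where "m x = \<nu> (fst x + snd x) + \<epsilon> (\<rho> x) * (- \<xi> (fst x - snd x) * N x / 2)"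

definition n' where "n' x = \<nu>' (fst x - snd x) + \<epsilon>' (\<rho> x) * (- \<xi> (fst x + snd x) * N x / 2)\<^sup>2 +
    \<epsilon> (\<rho> x) * (- \<xi> (fst x + snd x) * (N x * n x) / 2)"
definition m' where "m' x = \<nu>' (fst x + snd x) + \<epsilon>' (\<rho> x) * (- \<xi> (fst x - snd x) * N x / 2)\<^sup>2 +
    \<epsilon> (\<rho> x) * (- \<xi> (fst x - snd x) * (N x * m x) / 2)"

text \<open>The radial part of \<open>lnN\<close> is \<open>ln \<bar>h\<bar>\<close> minus
  \<open>ka\<close> times twice the tortoise coordinate, whose derivative is \<open>2 / h\<close>.
  The second equation is the derivative of the first.\<close>

lemma \<epsilon>_h:
  assumes "r > 0" "r \<noteq> rb"
  shows "\<epsilon> r * h r = h1 r - 2 * ka"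
    and "\<epsilon>' r * h r + \<epsilon> r * h1 r = h2 r"
proof -
  have g: "g = 1 + rb\<^sup>2 / ra\<^sup>2" by (simp add: g_def \<beta>_eq)
  have ne: "r - rb \<noteq> 0" using assms by simp
  have "(G / (r - rb) - 2 * K - 2 / r) * ((r - ra) * (r - rb) / r\<^sup>2) = ((ra + rb) / r\<^sup>2 - 2 * ra * rb / r ^ 3) - 2 * K"
    if "G = 1 + rb\<^sup>2 / ra\<^sup>2" "K = (ra - rb) / (2 * ra\<^sup>2)" for G K
    unfolding that using ne assms ra
    by (simp add: divide_simps) (simp add: algebra_simps eval_nat_numeral)
  from this[OF g ka] show "\<epsilon> r * h r = h1 r - 2 * ka" unfolding \<epsilon>_def h_def h1_def .
  have "(2 / r\<^sup>2 - G / (r - rb)\<^sup>2) * ((r - ra) * (r - rb) / r\<^sup>2) + (G / (r - rb) - 2 * K - 2 / r) * ((ra + rb) / r\<^sup>2 - 2 * ra * rb / r ^ 3)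
     = 6 * ra * rb / r ^ 4 - 2 * (ra + rb) / r ^ 3"
    if "G = 1 + rb\<^sup>2 / ra\<^sup>2" "K = (ra - rb) / (2 * ra\<^sup>2)" for G K
    unfolding that using ne assms ra
    by (simp add: divide_simps) (simp add: algebra_simps eval_nat_numeral)
  from this[OF g ka] show "\<epsilon>' r * h r + \<epsilon> r * h1 r = h2 r" unfolding \<epsilon>_def \<epsilon>'_def h_def h1_def h2_def .
qed

text \<open>The part of \<open>lnN\<close> that depends on \<open>p\<close> is
  \<open>ka * G p - ln \<bar>\<xi> p\<bar>\<close> up to a constant, and
  \<open>G' = 1 / \<xi>\<close>.\<close>

lemma \<xi>_\<nu>:
  assumes "sb p \<noteq> 0"
  shows "\<xi> p * \<nu> p + \<xi>' p = ka"
proof -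
  have D: "Dn p \<noteq> 0" using Dn_pos[of p] by simp
  have "\<xi> p * \<nu> p + \<xi>' p = - ka * kb * \<eta> / Dn p * ((sb p)\<^sup>2 - \<beta> * (sa p)\<^sup>2)"
    unfolding \<xi>_def \<nu>_def \<xi>'_def g_def using assms D
    by (simp add: divide_simps) (simp add: algebra_simps power2_eq_square)
  also have "\<dots> = (\<eta> * \<eta>) * ka" unfolding Dn_eq using D signs by simp
  finally show ?thesis unfolding \<eta>2 by simp
qed

lemma \<epsilon>_deriv: "r > 0 \<Longrightarrow> r \<noteq> rb \<Longrightarrow> (\<epsilon> has_real_derivative \<epsilon>' r) (at r)"
proof -
  assume r: "r > 0" "r \<noteq> rb"
  have "((\<lambda>r. g / (r - rb) - 2 * ka - 2 / r) has_real_derivative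
      (0 * (r - rb) - g * (1 - 0)) / ((r - rb) * (r - rb)) - 0 - (0 * r - 2 * 1) / (r * r)) (at r)"
    using r by (intro DERIV_diff DERIV_divide DERIV_const DERIV_ident) auto
  then show ?thesis unfolding \<epsilon>_def \<epsilon>'_def by (simp add: power2_eq_square)
qed

lemma \<nu>_deriv:
  assumes "sb p \<noteq> 0"
  shows "(\<nu> has_real_derivative \<nu>' p) (at p)"
proof -
  have D: "Dn p \<noteq> 0" using Dn_pos[of p] by simp
  have "((\<lambda>p. g * \<eta> / 2 * (sa p / sb p) + (ka + kb) * ((sa p * sb p) / Dn p)) has_real_derivative
     g * \<eta> / 2 * ((\<eta> * sb p / 2 * sb p - sa p * (- \<eta> * sa p / 2)) / (sb p * sb p)) +
     (ka + kb) * (((\<eta> * sb p / 2 * sb p + - \<eta> * sa p / 2 * sa p) * Dn p - sa p * sb p * ((ka + kb) * (sa p * sb p))) / (Dn p * Dn p))) (at p)"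
    using assms D by (intro DERIV_add DERIV_cmult DERIV_divide DERIV_mult sa sb Dn_deriv)
  moreover have "g * \<eta> / 2 * ((\<eta> * sb p / 2 * sb p - sa p * (- \<eta> * sa p / 2)) / (sb p * sb p))
     = g * (\<eta> * \<eta>) * ((sa p)\<^sup>2 + (sb p)\<^sup>2) / (4 * (sb p)\<^sup>2)"
    using assms by (simp add: field_simps power2_eq_square)
  moreover have "\<dots> = g / (4 * (sb p)\<^sup>2)" unfolding \<eta>2 ss by simp
  moreover have "(ka + kb) * (((\<eta> * sb p / 2 * sb p + - \<eta> * sa p / 2 * sa p) * Dn p - sa p * sb p * ((ka + kb) * (sa p * sb p))) / (Dn p * Dn p))
     = ((ka + kb) * (\<eta> * ((sb p)\<^sup>2 - (sa p)\<^sup>2) / 2) * Dn p - ((ka + kb) * (sa p * sb p))\<^sup>2) / (Dn p)\<^sup>2"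
    using D by (simp add: field_simps power2_eq_square)
  ultimately have "((\<lambda>p. g * \<eta> / 2 * (sa p / sb p) + (ka + kb) * ((sa p * sb p) / Dn p)) has_real_derivative \<nu>' p) (at p)"
    unfolding \<nu>'_def by (simp only:)
  moreover have "\<nu> = (\<lambda>p. g * \<eta> / 2 * (sa p / sb p) + (ka + kb) * ((sa p * sb p) / Dn p))"
    by (simp add: \<nu>_def fun_eq_iff)
  ultimately show ?thesis by (simp only:)
qed

lemma lnN_null_partials:
  assumes x: "x \<in> U"
  shows "null_partials lnN (n x) (m x) x"
proof -
  let ?p = "fst x - snd x" and ?q = "fst x + snd x"
  note f = U_facts[OF x]
  define w where "w = (\<lambda>p. ln (Dn p) - g * ln \<bar>sb p\<bar>)"
  define v where "v = (\<lambda>r. g * ln \<bar>r - rb\<bar> - 2 * ka * r - 2 * ln r)"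
  have wD: "(w has_real_derivative \<nu> p) (at p)" if "sb p \<noteq> 0" for p
  proof -
    have "(w has_real_derivative 1 / Dn p * ((ka + kb) * (sa p * sb p)) - g * (- \<eta> * sa p / (2 * sb p))) (at p)"
      unfolding w_def using Dn_pos[of p]
      by (intro DERIV_diff DERIV_cmult ln_sb_deriv that DERIV_chain2[where f = ln and g = Dn, OF DERIV_ln_divide Dn_deriv])
    then show ?thesis by (simp add: \<nu>_def add.commute mult.assoc)
  qed
  have vD: "(v has_real_derivative \<epsilon> (\<rho> x)) (at (\<rho> x))"
  proof -
    have "((\<lambda>r. ln \<bar>r - rb\<bar>) has_real_derivative 1 / (\<rho> x - rb) * 1) (at (\<rho> x))"
      by (rule DERIV_chain2[where f = "\<lambda>x. ln \<bar>x\<bar>" and g = "\<lambda>r. r - rb", OF abs_ln_deriv])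
        (use f in \<open>auto intro!: derivative_eq_intros\<close>)
    then have "(v has_real_derivative g * (1 / (\<rho> x - rb) * 1) - 2 * ka * 1 - 2 * (1 / \<rho> x)) (at (\<rho> x))"
      unfolding v_def using f(1) by (intro DERIV_diff DERIV_cmult DERIV_ident DERIV_ln_divide)
    then show ?thesis by (simp add: \<epsilon>_def)
  qed
  have "null_partials (\<lambda>x. (w (fst x - snd x) + w (fst x + snd x) + v (\<rho> x)) - ln (4 * ka\<^sup>2 * kb\<^sup>2))
     ((\<nu> ?p + 0 + \<epsilon> (\<rho> x) * (- \<xi> ?q * N x / 2)) - 0) ((0 + \<nu> ?q + \<epsilon> (\<rho> x) * (- \<xi> ?p * N x / 2)) - 0) x"
    by (intro null_partials_diff null_partials_add null_partials_const null_partials_p null_partials_q wD f null_partials_comp[OF \<rho>_null_partials[OF x] vD])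
  moreover have "lnN = (\<lambda>x. (w (fst x - snd x) + w (fst x + snd x) + v (\<rho> x)) - ln (4 * ka\<^sup>2 * kb\<^sup>2))"
    by (simp add: lnN_def w_def v_def fun_eq_iff)
  ultimately show ?thesis by (simp add: n_def m_def)
qed

lemma N_null_partials: "x \<in> U \<Longrightarrow> null_partials N (N x * n x) (N x * m x) x"
  unfolding N_def by (rule null_partials_comp[OF lnN_null_partials DERIV_exp])

text \<open>These are the logarithmic null derivatives of
  \<open>N * \<xi> p * \<xi> q = - h\<close>, multiplied by \<open>\<xi>\<close> so that they make
  sense on the horizon.\<close>

lemma \<xi>_n:
  assumes x: "x \<in> U"
  shows "\<xi> (fst x - snd x) * n x = h1 (\<rho> x) / 2 - \<xi>' (fst x - snd x)"
    and "\<xi> (fst x + snd x) * m x = h1 (\<rho> x) / 2 - \<xi>' (fst x + snd x)"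
proof -
  let ?p = "fst x - snd x" and ?q = "fst x + snd x"
  note f = U_facts[OF x]
  have "\<xi> ?p * n x = \<xi> ?p * \<nu> ?p - \<epsilon> (\<rho> x) * (N x * \<xi> ?p * \<xi> ?q) / 2"
    by (simp add: n_def algebra_simps)
  also have "\<dots> = (ka - \<xi>' ?p) + \<epsilon> (\<rho> x) * h (\<rho> x) / 2"
    unfolding N_\<xi>_\<xi>[OF x] using \<xi>_\<nu>[OF f(4)] by simp
  finally show "\<xi> ?p * n x = h1 (\<rho> x) / 2 - \<xi>' ?p"
    unfolding \<epsilon>_h(1)[OF f(1,3)] by (simp add: diff_divide_distrib)
  have "\<xi> ?q * m x = \<xi> ?q * \<nu> ?q - \<epsilon> (\<rho> x) * (N x * \<xi> ?p * \<xi> ?q) / 2"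
    by (simp add: m_def algebra_simps)
  also have "\<dots> = (ka - \<xi>' ?q) + \<epsilon> (\<rho> x) * h (\<rho> x) / 2"
    unfolding N_\<xi>_\<xi>[OF x] using \<xi>_\<nu>[OF f(5)] by simp
  finally show "\<xi> ?q * m x = h1 (\<rho> x) / 2 - \<xi>' ?q"
    unfolding \<epsilon>_h(1)[OF f(1,3)] by (simp add: diff_divide_distrib)
qed

text \<open>Off the horizon \<open>lnN\<close> is \<open>ln \<bar>h\<bar>\<close> plus a function of
  \<open>p\<close> plus a function of \<open>q\<close>, so its mixed derivative is that of
  \<open>ln \<bar>h\<bar>\<close>. It encodes the curvature of the two-dimensional quotient and is
  regular on the horizon.\<close>

lemma n_null_partials:
  assumes x: "x \<in> U"
  shows "null_partials n (n' x) (- h2 (\<rho> x) * N x / 4) x" "null_partials m (- h2 (\<rho> x) * N x / 4) (m' x) x"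
proof -
  let ?p = "fst x - snd x" and ?q = "fst x + snd x"
  note f = U_facts[OF x]
  have mixed: "\<epsilon>' (\<rho> x) * (- \<xi> ?p * N x / 2) * (- \<xi> ?q * N x / 2) - \<epsilon> (\<rho> x) * (h1 (\<rho> x) * N x / 4) = - h2 (\<rho> x) * N x / 4"
  proof -
    have "\<epsilon>' (\<rho> x) * (- \<xi> ?p * N x / 2) * (- \<xi> ?q * N x / 2) - \<epsilon> (\<rho> x) * (h1 (\<rho> x) * N x / 4)
      = (\<epsilon>' (\<rho> x) * (N x * \<xi> ?p * \<xi> ?q) - \<epsilon> (\<rho> x) * h1 (\<rho> x)) * N x / 4" by (simp add: algebra_simps)
    also have "\<dots> = - (\<epsilon>' (\<rho> x) * h (\<rho> x) + \<epsilon> (\<rho> x) * h1 (\<rho> x)) * N x / 4"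
      unfolding N_\<xi>_\<xi>[OF x] by (simp add: algebra_simps)
    finally show ?thesis unfolding \<epsilon>_h(2)[OF f(1,3)] .
  qed
  have \<epsilon>D: "null_partials (\<lambda>x. \<epsilon> (\<rho> x)) (\<epsilon>' (\<rho> x) * (- \<xi> ?q * N x / 2)) (\<epsilon>' (\<rho> x) * (- \<xi> ?p * N x / 2)) x"
    by (rule null_partials_comp[OF \<rho>_null_partials[OF x] \<epsilon>_deriv[OF f(1,3)]])
  have "null_partials (\<lambda>x. \<nu> (fst x - snd x) + \<epsilon> (\<rho> x) * (- 1 / 2 * (\<xi> (fst x + snd x) * N x)))
     (\<nu>' ?p + (\<epsilon>' (\<rho> x) * (- \<xi> ?q * N x / 2) * (- 1 / 2 * (\<xi> ?q * N x)) + \<epsilon> (\<rho> x) * (- 1 / 2 * (0 * N x + \<xi> ?q * (N x * n x)))))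
     (0 + (\<epsilon>' (\<rho> x) * (- \<xi> ?p * N x / 2) * (- 1 / 2 * (\<xi> ?q * N x)) + \<epsilon> (\<rho> x) * (- 1 / 2 * (\<xi>' ?q * N x + \<xi> ?q * (N x * m x))))) x"
    by (intro null_partials_add null_partials_mult null_partials_cmult null_partials_p null_partials_q \<epsilon>D N_null_partials[OF x] \<nu>_deriv f \<xi>_deriv)
  moreover have "n = (\<lambda>x. \<nu> (fst x - snd x) + \<epsilon> (\<rho> x) * (- 1 / 2 * (\<xi> (fst x + snd x) * N x)))"
    by (simp add: n_def fun_eq_iff)
  moreover have "\<nu>' ?p + (\<epsilon>' (\<rho> x) * (- \<xi> ?q * N x / 2) * (- 1 / 2 * (\<xi> ?q * N x)) + \<epsilon> (\<rho> x) * (- 1 / 2 * (0 * N x + \<xi> ?q * (N x * n x)))) = n' x"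
    by (simp add: n'_def power2_eq_square algebra_simps)
  moreover have "0 + (\<epsilon>' (\<rho> x) * (- \<xi> ?p * N x / 2) * (- 1 / 2 * (\<xi> ?q * N x)) + \<epsilon> (\<rho> x) * (- 1 / 2 * (\<xi>' ?q * N x + \<xi> ?q * (N x * m x)))) = - h2 (\<rho> x) * N x / 4"
  proof -
    have eq: "\<xi>' ?q * N x + \<xi> ?q * (N x * m x) = h1 (\<rho> x) / 2 * N x"
    proof -
      have "\<xi>' ?q * N x + \<xi> ?q * (N x * m x) = (\<xi>' ?q + \<xi> ?q * m x) * N x" by (simp add: algebra_simps)
      also have "\<dots> = h1 (\<rho> x) / 2 * N x" unfolding \<xi>_n[OF x] by simp
      finally show ?thesis .
    qed
    show ?thesis unfolding mixed[symmetric] eq by (simp add: algebra_simps)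
  qed
  ultimately show "null_partials n (n' x) (- h2 (\<rho> x) * N x / 4) x" by (simp only:)
  have "null_partials (\<lambda>x. \<nu> (fst x + snd x) + \<epsilon> (\<rho> x) * (- 1 / 2 * (\<xi> (fst x - snd x) * N x)))
     (0 + (\<epsilon>' (\<rho> x) * (- \<xi> ?q * N x / 2) * (- 1 / 2 * (\<xi> ?p * N x)) + \<epsilon> (\<rho> x) * (- 1 / 2 * (\<xi>' ?p * N x + \<xi> ?p * (N x * n x)))))
     (\<nu>' ?q + (\<epsilon>' (\<rho> x) * (- \<xi> ?p * N x / 2) * (- 1 / 2 * (\<xi> ?p * N x)) + \<epsilon> (\<rho> x) * (- 1 / 2 * (0 * N x + \<xi> ?p * (N x * m x))))) x"
    by (intro null_partials_add null_partials_mult null_partials_cmult null_partials_p null_partials_q \<epsilon>D N_null_partials[OF x] \<nu>_deriv f \<xi>_deriv)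
  moreover have "m = (\<lambda>x. \<nu> (fst x + snd x) + \<epsilon> (\<rho> x) * (- 1 / 2 * (\<xi> (fst x - snd x) * N x)))"
    by (simp add: m_def fun_eq_iff)
  moreover have "\<nu>' ?q + (\<epsilon>' (\<rho> x) * (- \<xi> ?p * N x / 2) * (- 1 / 2 * (\<xi> ?p * N x)) + \<epsilon> (\<rho> x) * (- 1 / 2 * (0 * N x + \<xi> ?p * (N x * m x)))) = m' x"
    by (simp add: m'_def power2_eq_square algebra_simps)
  moreover have "0 + (\<epsilon>' (\<rho> x) * (- \<xi> ?q * N x / 2) * (- 1 / 2 * (\<xi> ?p * N x)) + \<epsilon> (\<rho> x) * (- 1 / 2 * (\<xi>' ?p * N x + \<xi> ?p * (N x * n x)))) = - h2 (\<rho> x) * N x / 4"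
  proof -
    have eq: "\<xi>' ?p * N x + \<xi> ?p * (N x * n x) = h1 (\<rho> x) / 2 * N x"
    proof -
      have "\<xi>' ?p * N x + \<xi> ?p * (N x * n x) = (\<xi>' ?p + \<xi> ?p * n x) * N x" by (simp add: algebra_simps)
      also have "\<dots> = h1 (\<rho> x) / 2 * N x" unfolding \<xi>_n[OF x] by simp
      finally show ?thesis .
    qed
    show ?thesis unfolding mixed[symmetric] eq by (simp add: algebra_simps)
  qed
  ultimately show "null_partials m (- h2 (\<rho> x) * N x / 4) (m' x) x" by (simp only:)
qed

lemma continuous_n': "continuous_on U n'" "continuous_on U m'"
proof -
  have r: "continuous_on U \<rho>" and N: "continuous_on U N" and n: "continuous_on U n" and m: "continuous_on U m"
    using null_partials_isCont[OF \<rho>_null_partials] null_partials_isCont[OF N_null_partials] null_partials_isCont[OF n_null_partials(1)] null_partials_isCont[OF n_null_partials(2)]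
    by (auto intro!: continuous_at_imp_continuous_on)
  have cs: "continuous_on UNIV sa" "continuous_on UNIV sb" "continuous_on UNIV Dn" "continuous_on UNIV \<xi>"
    using DERIV_isCont[OF sa] DERIV_isCont[OF sb] DERIV_isCont[OF Dn_deriv] DERIV_isCont[OF \<xi>_deriv]
    by (auto intro!: continuous_at_imp_continuous_on)
  have c: "continuous_on U (\<lambda>x. f (fst x - snd x))" "continuous_on U (\<lambda>x. f (fst x + snd x))"
    if "continuous_on UNIV f" for f :: "real \<Rightarrow> real"
    by (rule continuous_on_compose2[OF that]; (intro continuous_intros)?; simp)+
  note cc = c[OF cs(1)] c[OF cs(2)] c[OF cs(3)] c[OF cs(4)]
  have D0: "Dn p \<noteq> 0" for p using Dn_pos[of p] by simp
  have nz: "\<rho> x \<noteq> 0" "\<rho> x - rb \<noteq> 0" "\<rho> x \<noteq> rb" "sb (fst x - snd x) \<noteq> 0" "sb (fst x + snd x) \<noteq> 0" if "x \<in> U" for x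
    using U_facts[OF that] by auto
  note ci = continuous_on_add continuous_on_diff continuous_on_mult continuous_on_divide
    continuous_on_power continuous_on_minus continuous_on_const
  show "continuous_on U n'" "continuous_on U m'"
    unfolding n'_def m'_def \<nu>'_def \<epsilon>_def \<epsilon>'_def
    by (intro ci cc r N n m; (intro ballI)?; simp add: nz D0)+
qed

end

section \<open>The radius function on the Penrose diagram\<close>

text \<open>Exponentiating \<open>ka\<close> times the tortoise equation removes the logarithm at
  \<open>ra\<close>, and the sign condition restores what the absolute values lose. At
  \<open>r = ra\<close> both sides vanish, so a single equation covers the horizon and both of its
  sides.\<close>

lemma radius_equation_iff:
  fixes ra rb ka kb \<eta> r sap saq sbp sbq :: real
  assumes "ka \<noteq> 0" "\<eta> * \<eta> = 1" "r \<noteq> rb" "sbp \<noteq> 0" "sbq \<noteq> 0"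
  shows "sgn (- \<eta> * (r - ra)) = sgn (sap * saq) \<and>
      (r \<noteq> ra \<longrightarrow> 2 * r + ln \<bar>r - ra\<bar> / ka + ln \<bar>r - rb\<bar> / kb =
         (ln \<bar>sap\<bar> / ka + ln \<bar>sbp\<bar> / kb) + (ln \<bar>saq\<bar> / ka + ln \<bar>sbq\<bar> / kb))
    \<longleftrightarrow> - \<eta> * ((r - ra) * exp (2 * ka * r + ka / kb * ln \<bar>r - rb\<bar>)) =
      (sap * exp (ka / kb * ln \<bar>sbp\<bar>)) * (saq * exp (ka / kb * ln \<bar>sbq\<bar>))"
proof -
  define Y where "Y = - \<eta> * (r - ra)"
  define Z where "Z = sap * saq"
  define a where "a = 2 * ka * r + ka / kb * ln \<bar>r - rb\<bar>"
  define b where "b = ka / kb * ln \<bar>sbp\<bar> + ka / kb * ln \<bar>sbq\<bar>"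
  have "\<bar>\<eta>\<bar> = 1" using assms(2) by (metis abs_mult_self_eq abs_1 abs_mult mult_1 mult_cancel_left2 real_sqrt_abs2 real_sqrt_one)
  then have absY: "\<bar>Y\<bar> = \<bar>r - ra\<bar>" by (simp add: Y_def abs_mult)
  have \<eta>0: "\<eta> \<noteq> 0" using assms(2) by auto
  have rhs: "- \<eta> * ((r - ra) * exp (2 * ka * r + ka / kb * ln \<bar>r - rb\<bar>)) =
      (sap * exp (ka / kb * ln \<bar>sbp\<bar>)) * (saq * exp (ka / kb * ln \<bar>sbq\<bar>)) \<longleftrightarrow> Y * exp a = Z * exp b"
    by (simp add: Y_def Z_def a_def b_def exp_add algebra_simps)
  show ?thesis
  proof (cases "r = ra")
    case True
    then have "Y = 0" by (simp add: Y_def)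
    then show ?thesis unfolding rhs using True by (simp add: Y_def[symmetric] Z_def[symmetric] sgn_zero_iff eq_commute[of 0])
  next
    case False
    then have Y0: "Y \<noteq> 0" using \<eta>0 by (simp add: Y_def)
    have tort: "2 * r + ln \<bar>r - ra\<bar> / ka + ln \<bar>r - rb\<bar> / kb =
         (ln \<bar>sap\<bar> / ka + ln \<bar>sbp\<bar> / kb) + (ln \<bar>saq\<bar> / ka + ln \<bar>sbq\<bar> / kb) \<longleftrightarrow> ln \<bar>Y\<bar> + a = ln \<bar>Z\<bar> + b" if "Z \<noteq> 0"
    proof -
      have "ln \<bar>Z\<bar> = ln \<bar>sap\<bar> + ln \<bar>saq\<bar>" using that by (simp add: Z_def abs_mult ln_mult)
      moreover have "2 * r + ln \<bar>r - ra\<bar> / ka + ln \<bar>r - rb\<bar> / kb =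
         (ln \<bar>sap\<bar> / ka + ln \<bar>sbp\<bar> / kb) + (ln \<bar>saq\<bar> / ka + ln \<bar>sbq\<bar> / kb) \<longleftrightarrow>
         ka * (2 * r + ln \<bar>r - ra\<bar> / ka + ln \<bar>r - rb\<bar> / kb) =
         ka * ((ln \<bar>sap\<bar> / ka + ln \<bar>sbp\<bar> / kb) + (ln \<bar>saq\<bar> / ka + ln \<bar>sbq\<bar> / kb))"
        using assms(1) by simp
      ultimately show ?thesis using assms(1) unfolding absY a_def b_def by (simp add: distrib_left mult_ac add_ac)
    qed
    have "Y * exp a = Z * exp b \<longleftrightarrow> sgn Y = sgn Z \<and> ln \<bar>Y\<bar> + a = ln \<bar>Z\<bar> + b"
    proof
      assume eq: "Y * exp a = Z * exp b"
      then have "Z \<noteq> 0" using Y0 by auto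
      have "sgn (Y * exp a) = sgn Y" "sgn (Z * exp b) = sgn Z" by (simp_all add: sgn_mult)
      then have 1: "sgn Y = sgn Z" using eq by simp
      have "\<bar>Y\<bar> * exp a = \<bar>Z\<bar> * exp b" using arg_cong[OF eq, of abs] by (simp add: abs_mult)
      then have "ln (\<bar>Y\<bar> * exp a) = ln (\<bar>Z\<bar> * exp b)" by simp
      then show "sgn Y = sgn Z \<and> ln \<bar>Y\<bar> + a = ln \<bar>Z\<bar> + b"
        using 1 Y0 \<open>Z \<noteq> 0\<close> by (simp add: ln_mult)
    next
      assume *: "sgn Y = sgn Z \<and> ln \<bar>Y\<bar> + a = ln \<bar>Z\<bar> + b"
      then have "Z \<noteq> 0" using Y0 by (metis sgn_zero_iff)
      have "exp (ln \<bar>Y\<bar> + a) = exp (ln \<bar>Z\<bar> + b)" using * by simp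
      then have "\<bar>Y\<bar> * exp a = \<bar>Z\<bar> * exp b" using Y0 \<open>Z \<noteq> 0\<close> by (simp add: exp_add)
      then have "(sgn Y * \<bar>Y\<bar>) * exp a = (sgn Z * \<bar>Z\<bar>) * exp b" using * by (simp add: mult.assoc)
      then show "Y * exp a = Z * exp b" by (simp add: mult.commute[of "sgn _"] abs_mult_sgn)
    qed
    moreover have "sgn Y = sgn Z \<Longrightarrow> Z \<noteq> 0" using Y0 by (metis sgn_zero_iff)
    ultimately show ?thesis unfolding rhs Y_def[symmetric] Z_def[symmetric] using tort False by blast
  qed
qed

locale reissner_nordstrom =
  fixes M e :: real
  assumes M_pos: "0 < M" and e_pos: "0 < e\<^sup>2" and sub: "e\<^sup>2 < M\<^sup>2"
begin

abbreviation "rp \<equiv> r_plus M e"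
abbreviation "rm \<equiv> r_minus M e"
abbreviation "kp \<equiv> kappa_plus M e"
abbreviation "km \<equiv> kappa_minus M e"

lemma roots: "rm > 0" "rm < rp" "rp > 0" "rp + rm = 2 * M" "rp * rm = e\<^sup>2"
proof -
  have s: "sqrt (M\<^sup>2 - e\<^sup>2) > 0" using sub by simp
  have "sqrt (M\<^sup>2 - e\<^sup>2) < sqrt (M\<^sup>2)" using e_pos by (intro real_sqrt_less_mono) simp
  then show "rm > 0" using M_pos by (simp add: r_minus_def)
  then show "rm < rp" "rp > 0" "rp + rm = 2 * M" using s M_pos unfolding r_minus_def r_plus_def by linarith+
  have "rp * rm = M\<^sup>2 - (sqrt (M\<^sup>2 - e\<^sup>2))\<^sup>2" by (simp add: r_minus_def r_plus_def algebra_simps power2_eq_square)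
  then show "rp * rm = e\<^sup>2" using sub by simp
qed

lemma kappas: "kp > 0" "km > 0" "kp = (rp - rm) / (2 * rp\<^sup>2)" "- km = (rm - rp) / (2 * rm\<^sup>2)" "kp \<noteq> 0" "km \<noteq> 0"
proof -
  show "kp > 0" "km > 0" unfolding kappa_plus_def kappa_minus_def using roots by simp_all
  then show "kp \<noteq> 0" "km \<noteq> 0" by auto
  show "kp = (rp - rm) / (2 * rp\<^sup>2)" by (simp add: kappa_plus_def)
  show "- km = (rm - rp) / (2 * rm\<^sup>2)" unfolding kappa_minus_def by (simp add: minus_divide_left)
qed

lemma kpos: "kp > 0" "km > 0" "kp \<noteq> 0" "km \<noteq> 0" using kappas(1,2) by auto

lemma rn_h_eq: "r \<noteq> 0 \<Longrightarrow> rn_h M e r = (r - rp) * (r - rm) / r\<^sup>2"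
proof -
  assume "r \<noteq> 0"
  have "(r - rp) * (r - rm) = r\<^sup>2 - (rp + rm) * r + rp * rm" by (simp add: algebra_simps power2_eq_square)
  then show ?thesis unfolding rn_h_def roots using \<open>r \<noteq> 0\<close> by (simp add: divide_simps) (simp add: algebra_simps power2_eq_square)
qed

definition "s1 p = sin (p / 2)" for p :: real
definition "s2 p = cos (p / 2)" for p :: real

lemma s_deriv: "(s1 has_real_derivative 1 * s2 p / 2) (at p)" "(s2 has_real_derivative - 1 * s1 p / 2) (at p)"
  "(s1 has_real_derivative - (-1) * s2 p / 2) (at p)"
  unfolding s1_def s2_def by (auto intro!: derivative_eq_intros)

lemma ss: "(s1 p)\<^sup>2 + (s2 p)\<^sup>2 = 1" "(s2 p)\<^sup>2 + (s1 p)\<^sup>2 = 1" by (simp_all add: s1_def s2_def)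

lemma is_radius_iff: "is_radius M e x r \<longleftrightarrow> 0 < r \<and>
   sgn (rp - r) = sgn (s1 (fst x - snd x) * s1 (fst x + snd x)) \<and>
   sgn (r - rm) = sgn (s2 (fst x - snd x) * s2 (fst x + snd x)) \<and>
   (r \<noteq> rp \<and> r \<noteq> rm \<longrightarrow> tortoise2 M e r = null_scale M e (fst x - snd x) + null_scale M e (fst x + snd x))"
  unfolding is_radius_def Let_def s1_def s2_def by (simp add: split_beta)

text \<open>Kruskal-type functions of the charts around \<open>r_plus\<close> and
  \<open>r_minus\<close>. The minus sign of \<open>- km\<close> reflects that \<open>h\<close>
  decreases at \<open>r_minus\<close>.\<close>

definition "\<Phi>p r = (r - rp) * exp (2 * kp * r + kp / - km * ln \<bar>r - rm\<bar>)"
definition "\<Phi>m r = (r - rm) * exp (2 * - km * r + - km / kp * ln \<bar>r - rp\<bar>)"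
definition "Ap p = s1 p * exp (kp / - km * ln \<bar>s2 p\<bar>)"
definition "Am p = s2 p * exp (- km / kp * ln \<bar>s1 p\<bar>)"

lemma is_radius_plus:
  assumes "s2 (fst x - snd x) * s2 (fst x + snd x) > 0"
  shows "is_radius M e x r \<longleftrightarrow> rm < r \<and> - \<Phi>p r = Ap (fst x - snd x) * Ap (fst x + snd x)"
proof (cases "rm < r")
  case True
  have "s2 (fst x - snd x) \<noteq> 0" "s2 (fst x + snd x) \<noteq> 0" "r > 0" using assms True roots(1) by auto
  then show ?thesis
    using radius_equation_iff[of kp 1 r rm "s2 (fst x - snd x)" "s2 (fst x + snd x)" rp "s1 (fst x - snd x)" "s1 (fst x + snd x)" "- km"]
      assms True kpos
    unfolding is_radius_iff tortoise2_def null_scale_def \<Phi>p_def Ap_def s1_def[symmetric] s2_def[symmetric] by auto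
next
  case False
  then have "\<not> is_radius M e x r" using assms unfolding is_radius_iff by (auto simp: sgn_if split: if_splits)
  then show ?thesis using False by simp
qed

lemma is_radius_minus:
  assumes "s1 (fst x - snd x) * s1 (fst x + snd x) > 0"
  shows "is_radius M e x r \<longleftrightarrow> 0 < r \<and> r < rp \<and> \<Phi>m r = Am (fst x - snd x) * Am (fst x + snd x)"
proof (cases "r < rp")
  case True
  have "s1 (fst x - snd x) \<noteq> 0" "s1 (fst x + snd x) \<noteq> 0" using assms by auto
  then show ?thesis
    using radius_equation_iff[of "- km" "-1" r rp "s1 (fst x - snd x)" "s1 (fst x + snd x)" rm "s2 (fst x - snd x)" "s2 (fst x + snd x)" kp]
      assms True kpos
    unfolding is_radius_iff tortoise2_def null_scale_def \<Phi>m_def Am_def s1_def[symmetric] s2_def[symmetric] by auto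
next
  case False
  then have "\<not> is_radius M e x r" using assms unfolding is_radius_iff by (auto simp: sgn_if split: if_splits)
  then show ?thesis using False by simp
qed

text \<open>The function \<open>\<Phi>\<close> of a chart does not depend on its domain, so the charts with empty domain already
  provide the injectivity from which the radius is shown to be unique.\<close>

interpretation P0: horizon_chart rp rm kp "- km" 1 s1 s2 "{rm<..}" "{}" "area_radius M e"
  by unfold_locales (use roots kappas ss s_deriv in auto)

interpretation Q0: horizon_chart rm rp "- km" kp "-1" s2 s1 "{0<..<rp}" "{}" "area_radius M e"
  by unfold_locales (use roots kappas ss s_deriv in auto)

lemma inj_\<Phi>p: "inj_on \<Phi>p {rm<..}" and inj_\<Phi>m: "inj_on \<Phi>m {0<..<rp}"
proof -
  have "P0.\<Phi> = \<Phi>p" "Q0.\<Phi> = \<Phi>m" unfolding P0.\<Phi>_def Q0.\<Phi>_def \<Phi>p_def \<Phi>m_def P0.\<beta>_def Q0.\<beta>_def by auto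
  then show "inj_on \<Phi>p {rm<..}" "inj_on \<Phi>m {0<..<rp}" using P0.inj_\<Phi> Q0.inj_\<Phi> by simp_all
qed

text \<open>The power of \<open>r - rm\<close> is \<open>- kp / km\<close>, hence negative, so the
  exponential factor blows up at \<open>rm\<close>, where \<open>r - rp\<close> is negative; at
  infinity the exponential growth wins. Thus in this chart the sign condition alone guarantees a
  radius.\<close>

lemma \<Phi>p_surj: "\<exists>r>rm. \<Phi>p r = y"
proof -
  define b where "b = kp / km"
  have b: "b > 0" using kpos by (simp add: b_def)
  have eq: "eventually (\<lambda>r. (r - rp) * exp (2 * kp * r - b * ln (r - rm)) = \<Phi>p r) at_top"
    "eventually (\<lambda>r. (r - rp) * exp (2 * kp * r - b * ln (r - rm)) = \<Phi>p r) (at_right rm)"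
    by (rule eventually_mono[OF eventually_gt_at_top[of rm]], simp add: \<Phi>p_def b_def)
      (rule eventually_mono[OF eventually_at_right_less[of rm]], simp add: \<Phi>p_def b_def)
  have k: "kp > 0" by (rule kappas)
  have r: "rm < rp" by (rule roots)
  have "filterlim (\<lambda>r. (r - rp) * exp (2 * kp * r - b * ln (r - rm))) at_top at_top"
    using b k by real_asymp
  then have top: "filterlim \<Phi>p at_top at_top" using filterlim_cong[OF refl refl eq(1)] by blast
  have "filterlim (\<lambda>r. (rp - r) * exp (2 * kp * r - b * ln (r - rm))) at_top (at_right rm)"
    using b k r by real_asymp
  moreover have "(\<lambda>r. (rp - r) * exp (2 * kp * r - b * ln (r - rm))) = (\<lambda>r. - ((r - rp) * exp (2 * kp * r - b * ln (r - rm))))"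
    by (simp add: fun_eq_iff algebra_simps)
  ultimately have "filterlim (\<lambda>r. (r - rp) * exp (2 * kp * r - b * ln (r - rm))) at_bot (at_right rm)"
    by (simp only: filterlim_uminus_at_bot)
  then have bot: "filterlim \<Phi>p at_bot (at_right rm)" using filterlim_cong[OF refl refl eq(2)] by blast
  have "eventually (\<lambda>r. \<Phi>p r \<ge> y \<and> r > rp) at_top"
    using top eventually_gt_at_top[of rp] unfolding filterlim_at_top by (auto intro: eventually_conj)
  then obtain r2 where r2: "\<Phi>p r2 \<ge> y" "r2 > rp" using eventually_happens'[OF trivial_limit_at_top_linorder] by blast
  have "eventually (\<lambda>r. \<Phi>p r \<le> y \<and> r \<in> {rm<..<rp}) (at_right rm)"
    using bot eventually_at_right_real[OF r] unfolding filterlim_at_bot by (auto intro: eventually_conj)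
  then obtain r1 where r1: "\<Phi>p r1 \<le> y" "r1 \<in> {rm<..<rp}"
    using eventually_happens'[OF trivial_limit_at_right_real[of rm]] by blast
  have "continuous_on {r1..r2} \<Phi>p"
    unfolding \<Phi>p_def using r1 kpos by (intro continuous_intros) auto
  then obtain r where "r1 \<le> r" "\<Phi>p r = y" using IVT'[of \<Phi>p r1 y r2] r1 r2 by auto
  then show ?thesis using r1 by (intro exI[of _ r]) auto
qed

lemma \<Phi>m_deriv_pos:
  assumes "0 < r" "r < rp"
  shows "\<exists>d>0. (\<Phi>m has_real_derivative d) (at r)"
proof -
  have "Q0.\<Phi> = \<Phi>m" unfolding Q0.\<Phi>_def \<Phi>m_def Q0.\<beta>_def by auto
  moreover have "2 * - km * r\<^sup>2 / (r - rp) > 0" using assms kpos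
    by (intro divide_neg_neg) (auto intro: mult_neg_pos)
  ultimately show ?thesis
    using Q0.\<Phi>_deriv[of r] assms mult_pos_pos[OF exp_gt_zero] by fastforce
qed

text \<open>\<open>\<Phi>m\<close> is increasing and blows up at \<open>rp\<close>, but it starts
  from the finite value \<open>\<Phi>m 0\<close>, which marks the singularity \<open>r = 0\<close>
  in the diagram.\<close>

lemma \<Phi>m_range: "(\<exists>r. 0 < r \<and> r < rp \<and> \<Phi>m r = y) \<longleftrightarrow> \<Phi>m 0 < y"
proof
  assume "\<exists>r. 0 < r \<and> r < rp \<and> \<Phi>m r = y"
  then obtain r where r: "0 < r" "r < rp" "\<Phi>m r = y" by blast
  have "continuous_on {0..r} \<Phi>m" unfolding \<Phi>m_def using r kpos by (intro continuous_intros) auto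
  then show "\<Phi>m 0 < y"
    using DERIV_pos_imp_increasing_open[OF r(1), of \<Phi>m] \<Phi>m_deriv_pos r by force
next
  assume y: "\<Phi>m 0 < y"
  define b where "b = km / kp"
  have b: "b > 0" using kpos by (simp add: b_def)
  have eq: "eventually (\<lambda>r. (r - rm) * exp (- 2 * km * r - b * ln (rp - r)) = \<Phi>m r) (at_left rp)"
    by (rule eventually_mono[OF eventually_at_left_real[of 0 rp]]) (use roots in \<open>simp_all add: \<Phi>m_def b_def\<close>)
  have r: "rm < rp" by (rule roots)
  have "filterlim (\<lambda>r. (r - rm) * exp (- 2 * km * r - b * ln (rp - r))) at_top (at_left rp)"
    using b r by real_asymp
  then have top: "filterlim \<Phi>m at_top (at_left rp)" using filterlim_cong[OF refl refl eq] by blast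
  have "eventually (\<lambda>r. \<Phi>m r \<ge> y \<and> r \<in> {rm<..<rp}) (at_left rp)"
    using top eventually_at_left_real[OF r] unfolding filterlim_at_top by (auto intro: eventually_conj)
  then obtain r2 where r2: "\<Phi>m r2 \<ge> y" "r2 \<in> {rm<..<rp}"
    using eventually_happens'[OF trivial_limit_at_left_real[of rp]] by blast
  have "continuous_on {0..r2} \<Phi>m"
    unfolding \<Phi>m_def using r2 kpos by (intro continuous_intros) auto
  then obtain r where "0 \<le> r" "r \<le> r2" "\<Phi>m r = y" using IVT'[of \<Phi>m 0 y r2] r2 y roots by auto
  then show "\<exists>r. 0 < r \<and> r < rp \<and> \<Phi>m r = y" using r2 y by (intro exI[of _ r]) (auto simp: le_less)
qed

text \<open>\<open>Up\<close> covers the regions I, I', II, II' and \<open>Um\<close> the regions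
  II, II', III, III', each with the horizons and bifurcation spheres between them. The last
  condition of \<open>Um\<close> stops at the singularity \<open>r = 0\<close>.\<close>

definition Up :: "(real \<times> real) set" where
  "Up = {x. \<bar>snd x\<bar> < pi \<and> s2 (fst x - snd x) * s2 (fst x + snd x) > 0}"

definition Um :: "(real \<times> real) set" where
  "Um = {x. \<bar>snd x\<bar> < pi \<and> s1 (fst x - snd x) * s1 (fst x + snd x) > 0 \<and>
     \<Phi>m 0 < Am (fst x - snd x) * Am (fst x + snd x)}"

abbreviation "D \<equiv> penrose_diagram M e"
abbreviation "\<rho> \<equiv> area_radius M e"

lemma area_radius_eqI:
  assumes "is_radius M e x r" "\<And>r'. is_radius M e x r' \<Longrightarrow> r' = r"
  shows "\<rho> x = r"
  unfolding area_radius_def using assms by (rule the_equality)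

lemma Up_radius:
  assumes "x \<in> Up"
  shows "x \<in> D" "\<rho> x > rm" "- \<Phi>p (\<rho> x) = Ap (fst x - snd x) * Ap (fst x + snd x)"
proof -
  have s: "s2 (fst x - snd x) * s2 (fst x + snd x) > 0" using assms by (simp add: Up_def)
  obtain r where r: "r > rm" "\<Phi>p r = - (Ap (fst x - snd x) * Ap (fst x + snd x))" using \<Phi>p_surj by blast
  have 1: "is_radius M e x r" using r by (simp add: is_radius_plus[OF s])
  then show "x \<in> D" using assms unfolding penrose_diagram_def Up_def by blast
  have "\<rho> x = r"
  proof (rule area_radius_eqI[OF 1])
    fix r' assume "is_radius M e x r'"
    then have "r' > rm" "\<Phi>p r' = \<Phi>p r" using r by (auto simp: is_radius_plus[OF s])
    then show "r' = r" using inj_onD[OF inj_\<Phi>p, of r' r] r(1) by simp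
  qed
  then show "\<rho> x > rm" "- \<Phi>p (\<rho> x) = Ap (fst x - snd x) * Ap (fst x + snd x)" using r by simp_all
qed

lemma Um_radius:
  assumes "x \<in> Um"
  shows "x \<in> D" "0 < \<rho> x" "\<rho> x < rp" "\<Phi>m (\<rho> x) = Am (fst x - snd x) * Am (fst x + snd x)"
proof -
  have s: "s1 (fst x - snd x) * s1 (fst x + snd x) > 0" using assms by (simp add: Um_def)
  have "\<Phi>m 0 < Am (fst x - snd x) * Am (fst x + snd x)" using assms by (simp add: Um_def)
  then obtain r where r: "0 < r" "r < rp" "\<Phi>m r = Am (fst x - snd x) * Am (fst x + snd x)"
    using \<Phi>m_range by blast
  have 1: "is_radius M e x r" using r by (simp add: is_radius_minus[OF s])
  then show "x \<in> D" using assms unfolding penrose_diagram_def Um_def by blast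
  have "\<rho> x = r"
  proof (rule area_radius_eqI[OF 1])
    fix r' assume "is_radius M e x r'"
    then have "0 < r'" "r' < rp" "\<Phi>m r' = \<Phi>m r" using r by (auto simp: is_radius_minus[OF s])
    then show "r' = r" using inj_onD[OF inj_\<Phi>m, of r' r] r by simp
  qed
  then show "0 < \<rho> x" "\<rho> x < rp" "\<Phi>m (\<rho> x) = Am (fst x - snd x) * Am (fst x + snd x)" using r by simp_all
qed

lemma D_eq: "D = Up \<union> Um"
proof
  show "Up \<union> Um \<subseteq> D" using Up_radius(1) Um_radius(1) by blast
  show "D \<subseteq> Up \<union> Um"
  proof
    fix x assume "x \<in> D"
    then obtain r where x: "\<bar>snd x\<bar> < pi" "is_radius M e x r" unfolding penrose_diagram_def by blast
    show "x \<in> Up \<union> Um"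
    proof (cases "rm < r")
      case True
      then have "sgn (s2 (fst x - snd x) * s2 (fst x + snd x)) = 1" using x(2) by (simp add: is_radius_iff)
      then show ?thesis using x(1) by (simp add: Up_def sgn_1_pos)
    next
      case False
      then have "sgn (s1 (fst x - snd x) * s1 (fst x + snd x)) = 1" using x(2) roots(2) by (simp add: is_radius_iff)
      then have s: "s1 (fst x - snd x) * s1 (fst x + snd x) > 0" by (simp add: sgn_1_pos)
      then have "\<Phi>m 0 < Am (fst x - snd x) * Am (fst x + snd x)"
        using x(2) \<Phi>m_range by (auto simp: is_radius_minus[OF s])
      then show ?thesis using x(1) s by (simp add: Um_def)
    qed
  qed
qed

lemma s_prod: "s2 (fst x - snd x) * s2 (fst x + snd x) = (cos (fst x) + cos (snd x)) / 2"
    "s1 (fst x - snd x) * s1 (fst x + snd x) = (cos (snd x) - cos (fst x)) / 2"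
proof -
  have *: "(fst x - snd x) / 2 - (fst x + snd x) / 2 = - snd x" "(fst x - snd x) / 2 + (fst x + snd x) / 2 = fst x"
    by (simp_all add: field_simps)
  show "s2 (fst x - snd x) * s2 (fst x + snd x) = (cos (fst x) + cos (snd x)) / 2"
    unfolding s2_def cos_times_cos * by simp
  show "s1 (fst x - snd x) * s1 (fst x + snd x) = (cos (snd x) - cos (fst x)) / 2"
    unfolding s1_def sin_times_sin * by simp
qed

lemma continuous_s: "continuous_on A (\<lambda>x. s1 (fst x - snd x))" "continuous_on A (\<lambda>x. s1 (fst x + snd x))"
   "continuous_on A (\<lambda>x. s2 (fst x - snd x))" "continuous_on A (\<lambda>x. s2 (fst x + snd x))"
  unfolding s1_def s2_def by (intro continuous_intros; simp)+

lemma open_Up: "open Up"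
proof -
  have "open {x::real \<times> real. \<bar>snd x\<bar> < pi}" by (intro open_Collect_less continuous_intros)
  moreover have "open {x::real \<times> real. 0 < s2 (fst x - snd x) * s2 (fst x + snd x)}"
    by (intro open_Collect_less continuous_on_mult continuous_s continuous_on_const)
  ultimately show ?thesis unfolding Up_def by (rule open_Collect_conj)
qed

lemma open_Um: "open Um"
proof -
  define V where "V = {x::real \<times> real. 0 < s1 (fst x - snd x) * s1 (fst x + snd x)}"
  have V: "open V" unfolding V_def by (intro open_Collect_less continuous_on_mult continuous_s continuous_on_const)
  have "continuous_on V (\<lambda>x. Am (fst x - snd x) * Am (fst x + snd x))"
    unfolding Am_def
    by (intro continuous_on_mult continuous_on_exp continuous_on_const continuous_s continuous_on_ln continuous_on_rabs)
      (auto simp: V_def)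
  then have "open (V \<inter> (\<lambda>x. Am (fst x - snd x) * Am (fst x + snd x)) -` {\<Phi>m 0<..})"
    using V by (intro continuous_open_preimage) auto
  moreover have "open {x::real \<times> real. \<bar>snd x\<bar> < pi}" by (intro open_Collect_less continuous_intros)
  moreover have "Um = {x. \<bar>snd x\<bar> < pi} \<inter> (V \<inter> (\<lambda>x. Am (fst x - snd x) * Am (fst x + snd x)) -` {\<Phi>m 0<..})"
    by (auto simp: Um_def V_def)
  ultimately show ?thesis by (simp only: open_Int)
qed

lemma open_D: "open D" unfolding D_eq using open_Up open_Um by auto

sublocale P: horizon_chart rp rm kp "- km" 1 s1 s2 "{rm<..}" Up "area_radius M e"
proof unfold_locales
  fix x assume x: "x \<in> Up"
  show "\<rho> x \<in> {rm<..}" using Up_radius(2)[OF x] by simp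
  show "s2 (fst x - snd x) * s2 (fst x + snd x) > 0" using x by (simp add: Up_def)
  show "- 1 * ((\<rho> x - rp) * exp (2 * kp * \<rho> x + kp / - km * ln \<bar>\<rho> x - rm\<bar>)) =
      s1 (fst x - snd x) * exp (kp / - km * ln \<bar>s2 (fst x - snd x)\<bar>) *
      (s1 (fst x + snd x) * exp (kp / - km * ln \<bar>s2 (fst x + snd x)\<bar>))"
    using Up_radius(3)[OF x] by (simp add: \<Phi>p_def Ap_def)
qed (use roots kappas ss s_deriv open_Up in auto)

sublocale Q: horizon_chart rm rp "- km" kp "-1" s2 s1 "{0<..<rp}" Um "area_radius M e"
proof unfold_locales
  fix x assume x: "x \<in> Um"
  show "\<rho> x \<in> {0<..<rp}" using Um_radius(2,3)[OF x] by simp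
  show "s1 (fst x - snd x) * s1 (fst x + snd x) > 0" using x by (simp add: Um_def)
  show "- (-1) * ((\<rho> x - rm) * exp (2 * - km * \<rho> x + - km / kp * ln \<bar>\<rho> x - rp\<bar>)) =
      s2 (fst x - snd x) * exp (- km / kp * ln \<bar>s1 (fst x - snd x)\<bar>) *
      (s2 (fst x + snd x) * exp (- km / kp * ln \<bar>s1 (fst x + snd x)\<bar>))"
    using Um_radius(4)[OF x] by (simp add: \<Phi>m_def Am_def)
qed (use roots kappas ss s_deriv open_Um in auto)

text \<open>Passing to the other chart exchanges \<open>(sa, ka)\<close> with
  \<open>(sb, kb)\<close> and flips \<open>\<eta>\<close>, which leaves these expressions
  invariant.\<close>

lemma chart_functions_eq:
  "Q.Dn = P.Dn" "Q.\<xi> = P.\<xi>" "Q.\<xi>' = P.\<xi>'" "Q.h = P.h" "Q.h1 = P.h1" "Q.h2 = P.h2"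
proof -
  show D: "Q.Dn = P.Dn" by (rule ext) (simp add: P.Dn_def Q.Dn_def algebra_simps)
  show xi: "Q.\<xi> = P.\<xi>" by (rule ext) (simp add: P.\<xi>_def Q.\<xi>_def D mult_ac)
  show "Q.\<xi>' = P.\<xi>'" 
    by (rule ext) (rule DERIV_unique[OF Q.\<xi>_deriv[unfolded xi] P.\<xi>_deriv])
  show "Q.h = P.h" "Q.h1 = P.h1" "Q.h2 = P.h2"
    by (simp_all add: fun_eq_iff P.h_def Q.h_def P.h1_def Q.h1_def P.h2_def Q.h2_def mult_ac add_ac)
qed

abbreviation "\<xi> \<equiv> P.\<xi>"
abbreviation "\<xi>' \<equiv> P.\<xi>'"
abbreviation "h \<equiv> P.h"
abbreviation "h1 \<equiv> P.h1"
abbreviation "h2 \<equiv> P.h2"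

lemma \<xi>_zero_iff: "\<xi> p = 0 \<longleftrightarrow> s1 p = 0 \<or> s2 p = 0"
  unfolding P.\<xi>_def using kpos P.Dn_pos[of p] by auto

text \<open>The overlap contains no horizon, so \<open>\<xi>\<close> does not vanish and the
  chart-independent identities for \<open>N * \<xi> p * \<xi> q\<close>, \<open>\<xi> * n\<close>
  and \<open>\<xi> * m\<close> can be solved for \<open>N\<close>, \<open>n\<close> and
  \<open>m\<close>.\<close>

lemma overlap:
  assumes "x \<in> Up" "x \<in> Um"
  shows "Q.N x = P.N x" "Q.n x = P.n x" "Q.m x = P.m x"
proof -
  have 0: "\<xi> (fst x - snd x) \<noteq> 0" "\<xi> (fst x + snd x) \<noteq> 0"
    using assms by (auto simp: \<xi>_zero_iff Up_def Um_def)
  have "Q.N x * \<xi> (fst x - snd x) * \<xi> (fst x + snd x) = P.N x * \<xi> (fst x - snd x) * \<xi> (fst x + snd x)"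
    using P.N_\<xi>_\<xi>[OF assms(1)] Q.N_\<xi>_\<xi>[OF assms(2)] unfolding chart_functions_eq by simp
  then show "Q.N x = P.N x" using 0 by simp
  have "\<xi> (fst x - snd x) * Q.n x = \<xi> (fst x - snd x) * P.n x" "\<xi> (fst x + snd x) * Q.m x = \<xi> (fst x + snd x) * P.m x"
    using P.\<xi>_n[OF assms(1)] Q.\<xi>_n[OF assms(2)] unfolding chart_functions_eq by simp_all
  then show "Q.n x = P.n x" "Q.m x = P.m x" using 0 by simp_all
qed

lemma overlap':
  assumes "x \<in> Up" "x \<in> Um"
  shows "Q.n' x = P.n' x" "Q.m' x = P.m' x"
proof -
  have op: "open (Up \<inter> Um)" using open_Up open_Um by auto
  have "null_partials Q.n (P.n' x) (- h2 (\<rho> x) * P.N x / 4) x"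
    by (rule null_partials_cong[OF P.n_null_partials(1)[OF assms(1)] op]) (use assms overlap in auto)
  from null_partials_unique(1)[OF Q.n_null_partials(1)[OF assms(2)] this] show "Q.n' x = P.n' x" .
  have "null_partials Q.m (- h2 (\<rho> x) * P.N x / 4) (P.m' x) x"
    by (rule null_partials_cong[OF P.n_null_partials(2)[OF assms(1)] op]) (use assms overlap in auto)
  from null_partials_unique(2)[OF Q.n_null_partials(2)[OF assms(2)] this] show "Q.m' x = P.m' x" .
qed

definition "N x = (if x \<in> Up then P.N x else Q.N x)"
definition "n x = (if x \<in> Up then P.n x else Q.n x)"
definition "m x = (if x \<in> Up then P.m x else Q.m x)"
definition "n' x = (if x \<in> Up then P.n' x else Q.n' x)"
definition "m' x = (if x \<in> Up then P.m' x else Q.m' x)"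

lemma on_Up: "x \<in> Up \<Longrightarrow> N x = P.N x \<and> n x = P.n x \<and> m x = P.m x \<and> n' x = P.n' x \<and> m' x = P.m' x"
  by (simp add: N_def n_def m_def n'_def m'_def)

lemma on_Um: "x \<in> Um \<Longrightarrow> N x = Q.N x \<and> n x = Q.n x \<and> m x = Q.m x \<and> n' x = Q.n' x \<and> m' x = Q.m' x"
  using overlap[of x] overlap'[of x] by (simp add: N_def n_def m_def n'_def m'_def)

lemma \<rho>_pos: "x \<in> D \<Longrightarrow> \<rho> x > 0"
  using Up_radius(2)[of x] Um_radius(2)[of x] roots(1) unfolding D_eq by force

lemma N_pos: "N x > 0" by (simp add: N_def P.N_pos Q.N_pos)

lemma N_\<xi>_\<xi>: "x \<in> D \<Longrightarrow> N x * \<xi> (fst x - snd x) * \<xi> (fst x + snd x) = - h (\<rho> x)"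
  using P.N_\<xi>_\<xi>[of x] Q.N_\<xi>_\<xi>[of x] on_Up[of x] on_Um[of x] unfolding D_eq chart_functions_eq by auto

lemma \<rho>_null_partials: "x \<in> D \<Longrightarrow> null_partials \<rho> (- \<xi> (fst x + snd x) * N x / 2) (- \<xi> (fst x - snd x) * N x / 2) x"
  using P.\<rho>_null_partials[of x] Q.\<rho>_null_partials[of x] on_Up[of x] on_Um[of x] unfolding D_eq chart_functions_eq by auto

lemma null_partials_glue:
  assumes "x \<in> D" and "x \<in> Up \<Longrightarrow> null_partials f a b x" and "x \<in> Um \<Longrightarrow> null_partials f' a b x"
    and "\<And>y. y \<in> Up \<Longrightarrow> f y = F y" "\<And>y. y \<in> Um \<Longrightarrow> f' y = F y"
  shows "null_partials F a b x"
  using assms(1) unfolding D_eq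
proof
  assume "x \<in> Up" then show ?thesis using null_partials_cong[OF assms(2) open_Up] assms(4) by blast
next
  assume "x \<in> Um" then show ?thesis using null_partials_cong[OF assms(3) open_Um] assms(5) by blast
qed

lemma lnN_null_partials: "x \<in> D \<Longrightarrow> null_partials (\<lambda>x. ln (N x)) (n x) (m x) x"
  by (rule null_partials_glue[where f = P.lnN and f' = Q.lnN])
    (use P.lnN_null_partials Q.lnN_null_partials on_Up on_Um in \<open>auto simp: P.N_def Q.N_def\<close>)

lemma n_null_partials: "x \<in> D \<Longrightarrow> null_partials n (n' x) (- h2 (\<rho> x) * N x / 4) x"
  by (rule null_partials_glue[where f = P.n and f' = Q.n])
    (use P.n_null_partials(1) Q.n_null_partials(1) on_Up on_Um in \<open>auto simp: chart_functions_eq\<close>)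

lemma m_null_partials: "x \<in> D \<Longrightarrow> null_partials m (- h2 (\<rho> x) * N x / 4) (m' x) x"
  by (rule null_partials_glue[where f = P.m and f' = Q.m])
    (use P.n_null_partials(2) Q.n_null_partials(2) on_Up on_Um in \<open>auto simp: chart_functions_eq\<close>)

lemma continuous_n': "continuous_on D n'" "continuous_on D m'"
proof -
  have "continuous_on Up n'" "continuous_on Um n'" "continuous_on Up m'" "continuous_on Um m'"
    using P.continuous_n' Q.continuous_n' on_Up on_Um by (auto cong: continuous_on_cong)
  then show "continuous_on D n'" "continuous_on D m'"
    unfolding D_eq using open_Up open_Um by (auto intro: continuous_on_open_Un)
qed

end

section \<open>Shape of the diagram and conformal factor\<close>

context reissner_nordstrom begin

lemma is_radius_area_radius:
  assumes "x \<in> D"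
  shows "is_radius M e x (\<rho> x)"
  using assms unfolding D_eq
proof
  assume x: "x \<in> Up"
  then have "s2 (fst x - snd x) * s2 (fst x + snd x) > 0" by (simp add: Up_def)
  from is_radius_plus[OF this] show ?thesis using Up_radius[OF x] by simp
next
  assume x: "x \<in> Um"
  then have "s1 (fst x - snd x) * s1 (fst x + snd x) > 0" by (simp add: Um_def)
  from is_radius_minus[OF this] show ?thesis using Um_radius[OF x] by simp
qed

lemma reflect_diagram:
  assumes "(T, X) \<in> D"
  shows "(T, - X) \<in> D" "\<rho> (T, - X) = \<rho> (T, X)" "N (T, - X) = N (T, X)"
    "n (T, - X) = m (T, X)" "m (T, - X) = n (T, X)"
proof -
  have *: "is_radius M e (T, - X) r = is_radius M e (T, X) r" for r
    by (simp add: is_radius_iff mult.commute add.commute)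
  show "(T, - X) \<in> D" 
  proof -
    obtain r where "\<bar>X\<bar> < pi" "is_radius M e (T, X) r" using assms by (auto simp: penrose_diagram_def)
    with *[of r] show ?thesis unfolding penrose_diagram_def by auto
  qed
  show r: "\<rho> (T, - X) = \<rho> (T, X)" by (simp add: area_radius_def *)
  have U: "(T, - X) \<in> Up \<longleftrightarrow> (T, X) \<in> Up" by (simp add: Up_def mult.commute)
  have "P.lnN (T, - X) = P.lnN (T, X)" "Q.lnN (T, - X) = Q.lnN (T, X)"
    unfolding P.lnN_def Q.lnN_def r by simp_all
  then have N': "P.N (T, - X) = P.N (T, X)" "Q.N (T, - X) = Q.N (T, X)" by (simp_all add: P.N_def Q.N_def)
  then show "N (T, - X) = N (T, X)" by (simp add: N_def U)
  show "n (T, - X) = m (T, X)" "m (T, - X) = n (T, X)"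
    by (simp_all add: n_def m_def U P.n_def P.m_def Q.n_def Q.m_def r N')
qed

lemma cos_shift: "cos (T - 2 * pi * of_int k) = cos T"
  by (simp add: cos_diff)

text \<open>Inside the strip the region is a chain of diamonds around the even bifurcation spheres.
  Rounding \<open>T / (2 * pi)\<close> to \<open>k\<close> leaves an angle of absolute value at most
  \<open>pi\<close>, where \<open>cos\<close> is monotone.\<close>

lemma cos_sum_pos_iff:
  assumes "\<bar>X\<bar> < pi"
  shows "cos T + cos X > 0 \<longleftrightarrow> (\<exists>k::int. \<bar>T - 2 * pi * of_int k\<bar> + \<bar>X\<bar> < pi)"
proof
  assume pos: "cos T + cos X > 0"
  define k where "k = round (T / (2 * pi))"
  have "\<bar>of_int k - T / (2 * pi)\<bar> \<le> 1 / 2" unfolding k_def by (rule of_int_round_abs_le)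
  then have "\<bar>2 * pi\<bar> * \<bar>of_int k - T / (2 * pi)\<bar> \<le> 2 * pi * (1 / 2)" by (intro mult_mono) auto
  also have "2 * pi * (1 / 2) = pi" by simp
  finally have "\<bar>2 * pi\<bar> * \<bar>of_int k - T / (2 * pi)\<bar> \<le> pi" .
  then have "\<bar>2 * pi * (of_int k - T / (2 * pi))\<bar> \<le> pi" by (simp only: abs_mult[symmetric] mult_1_right)
  moreover have "2 * pi * (of_int k - T / (2 * pi)) = - (T - 2 * pi * of_int k)" by (simp add: right_diff_distrib)
  ultimately have le: "\<bar>T - 2 * pi * of_int k\<bar> \<le> pi" by simp
  have "cos \<bar>T - 2 * pi * of_int k\<bar> = cos T" using cos_shift by simp
  moreover have "cos (pi - \<bar>X\<bar>) = - cos X" by (simp add: cos_diff)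
  ultimately have "cos (pi - \<bar>X\<bar>) < cos \<bar>T - 2 * pi * of_int k\<bar>" using pos by linarith
  then have "\<bar>T - 2 * pi * of_int k\<bar> < pi - \<bar>X\<bar>"
    using cos_mono_less_eq[of "pi - \<bar>X\<bar>" "\<bar>T - 2 * pi * of_int k\<bar>"] le assms by simp
  then show "\<exists>k::int. \<bar>T - 2 * pi * of_int k\<bar> + \<bar>X\<bar> < pi" by (intro exI[of _ k]) linarith
next
  assume "\<exists>k::int. \<bar>T - 2 * pi * of_int k\<bar> + \<bar>X\<bar> < pi"
  then obtain k :: int where k: "\<bar>T - 2 * pi * of_int k\<bar> + \<bar>X\<bar> < pi" by blast
  have "cos (pi - \<bar>X\<bar>) < cos \<bar>T - 2 * pi * of_int k\<bar>"
    using cos_mono_less_eq[of "pi - \<bar>X\<bar>" "\<bar>T - 2 * pi * of_int k\<bar>"] k by simp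
  moreover have "cos \<bar>T - 2 * pi * of_int k\<bar> = cos T" using cos_shift by simp
  moreover have "cos (pi - \<bar>X\<bar>) = - cos X" by (simp add: cos_diff)
  ultimately show "cos T + cos X > 0" by linarith
qed

lemma Up_iff: "(T, X) \<in> Up \<longleftrightarrow> \<bar>X\<bar> < pi \<and> cos T + cos X > 0"
  unfolding Up_def mem_Collect_eq s_prod by simp

lemma Am_prod:
  assumes "s1 (T - X) * s1 (T + X) > 0"
  shows "Am (T - X) * Am (T + X) = (cos T + cos X) / 2 * exp (- km / kp * ln ((cos X - cos T) / 2))"
proof -
  have "ln ((cos X - cos T) / 2) = ln (\<bar>s1 (T - X)\<bar> * \<bar>s1 (T + X)\<bar>)"
    using s_prod(2)[of "(T, X)"] assms by (simp add: abs_mult[symmetric])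
  also have "\<dots> = ln \<bar>s1 (T - X)\<bar> + ln \<bar>s1 (T + X)\<bar>" using assms by (subst ln_mult) auto
  finally have "exp (- km / kp * ln ((cos X - cos T) / 2)) = exp (- km / kp * ln \<bar>s1 (T - X)\<bar>) * exp (- km / kp * ln \<bar>s1 (T + X)\<bar>)"
    by (simp only: distrib_left exp_add)
  moreover have "(cos T + cos X) / 2 = s2 (T - X) * s2 (T + X)" using s_prod(1)[of "(T, X)"] by simp
  ultimately show ?thesis by (simp add: Am_def mult_ac)
qed

text \<open>In terms of \<open>cos T\<close> and \<open>cos X\<close> the condition is visibly
  periodic in \<open>T\<close>, which permits a shift into a single diamond.\<close>

lemma Um_iff: "(T, X) \<in> Um \<longleftrightarrow> \<bar>X\<bar> < pi \<and> cos X - cos T > 0 \<and>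
    \<Phi>m 0 < (cos T + cos X) / 2 * exp (- km / kp * ln ((cos X - cos T) / 2))"
proof -
  have "cos X - cos T > 0 \<longleftrightarrow> s1 (T - X) * s1 (T + X) > 0"
    unfolding s_prod(2)[of "(T, X)", unfolded fst_conv snd_conv] by simp
  then show ?thesis unfolding Um_def using Am_prod[of T X] by auto
qed

lemma \<Phi>m_0: "\<Phi>m 0 < 0"
  unfolding \<Phi>m_def using roots(1) by (simp add: mult_neg_pos)

lemma Am_decreasing:
  assumes "0 < p'" "p' \<le> p" "p < 2 * pi"
  shows "Am p \<le> Am p'"
proof (cases "p' = p")
  case False
  then have "p' < p" using assms by simp
  then have "Am p < Am p'"
  proof (rule DERIV_neg_imp_decreasing)
    fix x assume x: "p' \<le> x" "x \<le> p"
    have s: "s1 x > 0" unfolding s1_def using x assms by (intro sin_gt_zero) auto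
    have "Q.A = Am" by (rule ext) (simp add: Q.A_def Am_def Q.\<beta>_def)
    then have "(Am has_real_derivative - exp (Q.\<beta> * ln \<bar>s1 x\<bar>) * Q.Dn x / (2 * kp * s1 x)) (at x)"
      using Q.A_deriv[of x] s by simp
    moreover have "- exp (Q.\<beta> * ln \<bar>s1 x\<bar>) * Q.Dn x / (2 * kp * s1 x) < 0"
      using s kpos Q.Dn_pos[of x] by (intro divide_neg_pos) (auto intro: mult_neg_pos)
    ultimately show "\<exists>y. (Am has_real_derivative y) (at x) \<and> y < 0" by blast
  qed
  then show ?thesis by simp
qed simp

text \<open>Moving towards the axis inside the light cone does not increase
  \<open>\<bar>T - c\<bar> + \<bar>X\<bar>\<close>, so the diamonds are respected. The singularity
  is avoided as well: \<open>p\<close> decreases, \<open>q\<close> increases and \<open>Am\<close>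
  is a decreasing function, which keeps the product of the two values of \<open>Am\<close> above
  \<open>\<Phi>m 0\<close>.\<close>

lemma triangle_diagram:
  assumes x: "(T, X) \<in> D" and le: "X \<le> X'" "X' \<le> 0" "\<bar>T' - T\<bar> \<le> X' - X"
  shows "(T', X') \<in> D"
proof -
  have X: "\<bar>X\<bar> < pi" using x by (simp add: penrose_diagram_def)
  then have X': "\<bar>X'\<bar> < pi" using le by linarith
  have step: "cos (T' - c) + cos X' > 0" if c: "cos (T - c) + cos X > 0" for c
  proof -
    obtain k :: int where "\<bar>T - c - 2 * pi * of_int k\<bar> + \<bar>X\<bar> < pi" using c cos_sum_pos_iff[OF X] by blast
    then have "\<bar>T' - c - 2 * pi * of_int k\<bar> + \<bar>X'\<bar> < pi" using le by linarith
    then show ?thesis using cos_sum_pos_iff[OF X'] by blast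
  qed
  show ?thesis
  proof (cases "(T, X) \<in> Up")
    case True
    then have "(T', X') \<in> Up" using step[of 0] X' by (simp add: Up_iff)
    then show ?thesis by (simp add: D_eq)
  next
    case False
    then have um: "(T, X) \<in> Um" using x by (simp add: D_eq)
    then have "cos (T - pi) + cos X > 0" by (simp add: Um_iff cos_diff)
    then obtain k :: int where k: "\<bar>T - pi - 2 * pi * of_int k\<bar> + \<bar>X\<bar> < pi" using cos_sum_pos_iff[OF X] by blast
    then have k': "\<bar>T' - pi - 2 * pi * of_int k\<bar> + \<bar>X'\<bar> < pi" using le by linarith
    define S where "S = T - 2 * pi * of_int k"
    define S' where "S' = T' - 2 * pi * of_int k"
    have cosS: "cos S = cos T" "cos S' = cos T'" unfolding S_def S'_def by (rule cos_shift)+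
    have "(S, X) \<in> Um" using um unfolding Um_iff cosS .
    then have A: "\<Phi>m 0 < Am (S - X) * Am (S + X)" by (simp add: Um_def)
    \<comment> \<open>After the shift all null coordinates lie in one period, between 0 and
      \<open>2 * pi\<close>, where \<open>s1\<close> is positive and \<open>Am\<close>
      decreases.\<close>
    have b: "0 < S' - X'" "S' - X' < 2 * pi" "0 < S' + X'" "S' + X' < 2 * pi"
      "0 < S - X" "S - X < 2 * pi" "0 < S + X" "S + X < 2 * pi"
      "S' - X' \<le> S - X" "S + X \<le> S' + X'" "S' + X' \<le> S' - X'"
      using k k' le by (simp_all add: S_def S'_def abs_if split: if_splits)
    have m1: "Am (S - X) \<le> Am (S' - X')" "Am (S' + X') \<le> Am (S + X)" "Am (S' - X') \<le> Am (S' + X')"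
      using b by (auto intro!: Am_decreasing)
    have "\<Phi>m 0 < Am (S' - X') * Am (S' + X')"
    proof -
      \<comment> \<open>If the factors do not have opposite signs, their product is nonnegative and
        \<open>\<Phi>m 0\<close> is negative. Otherwise both factors have moved towards 0, so the
        negative product has not dropped.\<close>
      consider "Am (S' - X') \<ge> 0" | "Am (S' + X') \<le> 0" | "Am (S' - X') < 0" "Am (S' + X') > 0" by linarith
      then show ?thesis
      proof cases
        case 1
        then have "Am (S' - X') * Am (S' + X') \<ge> 0" using m1 by simp
        then show ?thesis using \<Phi>m_0 by linarith
      next
        case 2
        then have "Am (S' - X') * Am (S' + X') \<ge> 0" using m1 by (simp add: mult_nonpos_nonpos)
        then show ?thesis using \<Phi>m_0 by linarith
      next
        case 3
        then have "(- Am (S' - X')) * Am (S' + X') \<le> (- Am (S - X)) * Am (S + X)"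
          using m1 by (intro mult_mono) auto
        then show ?thesis using A by simp
      qed
    qed
    moreover have "s1 (S' - X') * s1 (S' + X') > 0"
      unfolding s1_def using b by (intro mult_pos_pos sin_gt_zero) auto
    ultimately have "(S', X') \<in> Um" using X' by (simp add: Um_def)
    then have "(T', X') \<in> Um" unfolding Um_iff cosS .
    then show ?thesis by (simp add: D_eq)
  qed
qed

lemma axis_diagram: "(T, 0) \<in> D"
proof (cases "cos T + cos 0 > 0")
  case True
  then have "(T, 0) \<in> Up" by (simp add: Up_iff)
  then show ?thesis by (simp add: D_eq)
next
  case False
  then have "cos T = -1" using cos_ge_minus_one[of T] unfolding cos_zero by linarith
  then have "(T, 0) \<in> Um" using \<Phi>m_0 by (simp add: Um_iff)
  then show ?thesis by (simp add: D_eq)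
qed

lemma off_horizon_iff:
  assumes "x \<in> D"
  shows "x \<in> off_horizon M e \<longleftrightarrow> \<xi> (fst x - snd x) \<noteq> 0 \<and> \<xi> (fst x + snd x) \<noteq> 0"
proof -
  have "sgn (rp - \<rho> x) = sgn (s1 (fst x - snd x) * s1 (fst x + snd x))"
    "sgn (\<rho> x - rm) = sgn (s2 (fst x - snd x) * s2 (fst x + snd x))"
    using is_radius_area_radius[OF assms] by (simp_all add: is_radius_iff)
  then have "\<rho> x = rp \<longleftrightarrow> s1 (fst x - snd x) * s1 (fst x + snd x) = 0"
    "\<rho> x = rm \<longleftrightarrow> s2 (fst x - snd x) * s2 (fst x + snd x) = 0"
    by (metis sgn_zero_iff eq_iff_diff_eq_0)+
  then show ?thesis using assms unfolding off_horizon_def \<xi>_zero_iff by auto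
qed

lemma null_scale_deriv:
  assumes "\<xi> p \<noteq> 0"
  shows "deriv (null_scale M e) p = 1 / \<xi> p"
proof -
  have s: "s1 p \<noteq> 0" "s2 p \<noteq> 0" using assms by (auto simp: \<xi>_zero_iff)
  have "((\<lambda>p. ln \<bar>s1 p\<bar> / kp - ln \<bar>s2 p\<bar> / km) has_real_derivative
      (- (-1) * s2 p / (2 * s1 p)) / kp - (- 1 * s1 p / (2 * s2 p)) / km) (at p)"
    using s by (intro DERIV_diff DERIV_cdivide P.ln_sb_deriv Q.ln_sb_deriv)
  moreover have "(- (-1) * s2 p / (2 * s1 p)) / kp - (- 1 * s1 p / (2 * s2 p)) / km = 1 / \<xi> p"
    unfolding P.\<xi>_def using s kpos P.Dn_pos[of p]
    by (simp add: divide_simps) (simp add: P.Dn_def algebra_simps power2_eq_square)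
  moreover have "null_scale M e = (\<lambda>p. ln \<bar>s1 p\<bar> / kp - ln \<bar>s2 p\<bar> / km)"
    by (simp add: null_scale_def s1_def s2_def fun_eq_iff)
  ultimately show ?thesis by (simp add: DERIV_imp_deriv)
qed

lemma rn_h_h: "r > 0 \<Longrightarrow> rn_h M e r = h r"
  using rn_h_eq[of r] by (simp add: P.h_def)

lemma static_conformal_sq_eq:
  assumes "x \<in> D" "x \<in> off_horizon M e"
  shows "static_conformal_sq M e x = N x"
proof -
  have \<xi>0: "\<xi> (fst x - snd x) \<noteq> 0" "\<xi> (fst x + snd x) \<noteq> 0"
    using assms off_horizon_iff by auto
  have "static_conformal_sq M e x = - h (\<rho> x) * (1 / \<xi> (fst x - snd x)) * (1 / \<xi> (fst x + snd x))"
    unfolding static_conformal_sq_def split_beta null_scale_deriv[OF \<xi>0(1)] null_scale_deriv[OF \<xi>0(2)]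
    using rn_h_h[OF \<rho>_pos[OF assms(1)]] by simp
  also have "\<dots> = N x * \<xi> (fst x - snd x) * \<xi> (fst x + snd x) * (1 / \<xi> (fst x - snd x)) * (1 / \<xi> (fst x + snd x))"
    unfolding N_\<xi>_\<xi>[OF assms(1)] by simp
  also have "\<dots> = N x" using \<xi>0 by simp
  finally show ?thesis .
qed

lemma N_isCont: "x \<in> D \<Longrightarrow> isCont N x"
proof -
  assume "x \<in> D"
  then have "isCont (\<lambda>x. exp (ln (N x))) x" by (intro continuous_intros null_partials_isCont[OF lnN_null_partials])
  then show ?thesis using N_pos by simp
qed

text \<open>On a horizon the definition takes a limit within the off-horizon set, so that set must
  accumulate at the point. A translation in \<open>T\<close> shifts \<open>p\<close> and
  \<open>q\<close> alike, and only finitely many translations by \<open>t\<close> in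
  \<open>{0..1}\<close> meet a zero of \<open>\<xi>\<close>.\<close>

lemma conformal_factor_eq:
  assumes x: "x \<in> D"
  shows "conformal_factor M e x = sqrt (N x)"
proof (cases "x \<in> off_horizon M e")
  case True
  then show ?thesis using static_conformal_sq_eq[OF x] by (simp add: conformal_factor_def)
next
  case False
  let ?O = "off_horizon M e"
  have sub: "?O \<subseteq> D" by (auto simp: off_horizon_def)
  have "x islimpt ?O"
    unfolding islimpt_approachable
  proof (intro allI impI)
    fix \<epsilon> :: real assume \<epsilon>: "\<epsilon> > 0"
    obtain \<delta> where \<delta>: "\<delta> > 0" "ball x \<delta> \<subseteq> D" using open_D x open_contains_ball by metis
    have fin: "finite {t \<in> {0..1}. \<xi> (c + t) = 0}" for c
    proof -
      have "t \<in> (\<lambda>k. pi * of_int k - c) ` {\<lfloor>c / pi\<rfloor>..\<lceil>(c + 1) / pi\<rceil>}" if t: "t \<in> {0..1}" "\<xi> (c + t) = 0" for t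
      proof -
        have "s1 (c + t) * s2 (c + t) = 0" using t(2) by (simp add: \<xi>_zero_iff)
        moreover have "sin (c + t) = 2 * s1 (c + t) * s2 (c + t)"
        proof -
          have "2 * ((c + t) / 2) = c + t" by simp
          from sin_double[of "(c + t) / 2", unfolded this] show ?thesis unfolding s1_def s2_def .
        qed
        ultimately have "sin (c + t) = 0" by simp
        then obtain k :: int where "c + t = of_int k * pi" using sin_zero_iff_int2 by blast
        then have k: "c + t = pi * of_int k" by simp
        then have "of_int k = (c + t) / pi" by simp
        then have "c / pi \<le> of_int k" "of_int k \<le> (c + 1) / pi" using t(1) by (simp_all add: divide_right_mono)
        then have "\<lfloor>c / pi\<rfloor> \<le> k" "k \<le> \<lceil>(c + 1) / pi\<rceil>" by linarith+
        then show ?thesis using k by (intro image_eqI[of _ _ k]) auto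
      qed
      then show ?thesis by (intro finite_subset[OF _ finite_imageI[OF finite_atLeastAtMost_int]]) blast
    qed
    define c where "c = min 1 (min \<epsilon> \<delta>)"
    have "c > 0" using \<epsilon> \<delta>(1) by (simp add: c_def)
    define Z where "Z = {t \<in> {0..1}. \<xi> ((fst x - snd x) + t) = 0} \<union> {t \<in> {0..1}. \<xi> ((fst x + snd x) + t) = 0}"
    have "finite Z" unfolding Z_def using fin by (intro finite_UnI)
    moreover have "infinite {0<..<c}" using \<open>c > 0\<close> by (simp add: infinite_Ioo)
    ultimately have "\<not> {0<..<c} \<subseteq> Z" using finite_subset by blast
    then obtain t where t: "t \<in> {0<..<c}" "t \<notin> Z" by blast
    define y where "y = (fst x + t, snd x)"
    have d: "dist y x = t" using t(1) by (simp add: y_def dist_prod_def dist_real_def)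
    have "y \<in> D" using \<delta>(2) d t(1) by (auto simp: c_def dist_commute)
    moreover have "\<xi> (fst y - snd y) \<noteq> 0 \<and> \<xi> (fst y + snd y) \<noteq> 0"
    proof -
      have e: "fst y - snd y = (fst x - snd x) + t" "fst y + snd y = (fst x + snd x) + t" by (simp_all add: y_def)
      show ?thesis using t unfolding Z_def e c_def by auto
    qed
    ultimately have "y \<in> ?O" using off_horizon_iff by blast
    then show "\<exists>x'\<in>?O. x' \<noteq> x \<and> dist x' x < \<epsilon>"
      using d t(1) by (intro bexI[of _ y]) (auto simp: c_def)
  qed
  then have nb: "at x within ?O \<noteq> bot" by (simp add: trivial_limit_within)
  have "(N \<longlongrightarrow> N x) (at x within ?O)"
    using N_isCont[OF x] unfolding isCont_def by (rule tendsto_within_subset) simp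
  then have "(static_conformal_sq M e \<longlongrightarrow> N x) (at x within ?O)"
    by (rule Lim_transform_within[OF _ zero_less_one])
      (use static_conformal_sq_eq sub in auto)
  then have "Lim (at x within ?O) (static_conformal_sq M e) = N x" by (rule tendsto_Lim[OF nb])
  then show ?thesis using False by (simp add: conformal_factor_def)
qed

end

section \<open>The equation of constant mean curvature\<close>

text \<open>Here \<open>c\<close>, \<open>s\<close>, \<open>t\<close> are \<open>cosh\<close>,
  \<open>sinh\<close>, \<open>tanh\<close> of the boost; \<open>a\<close>, \<open>b\<close> and the
  \<open>w\<close> terms are first and second derivatives of \<open>ln \<Omega>\<close>, the
  \<open>L\<close> terms those of \<open>ln (\<Omega> * r^2)\<close>. The equations for
  \<open>F\<close> and its partials come multiplied by powers of \<open>c\<close>, which eliminates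
  \<open>F\<close> almost without division.\<close>

lemma riccati_reduction:
  fixes a b c s t c0 LT LX LTT LTX LXX wTT wTX wXX F FT FX Fm :: real
  assumes ct: "c * t = s" and cc: "c * c = s * s + 1" and cF: "c * F = c0 - c * LT - s * LX"
    and Fm: "c * c * Fm = - (c0 * s + LX)"
    and FT: "c * FT = c0 * a - c * LTT - s * LTX" and FX: "c * FX = c0 * b - c * LTX - s * LXX"
  shows "(c * c + s * s) * F * (a + F) + s * c * ((wTT * t + wTX) + (FT * t + FX + Fm * F)) + 2 * s * c * F * b
      + c * c * (wTX * t + wXX) + FT - (s * c * (a + F) + c * c * b) * Fm - (s * (a + F) + c * b)\<^sup>2
    = (c0 - c * LT - s * LX)\<^sup>2 - (s * a + c * b)\<^sup>2 + 2 * c0 * (c * a + s * b) - a * LT + b * LX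
      + (s * s * wTT + 2 * s * c * wTX + c * c * wXX) - (c * c * LTT + 2 * s * c * LTX + s * s * LXX)"
proof -
  define Y where "Y = c0 - c * LT - s * LX"
  have c: "c \<noteq> 0" using cc by (metis add_nonneg_pos mult_zero_left not_less_iff_gr_or_eq zero_le_square zero_less_one)
  have t: "t = s / c" using ct c by (simp add: field_simps)
  have 1: "s * c * ((wTT * t + wTX) + (FT * t + FX + Fm * F)) = s * s * wTT + s * c * wTX + s * s * FT + s * (c * FX) + s * c * Fm * F"
  proof -
    have "s * c * ((wTT * t + wTX) + (FT * t + FX + Fm * F))
        = (c * t) * (s * wTT) + s * c * wTX + (c * t) * (s * FT) + s * (c * FX) + s * c * Fm * F"
      by (simp add: algebra_simps)
    then show ?thesis unfolding ct by (simp only: mult.assoc)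
  qed
  have 2: "c * c * (wTX * t + wXX) = s * c * wTX + c * c * wXX"
  proof -
    have "c * c * (wTX * t + wXX) = (c * t) * c * wTX + c * c * wXX" by (simp add: algebra_simps)
    then show ?thesis unfolding ct .
  qed
  have 3: "s * c * Fm * F - (s * c * (a + F) + c * c * b) * Fm = (c0 * s + LX) * (a * t + b)"
  proof -
    have "s * c * Fm * F - (s * c * (a + F) + c * c * b) * Fm = - (c * c * Fm) * (a * t + b)"
    proof -
      have "s * c * Fm * F - (s * c * (a + F) + c * c * b) * Fm = - (s * (c * a * Fm) + c * c * Fm * b)"
        by (simp add: algebra_simps)
      also have "\<dots> = - ((c * t) * (c * a * Fm) + c * c * Fm * b)" unfolding ct ..
      also have "\<dots> = - (c * c * Fm) * (a * t + b)" by (simp add: algebra_simps)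
      finally show ?thesis .
    qed
    also have "\<dots> = (c0 * s + LX) * (a * t + b)" unfolding Fm by simp
    finally show ?thesis .
  qed
  have 4: "s * s * FT + FT = c * (c * FT)"
  proof -
    have "s * s * FT + FT = (s * s + 1) * FT" by (simp add: distrib_right)
    then show ?thesis unfolding cc[symmetric] by (simp add: mult.assoc)
  qed
  have 5: "(c * c + s * s) * F * (a + F) + 2 * s * c * F * b - (s * (a + F) + c * b)\<^sup>2
     = Y\<^sup>2 + a * F - (s * a + c * b)\<^sup>2"
  proof -
    have "(c * c + s * s) * F * (a + F) + 2 * s * c * F * b - (s * (a + F) + c * b)\<^sup>2
      = (c * F)\<^sup>2 + (c * c - s * s) * (a * F) - (s * a + c * b)\<^sup>2"
      by (simp add: algebra_simps power2_eq_square)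
    then show ?thesis unfolding cF cc Y_def by simp
  qed
  have 6: "a * F + (c0 * s + LX) * (a * t) = a * (c * c0 - LT)"
  proof -
    have "c * (a * F + (c0 * s + LX) * (a * t)) = a * (c * F + (c0 * s + LX) * (c * t))" by (simp add: algebra_simps)
    also have "\<dots> = a * (c0 * (s * s + 1) - c * LT)" unfolding cF ct by (simp add: algebra_simps)
    also have "\<dots> = c * (a * (c * c0 - LT))" unfolding cc[symmetric] by (simp add: algebra_simps)
    finally show ?thesis using c by simp
  qed
  have "(c * c + s * s) * F * (a + F) + s * c * ((wTT * t + wTX) + (FT * t + FX + Fm * F)) + 2 * s * c * F * b
      + c * c * (wTX * t + wXX) + FT - (s * c * (a + F) + c * c * b) * Fm - (s * (a + F) + c * b)\<^sup>2
    = ((c * c + s * s) * F * (a + F) + 2 * s * c * F * b - (s * (a + F) + c * b)\<^sup>2)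
      + (s * c * Fm * F - (s * c * (a + F) + c * c * b) * Fm) + (s * s * FT + FT) + s * (c * FX)
      + s * s * wTT + 2 * s * c * wTX + c * c * wXX"
    unfolding 1 2 by (simp add: algebra_simps)
  also have "\<dots> = Y\<^sup>2 - (s * a + c * b)\<^sup>2 + (a * F + (c0 * s + LX) * (a * t)) + (c0 * s + LX) * b
      + c * (c * FT) + s * (c * FX) + s * s * wTT + 2 * s * c * wTX + c * c * wXX"
    unfolding 3 4 5 by (simp add: algebra_simps)
  also have "\<dots> = Y\<^sup>2 - (s * a + c * b)\<^sup>2 + 2 * c0 * (c * a + s * b) - a * LT + b * LX
      + (s * s * wTT + 2 * s * c * wTX + c * c * wXX) - (c * c * LTT + 2 * s * c * LTX + s * s * LXX)"
    unfolding 6 FT FX by (simp add: algebra_simps)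
  finally show ?thesis unfolding Y_def .
qed

text \<open>The unmixed second derivatives \<open>n'\<close> and \<open>m'\<close> cancel between
  the two quadratic forms; of the second derivatives only the mixed ones, \<open>J\<close> and
  \<open>lpq\<close>, survive.\<close>

lemma riccati_square_sum:
  fixes n m n' m' J lp lq lpq c s c0 :: real
  assumes cc: "c * c = s * s + 1"
  defines "a \<equiv> (n + m) / 2" and "b \<equiv> (m - n) / 2"
    and "lpp \<equiv> n * lp - lp\<^sup>2 / 2" and "lqq \<equiv> m * lq - lq\<^sup>2 / 2"
    and "W \<equiv> c * (lp + lq) + s * (lq - lp)"
  shows "(c0 - c * (a + (lp + lq)) - s * (b + (lq - lp)))\<^sup>2 - (s * a + c * b)\<^sup>2 + 2 * c0 * (c * a + s * b)
      - a * (a + (lp + lq)) + b * (b + (lq - lp))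
      + (s * s * ((n' + 2 * J + m') / 2) + 2 * s * c * ((m' - n') / 2) + c * c * ((m' - 2 * J + n') / 2))
      - (c * c * ((n' + 2 * J + m') / 2 + (lpp + 2 * lpq + lqq)) + 2 * s * c * ((m' - n') / 2 + (lqq - lpp))
         + s * s * ((m' - 2 * J + n') / 2 + (lqq - 2 * lpq + lpp)))
    = (c0 - W)\<^sup>2 + W\<^sup>2 / 2 - lp * lq - 2 * lpq - 2 * J"
proof -
  \<comment> \<open>Inserting \<open>c * c - s * s\<close> for 1 in front of selected terms turns
    the claim into a polynomial identity free of side conditions.\<close>
  define e where "e = c * c - s * s"
  have e1: "e = 1" using cc by (simp add: e_def)
  have "(c0 - c * (a + (lp + lq)) - s * (b + (lq - lp)))\<^sup>2 - (s * a + c * b)\<^sup>2 + 2 * c0 * (c * a + s * b)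
      - e * (a * (a + (lp + lq))) + e * (b * (b + (lq - lp)))
      + (s * s * ((n' + 2 * J + m') / 2) + 2 * s * c * ((m' - n') / 2) + c * c * ((m' - 2 * J + n') / 2))
      - (c * c * ((n' + 2 * J + m') / 2 + (lpp + 2 * lpq + lqq)) + 2 * s * c * ((m' - n') / 2 + (lqq - lpp))
         + s * s * ((m' - 2 * J + n') / 2 + (lqq - 2 * lpq + lpp)))
    = (c0 - W)\<^sup>2 + W\<^sup>2 / 2 - e * (lp * lq) - e * (2 * lpq) - e * (2 * J)"
    unfolding a_def b_def lpp_def lqq_def W_def e_def
    by (simp add: power2_eq_square field_simps)
  then show ?thesis unfolding e1 by simp
qed

lemma c1_on_null_partials:
  assumes "\<And>x. x \<in> S \<Longrightarrow> null_partials f (fp x) (fq x) x" "continuous_on S fp" "continuous_on S fq"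
  shows "c1_on S f (\<lambda>x. fp x + fq x) (\<lambda>x. fq x - fp x)"
proof -
  have "(\<lambda>d. fp x * (fst d - snd d) + fq x * (fst d + snd d)) = (\<lambda>d. (fp x + fq x) * fst d + (fq x - fp x) * snd d)" for x
    by (simp add: fun_eq_iff algebra_simps)
  then show ?thesis using assms unfolding c1_on_def null_partials_def by (auto intro!: continuous_intros)
qed

locale reissner_nordstrom_cmc = reissner_nordstrom +
  fixes H :: real
begin

text \<open>\<open>rP\<close> and \<open>rQ\<close> are the null partials of the radius,
  \<open>lp\<close> and \<open>lq\<close> those of \<open>ln (r^2)\<close>; the letter
  \<open>w\<close> below stands for \<open>ln \<Omega>\<close>, half the logarithm of
  \<open>N\<close>.\<close>

definition "rP x = - 1 / 2 * (\<xi> (fst x + snd x) * N x)"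
definition "rQ x = - 1 / 2 * (\<xi> (fst x - snd x) * N x)"
definition "J x = - h2 (\<rho> x) * N x / 4"
definition "lp x = 2 * (rP x / \<rho> x)"
definition "lq x = 2 * (rQ x / \<rho> x)"
text \<open>As \<open>\<xi> q\<close> is constant in \<open>p\<close>, the radius satisfies
  \<open>r_pp = n * r_p\<close>. This is the Raychaudhuri equation without null energy flux, and it
  removes second derivatives of \<open>r\<close> from \<open>lpp\<close> and
  \<open>lqq\<close>.\<close>

definition "lpp x = n x * lp x - (lp x)\<^sup>2 / 2"
definition "lqq x = m x * lq x - (lq x)\<^sup>2 / 2"
definition "lpq x = - h1 (\<rho> x) * N x / (2 * \<rho> x) - lp x * lq x / 2"

definition "w_T x = (n x + m x) / 2"
definition "w_X x = (m x - n x) / 2"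
definition "w_TT x = (n' x + 2 * J x + m' x) / 2"
definition "w_TX x = (m' x - n' x) / 2"
definition "w_XX x = (m' x - 2 * J x + n' x) / 2"

text \<open>With \<open>E = \<Omega> * r^2\<close>, mean curvature \<open>H\<close> means \<open>(E
  * cosh \<mu>)_T + (E * sinh \<mu>)_X = 3 * H * \<Omega> * E\<close>. Division by
  \<open>E * cosh \<mu>\<close> gives \<open>\<mu>' = F\<close> with the coefficients
  \<open>c0\<close>, \<open>c1\<close>, \<open>c2\<close>.\<close>

definition "c0 x = 3 * H * sqrt (N x)"
definition "c1 x = - (w_T x + (lp x + lq x))"
definition "c2 x = - (w_X x + (lq x - lp x))"
definition "c1T x = - (w_TT x + (lpp x + 2 * lpq x + lqq x))"
definition "c1X x = - (w_TX x + (lqq x - lpp x))"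
definition "c2X x = - (w_XX x + (lqq x - 2 * lpq x + lpp x))"

lemma \<rho>_null_partials': "x \<in> D \<Longrightarrow> null_partials \<rho> (rP x) (rQ x) x"
  using \<rho>_null_partials[of x] by (simp add: rP_def rQ_def)

lemma N_null_partials: "x \<in> D \<Longrightarrow> null_partials N (N x * n x) (N x * m x) x"
proof -
  assume x: "x \<in> D"
  from null_partials_comp[OF lnN_null_partials[OF x] DERIV_exp] show ?thesis by (simp add: N_pos)
qed

lemma \<xi>_nm:
  assumes "x \<in> D"
  shows "\<xi>' (fst x + snd x) + \<xi> (fst x + snd x) * m x = h1 (\<rho> x) / 2"
    and "\<xi>' (fst x - snd x) + \<xi> (fst x - snd x) * n x = h1 (\<rho> x) / 2"
  using assms P.\<xi>_n[of x] Q.\<xi>_n[of x] on_Up[of x] on_Um[of x] unfolding D_eq chart_functions_eq by auto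

text \<open>One null derivative hits only \<open>N\<close>; in the other, \<open>\<xi>_nm\<close>
  combines the derivatives of \<open>\<xi>\<close> and \<open>N\<close> into a multiple of
  \<open>h1 * N\<close>.\<close>

lemma rP_null_partials:
  assumes x: "x \<in> D"
  shows "null_partials rP (n x * rP x) (- h1 (\<rho> x) * N x / 4) x" "null_partials rQ (- h1 (\<rho> x) * N x / 4) (m x * rQ x) x"
proof -
  let ?p = "fst x - snd x" and ?q = "fst x + snd x"
  have 1: "null_partials rP (- 1 / 2 * (0 * N x + \<xi> ?q * (N x * n x))) (- 1 / 2 * (\<xi>' ?q * N x + \<xi> ?q * (N x * m x))) x"
    unfolding rP_def by (intro null_partials_cmult null_partials_mult null_partials_q P.\<xi>_deriv N_null_partials[OF x])
  have "- 1 / 2 * (\<xi>' ?q * N x + \<xi> ?q * (N x * m x)) = - 1 / 2 * ((\<xi>' ?q + \<xi> ?q * m x) * N x)" by (simp add: algebra_simps)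
  also have "\<dots> = - h1 (\<rho> x) * N x / 4" unfolding \<xi>_nm[OF x] by simp
  finally have 2: "- 1 / 2 * (\<xi>' ?q * N x + \<xi> ?q * (N x * m x)) = - h1 (\<rho> x) * N x / 4" .
  have 3: "- 1 / 2 * (0 * N x + \<xi> ?q * (N x * n x)) = n x * rP x" by (simp add: rP_def)
  show "null_partials rP (n x * rP x) (- h1 (\<rho> x) * N x / 4) x" using 1 unfolding 2 3 .
  have 1: "null_partials rQ (- 1 / 2 * (\<xi>' ?p * N x + \<xi> ?p * (N x * n x))) (- 1 / 2 * (0 * N x + \<xi> ?p * (N x * m x))) x"
    unfolding rQ_def by (intro null_partials_cmult null_partials_mult null_partials_p P.\<xi>_deriv N_null_partials[OF x])
  have "- 1 / 2 * (\<xi>' ?p * N x + \<xi> ?p * (N x * n x)) = - 1 / 2 * ((\<xi>' ?p + \<xi> ?p * n x) * N x)" by (simp add: algebra_simps)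
  also have "\<dots> = - h1 (\<rho> x) * N x / 4" unfolding \<xi>_nm[OF x] by simp
  finally have 2: "- 1 / 2 * (\<xi>' ?p * N x + \<xi> ?p * (N x * n x)) = - h1 (\<rho> x) * N x / 4" .
  have 3: "- 1 / 2 * (0 * N x + \<xi> ?p * (N x * m x)) = m x * rQ x" by (simp add: rQ_def)
  show "null_partials rQ (- h1 (\<rho> x) * N x / 4) (m x * rQ x) x" using 1 unfolding 2 3 .
qed

lemma lp_null_partials:
  assumes x: "x \<in> D"
  shows "null_partials lp (lpp x) (lpq x) x" "null_partials lq (lpq x) (lqq x) x"
proof -
  have r: "\<rho> x \<noteq> 0" using \<rho>_pos[OF x] by simp
  have inv: "null_partials (\<lambda>x. inverse (\<rho> x)) (- (1 / (\<rho> x)\<^sup>2) * rP x) (- (1 / (\<rho> x)\<^sup>2) * rQ x) x"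
    by (rule null_partials_comp[OF \<rho>_null_partials'[OF x]]) (use r in \<open>auto intro!: derivative_eq_intros simp: power2_eq_square divide_inverse\<close>)
  have "null_partials lp (2 * (n x * rP x * inverse (\<rho> x) + rP x * (- (1 / (\<rho> x)\<^sup>2) * rP x)))
     (2 * ((- h1 (\<rho> x) * N x / 4) * inverse (\<rho> x) + rP x * (- (1 / (\<rho> x)\<^sup>2) * rQ x))) x"
    unfolding lp_def divide_inverse[of "rP _"] by (intro null_partials_cmult null_partials_mult rP_null_partials[OF x] inv)
  moreover have "2 * (n x * rP x * inverse (\<rho> x) + rP x * (- (1 / (\<rho> x)\<^sup>2) * rP x)) = lpp x"
    using r unfolding lpp_def lp_def by (simp add: field_simps power2_eq_square)
  moreover have "2 * ((- h1 (\<rho> x) * N x / 4) * inverse (\<rho> x) + rP x * (- (1 / (\<rho> x)\<^sup>2) * rQ x)) = lpq x"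
    using r unfolding lpq_def lp_def lq_def by (simp add: field_simps power2_eq_square)
  ultimately show "null_partials lp (lpp x) (lpq x) x" by (simp only:)
  have "null_partials lq (2 * ((- h1 (\<rho> x) * N x / 4) * inverse (\<rho> x) + rQ x * (- (1 / (\<rho> x)\<^sup>2) * rP x)))
     (2 * (m x * rQ x * inverse (\<rho> x) + rQ x * (- (1 / (\<rho> x)\<^sup>2) * rQ x))) x"
    unfolding lq_def divide_inverse[of "rQ _"] by (intro null_partials_cmult null_partials_mult rP_null_partials[OF x] inv)
  moreover have "2 * (m x * rQ x * inverse (\<rho> x) + rQ x * (- (1 / (\<rho> x)\<^sup>2) * rQ x)) = lqq x"
    using r unfolding lqq_def lq_def by (simp add: field_simps power2_eq_square)
  moreover have "2 * ((- h1 (\<rho> x) * N x / 4) * inverse (\<rho> x) + rQ x * (- (1 / (\<rho> x)\<^sup>2) * rP x)) = lpq x"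
    using r unfolding lpq_def lp_def lq_def by (simp add: field_simps power2_eq_square)
  ultimately show "null_partials lq (lpq x) (lqq x) x" by (simp only:)
qed

lemma continuity:
  "continuous_on D \<rho>" "continuous_on D N" "continuous_on D n" "continuous_on D m" "continuous_on D J"
  "continuous_on D lp" "continuous_on D lq" "continuous_on D lpp" "continuous_on D lqq" "continuous_on D lpq"
proof -
  show r: "continuous_on D \<rho>" and N: "continuous_on D N" and n: "continuous_on D n" and m: "continuous_on D m"
    and lp: "continuous_on D lp" and lq: "continuous_on D lq"
    using null_partials_isCont[OF \<rho>_null_partials'] null_partials_isCont[OF N_null_partials] null_partials_isCont[OF n_null_partials] null_partials_isCont[OF m_null_partials]
      null_partials_isCont[OF lp_null_partials(1)] null_partials_isCont[OF lp_null_partials(2)]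
    by (auto intro!: continuous_at_imp_continuous_on)
  have r0: "\<rho> x \<noteq> 0" if "x \<in> D" for x using \<rho>_pos[OF that] by simp
  show "continuous_on D J" unfolding J_def P.h2_def
    by (intro continuous_intros r N) (simp_all add: r0)
  show "continuous_on D lpp" "continuous_on D lqq" unfolding lpp_def lqq_def by (intro continuous_intros n m lp lq; simp)+
  show "continuous_on D lpq" unfolding lpq_def P.h1_def
    by (intro continuous_intros r N lp lq) (simp_all add: r0)
qed

lemma c1_on_eq: "c1_on S f a b \<Longrightarrow> a = a' \<Longrightarrow> b = b' \<Longrightarrow> c1_on S f a' b'" by simp

lemma w_c1:
  "c1_on D w_T w_TT w_TX" "c1_on D w_X w_TX w_XX"
proof -
  have nJ: "x \<in> D \<Longrightarrow> null_partials n (n' x) (J x) x" "x \<in> D \<Longrightarrow> null_partials m (J x) (m' x) x" for x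
    using n_null_partials m_null_partials by (simp_all add: J_def)
  have "null_partials w_T (1 / 2 * (n' x + J x)) (1 / 2 * (J x + m' x)) x" if "x \<in> D" for x
  proof -
    have "w_T = (\<lambda>x. 1 / 2 * (n x + m x))" by (simp add: w_T_def fun_eq_iff)
    then show ?thesis by (simp only:) (intro null_partials_cmult null_partials_add nJ that)
  qed
  then show "c1_on D w_T w_TT w_TX"
    by (rule c1_on_eq[OF c1_on_null_partials])
      (auto intro!: continuous_intros continuous_n' continuity simp: w_TT_def w_TX_def fun_eq_iff field_simps)
  have "null_partials w_X (1 / 2 * (J x - n' x)) (1 / 2 * (m' x - J x)) x" if "x \<in> D" for x
  proof -
    have "w_X = (\<lambda>x. 1 / 2 * (m x - n x))" by (simp add: w_X_def fun_eq_iff)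
    then show ?thesis by (simp only:) (intro null_partials_cmult null_partials_diff nJ that)
  qed
  then show "c1_on D w_X w_TX w_XX"
    by (rule c1_on_eq[OF c1_on_null_partials])
      (auto intro!: continuous_intros continuous_n' continuity simp: w_XX_def w_TX_def fun_eq_iff field_simps)
qed

lemma c1_on_add: "c1_on S f a b \<Longrightarrow> c1_on S g a' b' \<Longrightarrow> c1_on S (\<lambda>x. f x + g x) (\<lambda>x. a x + a' x) (\<lambda>x. b x + b' x)"
  unfolding c1_on_def by (auto intro!: continuous_intros derivative_eq_intros simp: algebra_simps)

lemma c1_on_minus: "c1_on S f a b \<Longrightarrow> c1_on S (\<lambda>x. - f x) (\<lambda>x. - a x) (\<lambda>x. - b x)"
  unfolding c1_on_def by (auto intro!: continuous_intros derivative_eq_intros simp: algebra_simps)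

lemma l_c1: "c1_on D (\<lambda>x. lp x + lq x) (\<lambda>x. lpp x + 2 * lpq x + lqq x) (\<lambda>x. lqq x - lpp x)"
   "c1_on D (\<lambda>x. lq x - lp x) (\<lambda>x. lqq x - lpp x) (\<lambda>x. lqq x - 2 * lpq x + lpp x)"
proof -
  have "null_partials (\<lambda>x. lp x + lq x) (lpp x + lpq x) (lpq x + lqq x) x" if "x \<in> D" for x
    by (intro null_partials_add lp_null_partials that)
  then show "c1_on D (\<lambda>x. lp x + lq x) (\<lambda>x. lpp x + 2 * lpq x + lqq x) (\<lambda>x. lqq x - lpp x)"
    by (rule c1_on_eq[OF c1_on_null_partials]) (auto intro!: continuous_intros continuity simp: fun_eq_iff)
  have "null_partials (\<lambda>x. lq x - lp x) (lpq x - lpp x) (lqq x - lpq x) x" if "x \<in> D" for x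
    by (intro null_partials_diff lp_null_partials that)
  then show "c1_on D (\<lambda>x. lq x - lp x) (\<lambda>x. lqq x - lpp x) (\<lambda>x. lqq x - 2 * lpq x + lpp x)"
    by (rule c1_on_eq[OF c1_on_null_partials]) (auto intro!: continuous_intros continuity simp: fun_eq_iff)
qed

lemma exp_half_ln_N: "exp (1 / 2 * ln (N x)) = sqrt (N x)"
  using N_pos[of x] by (simp add: ln_sqrt[symmetric])

lemma c0_c1: "c1_on D c0 (\<lambda>x. c0 x * w_T x) (\<lambda>x. c0 x * w_X x)"
proof -
  have c0: "c0 = (\<lambda>x. 3 * H * exp (1 / 2 * ln (N x)))"
    unfolding exp_half_ln_N by (simp add: c0_def fun_eq_iff)
  have "null_partials c0 (c0 x * n x / 2) (c0 x * m x / 2) x" if "x \<in> D" for x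
  proof -
    have "null_partials (\<lambda>x. 3 * H * exp (1 / 2 * ln (N x))) (3 * H * (exp (1 / 2 * ln (N x)) * (1 / 2 * n x)))
        (3 * H * (exp (1 / 2 * ln (N x)) * (1 / 2 * m x))) x"
      by (intro null_partials_cmult null_partials_comp[where g = exp] DERIV_exp lnN_null_partials that)
    then show ?thesis unfolding c0 by (simp add: mult.assoc)
  qed
  moreover have "continuous_on D c0" unfolding c0_def by (intro continuous_intros continuity)
  ultimately show ?thesis
    by (intro c1_on_eq[OF c1_on_null_partials[where fp = "\<lambda>x. c0 x * n x / 2" and fq = "\<lambda>x. c0 x * m x / 2"]])
      (auto intro!: continuous_intros continuity simp: w_T_def w_X_def fun_eq_iff field_simps)
qed

sublocale cmc_flow D c0 c1 c2 "\<lambda>x. c0 x * w_T x" "\<lambda>x. c0 x * w_X x" c1T c1X c1X c2X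
proof
  show "open D" by (rule open_D)
  show "c1_on D c0 (\<lambda>x. c0 x * w_T x) (\<lambda>x. c0 x * w_X x)" by (rule c0_c1)
  show "c1_on D c1 c1T c1X" unfolding c1_def c1T_def c1X_def by (intro c1_on_minus c1_on_add w_c1 l_c1)
  show "c1_on D c2 c1X c2X" unfolding c2_def c1X_def c2X_def by (intro c1_on_minus c1_on_add w_c1 l_c1)
qed

definition "F_X x \<mu> = c0 x * w_X x * (1 / cosh \<mu>) + c1X x + c2X x * tanh \<mu>"

text \<open>The logarithmic derivative along the graph, with respect to arc length and up to a positive
  factor, of the normal component of \<open>\<partial>\<^sub>T\<close>.\<close>

definition "\<kappa> x \<mu> = sinh \<mu> * cosh \<mu> * (w_T x + F x \<mu>) + cosh \<mu> * cosh \<mu> * w_X x"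

definition "\<kappa>' x \<mu> = (cosh \<mu> * cosh \<mu> + sinh \<mu> * sinh \<mu>) * F x \<mu> * (w_T x + F x \<mu>)
   + sinh \<mu> * cosh \<mu> * ((w_TT x * tanh \<mu> + w_TX x) + (F_T x \<mu> * tanh \<mu> + F_X x \<mu> + F_\<mu> x \<mu> * F x \<mu>))
   + 2 * sinh \<mu> * cosh \<mu> * F x \<mu> * w_X x + cosh \<mu> * cosh \<mu> * (w_TX x * tanh \<mu> + w_XX x)"

lemma c1_along:
  assumes c: "c1_on D g gT gX" and s: "sol I f \<mu>" and X: "X \<in> I"
  shows "((\<lambda>X. g (f X, X)) has_real_derivative gT (f X, X) * tanh (\<mu> X) + gX (f X, X)) (at X within I)"
proof -
  have x: "(f X, X) \<in> D" and f: "(f has_real_derivative tanh (\<mu> X)) (at X within I)"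
    using s X by (auto simp: sol_def)
  have "(g has_derivative (\<lambda>h. gT (f X, X) * fst h + gX (f X, X) * snd h)) (at (f X, X))"
    using c x by (auto simp: c1_on_def)
  moreover have "((\<lambda>X. (f X, X)) has_derivative (\<lambda>h. (tanh (\<mu> X) * h, h))) (at X within I)"
    using f unfolding has_field_derivative_def by (intro has_derivative_Pair has_derivative_ident)
  ultimately have "((\<lambda>X. g (f X, X)) has_derivative (\<lambda>h. gT (f X, X) * (tanh (\<mu> X) * h) + gX (f X, X) * h)) (at X within I)"
    using has_derivative_compose by fastforce
  then show ?thesis unfolding has_field_derivative_def by (rule has_derivative_eq_rhs) (simp add: fun_eq_iff algebra_simps)
qed

lemma F_along:
  assumes s: "sol I f \<mu>" and X: "X \<in> I"
  shows "((\<lambda>X. F (f X, X) (\<mu> X)) has_real_derivative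
    F_T (f X, X) (\<mu> X) * tanh (\<mu> X) + F_X (f X, X) (\<mu> X) + F_\<mu> (f X, X) (\<mu> X) * F (f X, X) (\<mu> X)) (at X within I)"
proof -
  have m: "(\<mu> has_real_derivative F (f X, X) (\<mu> X)) (at X within I)" using s X by (simp add: sol_def)
  have sech: "((\<lambda>X. 1 / cosh (\<mu> X)) has_real_derivative - sinh (\<mu> X) / (cosh (\<mu> X))\<^sup>2 * F (f X, X) (\<mu> X)) (at X within I)"
    by (rule DERIV_chain2[where f = "\<lambda>x. 1 / cosh x", OF sech_has_derivative m])
  have th: "((\<lambda>X. tanh (\<mu> X)) has_real_derivative 1 / (cosh (\<mu> X))\<^sup>2 * F (f X, X) (\<mu> X)) (at X within I)"
    by (rule DERIV_chain2[where f = tanh, OF tanh_has_derivative m])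
  note d0 = c1_along[OF c0 s X] and d1 = c1_along[OF c1 s X] and d2 = c1_along[OF c2 s X]
  show ?thesis unfolding F_def[of "(f _, _)" "\<mu> _"]
    by (rule DERIV_cong[OF DERIV_add[OF DERIV_add[OF DERIV_mult[OF d0 sech] d1] DERIV_mult[OF d2 th]]])
      (unfold F_T_def F_X_def F_\<mu>_def F_def, simp add: algebra_simps)
qed

lemma \<kappa>_along:
  assumes s: "sol I f \<mu>" and X: "X \<in> I"
  shows "((\<lambda>X. \<kappa> (f X, X) (\<mu> X)) has_real_derivative \<kappa>' (f X, X) (\<mu> X)) (at X within I)"
proof -
  have m: "(\<mu> has_real_derivative F (f X, X) (\<mu> X)) (at X within I)" using s X by (simp add: sol_def)
  have sh: "((\<lambda>X. sinh (\<mu> X)) has_real_derivative cosh (\<mu> X) * F (f X, X) (\<mu> X)) (at X within I)"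
    using m by (auto intro!: derivative_eq_intros)
  have ch: "((\<lambda>X. cosh (\<mu> X)) has_real_derivative sinh (\<mu> X) * F (f X, X) (\<mu> X)) (at X within I)"
    using m by (auto intro!: derivative_eq_intros)
  note wT = c1_along[OF w_c1(1) s X] and wX = c1_along[OF w_c1(2) s X]
  show ?thesis unfolding \<kappa>_def[of "(f _, _)" "\<mu> _"]
    by (rule DERIV_cong[OF DERIV_add[OF DERIV_mult[OF DERIV_mult[OF sh ch] DERIV_add[OF wT F_along[OF s X]]]
        DERIV_mult[OF DERIV_mult[OF ch ch] wX]]])
      (simp add: \<kappa>'_def algebra_simps)
qed

lemma continuous_\<kappa>': "continuous_on (D \<times> UNIV) (\<lambda>(x, \<mu>). \<kappa>' x \<mu>)"
proof -
  have cc: "continuous_on (D \<times> UNIV) (\<lambda>z::(real \<times> real) \<times> real. c (fst z))" if "continuous_on D c" for c :: "real \<times> real \<Rightarrow> real"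
    by (rule continuous_on_compose2[OF that continuous_on_fst[OF continuous_on_id]]) auto
  have h: "continuous_on A (\<lambda>z::(real \<times> real) \<times> real. cosh (snd z))"
      "continuous_on A (\<lambda>z::(real \<times> real) \<times> real. sinh (snd z))"
      "continuous_on A (\<lambda>z::(real \<times> real) \<times> real. tanh (snd z))" for A
    by (intro continuous_on_cosh continuous_on_sinh continuous_on_tanh continuous_on_snd continuous_on_id; simp)+
  have w: "continuous_on D w_T" "continuous_on D w_X" "continuous_on D w_TT" "continuous_on D w_TX" "continuous_on D w_XX"
    using c1_on_continuous[OF w_c1(1)] c1_on_continuous[OF w_c1(2)] w_c1 by (auto simp: c1_on_def)
  have cd: "continuous_on D c0" "continuous_on D c1" "continuous_on D c2" "continuous_on D c1X" "continuous_on D c2X"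
    using c1_on_continuous[OF c0] c1_on_continuous[OF c1] c1_on_continuous[OF c2] c1 c2 by (auto simp: c1_on_def)
  have FT: "continuous_on (D \<times> UNIV) (\<lambda>z. F_T (fst z) (snd z))" "continuous_on (D \<times> UNIV) (\<lambda>z. F_\<mu> (fst z) (snd z))"
    using continuous_F_partials by (simp_all add: split_beta)
  note cs = continuous_on_add continuous_on_mult continuous_on_divide continuous_on_const
  have F: "continuous_on (D \<times> UNIV) (\<lambda>z. F (fst z) (snd z))"
    unfolding F_def by (intro cs cc cd h; simp)
  have FX: "continuous_on (D \<times> UNIV) (\<lambda>z. F_X (fst z) (snd z))"
    unfolding F_X_def by (intro cs cc cd w h; simp)
  show ?thesis unfolding \<kappa>'_def split_beta by (intro cs cc w h F FX FT)
qed

lemma cosh_sq: "cosh \<mu> * cosh \<mu> = sinh \<mu> * sinh \<mu> + (1::real)"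
  using cosh_square_eq[of \<mu>] by (simp add: power2_eq_square)

text \<open>Up to the factor \<open>N\<close> the left-hand side is the potential of the Jacobi operator, the squared norm
  of the second fundamental form plus the Ricci curvature \<open>e\<^sup>2 / r\<^sup>4\<close> of the unit normal.\<close>

lemma riccati_pos:
  assumes x: "x \<in> D"
  shows "\<kappa>' x \<mu> + F_T x \<mu> - \<kappa> x \<mu> * F_\<mu> x \<mu> - (\<kappa> x \<mu>)\<^sup>2 * (1 / (cosh \<mu>)\<^sup>2) > 0"
proof -
  define c where "c = cosh \<mu>"
  define s where "s = sinh \<mu>"
  define t where "t = tanh \<mu>"
  have c: "c \<noteq> 0" by (simp add: c_def)
  have cc: "c * c = s * s + 1" unfolding c_def s_def by (rule cosh_sq)
  have ct: "c * t = s" using c by (simp add: c_def s_def t_def tanh_def)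
  have r: "\<rho> x > 0" by (rule \<rho>_pos[OF x])
  define LT where "LT = w_T x + (lp x + lq x)"
  define LX where "LX = w_X x + (lq x - lp x)"
  define LTT where "LTT = w_TT x + (lpp x + 2 * lpq x + lqq x)"
  define LTX where "LTX = w_TX x + (lqq x - lpp x)"
  define LXX where "LXX = w_XX x + (lqq x - 2 * lpq x + lpp x)"
  have cF: "c * F x \<mu> = c0 x - c * LT - s * LX"
    using c ct unfolding F_def c1_def c2_def LT_def[symmetric] LX_def[symmetric] c_def[symmetric] t_def[symmetric]
    by (simp add: distrib_left right_diff_distrib; simp add: ct[symmetric])
  have Fm: "c * c * F_\<mu> x \<mu> = - (c0 x * s + LX)"
    using c unfolding F_\<mu>_def c2_def LX_def[symmetric] c_def[symmetric] s_def[symmetric]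
    by (simp add: field_simps power2_eq_square)
  have FT: "c * F_T x \<mu> = c0 x * w_T x - c * LTT - s * LTX"
    using c unfolding F_T_def c1T_def c1X_def LTT_def[symmetric] LTX_def[symmetric] c_def[symmetric] t_def[symmetric]
    by (simp add: distrib_left right_diff_distrib; simp add: ct[symmetric])
  have FX: "c * F_X x \<mu> = c0 x * w_X x - c * LTX - s * LXX"
    using c unfolding F_X_def c2X_def c1X_def LXX_def[symmetric] LTX_def[symmetric] c_def[symmetric] t_def[symmetric]
    by (simp add: distrib_left right_diff_distrib; simp add: ct[symmetric])
  \<comment> \<open>\<open>W / \<Omega>\<close> is the sum of the two angular principal curvatures,
    each of which is the normal derivative of \<open>ln r\<close>.\<close>
  define W where "W = c * (lp x + lq x) + s * (lq x - lp x)"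
  have sq: "(\<kappa> x \<mu>)\<^sup>2 * (1 / (cosh \<mu>)\<^sup>2) = (s * (w_T x + F x \<mu>) + c * w_X x)\<^sup>2"
  proof -
    have "\<kappa> x \<mu> = c * (s * (w_T x + F x \<mu>) + c * w_X x)" by (simp add: \<kappa>_def c_def s_def algebra_simps)
    then show ?thesis using c by (simp add: power_mult_distrib c_def)
  qed
  have "\<kappa>' x \<mu> + F_T x \<mu> - \<kappa> x \<mu> * F_\<mu> x \<mu> - (\<kappa> x \<mu>)\<^sup>2 * (1 / (cosh \<mu>)\<^sup>2)
    = (c * c + s * s) * F x \<mu> * (w_T x + F x \<mu>)
      + s * c * ((w_TT x * t + w_TX x) + (F_T x \<mu> * t + F_X x \<mu> + F_\<mu> x \<mu> * F x \<mu>))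
      + 2 * s * c * F x \<mu> * w_X x + c * c * (w_TX x * t + w_XX x) + F_T x \<mu>
      - (s * c * (w_T x + F x \<mu>) + c * c * w_X x) * F_\<mu> x \<mu> - (s * (w_T x + F x \<mu>) + c * w_X x)\<^sup>2"
    unfolding sq by (simp add: \<kappa>'_def \<kappa>_def c_def s_def t_def)
  also have "\<dots> = (c0 x - c * LT - s * LX)\<^sup>2 - (s * w_T x + c * w_X x)\<^sup>2 + 2 * c0 x * (c * w_T x + s * w_X x)
      - w_T x * LT + w_X x * LX
      + (s * s * w_TT x + 2 * s * c * w_TX x + c * c * w_XX x) - (c * c * LTT + 2 * s * c * LTX + s * s * LXX)"
    by (rule riccati_reduction[OF ct cc cF Fm FT FX])
  \<comment> \<open>The two squares are \<open>N * \<bar>A\<bar>^2\<close>: the radial principal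
    curvature is \<open>3 * H - W / \<Omega>\<close>, and each angular one is
    \<open>W / (2 * \<Omega>)\<close>.\<close>
  also have "\<dots> = (c0 x - W)\<^sup>2 + W\<^sup>2 / 2 - lp x * lq x - 2 * lpq x - 2 * J x"
    unfolding LT_def LX_def LTT_def LTX_def LXX_def W_def w_T_def w_X_def w_TT_def w_TX_def w_XX_def lpp_def lqq_def
    by (rule riccati_square_sum[OF cc])
  \<comment> \<open>The remaining terms add up to \<open>N * (h1 / r + h2 / 2)\<close>, in which the
    contributions of the mass cancel; \<open>rp * rm\<close> is \<open>e^2\<close>.\<close>
  also have "\<dots> = (c0 x - W)\<^sup>2 + W\<^sup>2 / 2 + N x * (rp * rm / \<rho> x ^ 4)"
    using r unfolding lpq_def J_def P.h1_def P.h2_def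
    by (simp add: divide_simps) (simp add: algebra_simps eval_nat_numeral)
  also have "\<dots> > 0"
    using N_pos[of x] roots(1,3) r by (intro add_nonneg_pos mult_pos_pos divide_pos_pos zero_less_power) auto
  finally show ?thesis .
qed

lemma reflect_l:
  assumes "(T, X) \<in> D"
  shows "lp (T, - X) = lq (T, X)" "lq (T, - X) = lp (T, X)"
  using reflect_diagram[OF assms] by (simp_all add: lp_def lq_def rP_def rQ_def)

sublocale cmc_foliation D c0 c1 c2 "\<lambda>x. c0 x * w_T x" "\<lambda>x. c0 x * w_X x" c1T c1X c1X c2X \<kappa> \<kappa>'
proof
  fix T X assume x: "(T, X) \<in> D"
  show "(T, - X) \<in> D" by (rule reflect_diagram(1)[OF x])
  show "c0 (T, - X) = c0 (T, X) \<and> c1 (T, - X) = c1 (T, X) \<and> c2 (T, - X) = - c2 (T, X)"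
    using reflect_diagram[OF x] reflect_l[OF x]
    by (simp add: c0_def c1_def c2_def w_T_def w_X_def add.commute minus_divide_left[symmetric] diff_divide_distrib)
  fix X' T' assume "X \<le> X'" "X' \<le> 0" "\<bar>T' - T\<bar> \<le> X' - X"
  then show "(T', X') \<in> D" using triangle_diagram[OF x] by blast
next
  fix T show "(T, 0) \<in> D" by (rule axis_diagram)
  from reflect_diagram(4)[OF this] show "\<kappa> (T, 0) 0 = 0" by (simp add: \<kappa>_def w_X_def)
next
  show "continuous_on (D \<times> UNIV) (\<lambda>(x, m). \<kappa>' x m)" by (rule continuous_\<kappa>')
qed (fact \<kappa>_along riccati_pos)+

text \<open>The density of the flux of the unit normal: the volume factor
  \<open>\<Omega>^2 * r^2 * sin \<theta>\<close> loses one \<open>\<Omega>\<close> to the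
  normalisation.\<close>

definition "E x = sqrt (N x) * (\<rho> x)\<^sup>2"

lemma E_c1: "c1_on D E (\<lambda>x. - c1 x * E x) (\<lambda>x. - c2 x * E x)"
proof -
  have "null_partials E (E x * (n x / 2 + lp x)) (E x * (m x / 2 + lq x)) x" if x: "x \<in> D" for x
  proof -
    have E: "E = (\<lambda>x. exp (1 / 2 * ln (N x)) * (\<rho> x * \<rho> x))"
      unfolding exp_half_ln_N by (simp add: E_def fun_eq_iff power2_eq_square)
    have "null_partials E (exp (1 / 2 * ln (N x)) * (1 / 2 * n x) * (\<rho> x * \<rho> x) + exp (1 / 2 * ln (N x)) * (rP x * \<rho> x + \<rho> x * rP x))
       (exp (1 / 2 * ln (N x)) * (1 / 2 * m x) * (\<rho> x * \<rho> x) + exp (1 / 2 * ln (N x)) * (rQ x * \<rho> x + \<rho> x * rQ x)) x"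
      unfolding E by (intro null_partials_mult null_partials_cmult null_partials_comp[where g = exp] DERIV_exp lnN_null_partials[OF x] \<rho>_null_partials'[OF x])
    moreover have "exp (1 / 2 * ln (N x)) * (1 / 2 * n x) * (\<rho> x * \<rho> x) + exp (1 / 2 * ln (N x)) * (rP x * \<rho> x + \<rho> x * rP x) = E x * (n x / 2 + lp x)"
      using \<rho>_pos[OF x] by (simp add: E lp_def field_simps)
    moreover have "exp (1 / 2 * ln (N x)) * (1 / 2 * m x) * (\<rho> x * \<rho> x) + exp (1 / 2 * ln (N x)) * (rQ x * \<rho> x + \<rho> x * rQ x) = E x * (m x / 2 + lq x)"
      using \<rho>_pos[OF x] by (simp add: E lq_def field_simps)
    ultimately show ?thesis by (simp only:)
  qed
  moreover have "continuous_on D E" unfolding E_def by (intro continuous_intros continuity)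
  ultimately show ?thesis
    by (intro c1_on_eq[OF c1_on_null_partials[where fp = "\<lambda>x. E x * (n x / 2 + lp x)" and fq = "\<lambda>x. E x * (m x / 2 + lq x)"]])
      (auto intro!: continuous_intros continuity simp: c1_def c2_def w_T_def w_X_def fun_eq_iff field_simps)
qed

lemma sqrt_det_metric:
  "sqrt \<bar>det (rn_metric M e y)\<bar> = (conformal_factor M e (y $ 1, y $ 2))\<^sup>2 * (\<rho> (y $ 1, y $ 2))\<^sup>2 * \<bar>sin (y $ 3)\<bar>"
proof -
  have 4: "(2::4) \<noteq> 1" "(3::4) \<noteq> 1" "(4::4) \<noteq> 1" "(3::4) \<noteq> 2" "(4::4) \<noteq> 2" "(4::4) \<noteq> 3" by simp_all
  define \<Omega> where "\<Omega> = conformal_factor M e (y $ 1, y $ 2)"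
  define r where "r = \<rho> (y $ 1, y $ 2)"
  have "det (rn_metric M e y) = (\<Prod>i\<in>UNIV. rn_metric M e y $ i $ i)"
    by (rule det_diagonal) (simp add: rn_metric_def Let_def)
  also have "\<dots> = - (\<Omega>\<^sup>2 * r\<^sup>2 * \<bar>sin (y $ 3)\<bar>)\<^sup>2"
    unfolding UNIV_4 using 4
    by (simp add: rn_metric_def Let_def \<Omega>_def[symmetric] r_def[symmetric] power2_eq_square algebra_simps)
  finally have "\<bar>det (rn_metric M e y)\<bar> = (\<Omega>\<^sup>2 * r\<^sup>2 * \<bar>sin (y $ 3)\<bar>)\<^sup>2" by simp
  then show ?thesis by (simp add: \<Omega>_def r_def)
qed

text \<open>The normal is extended by \<open>T\<close>-translation, so its flux components are
  \<open>E * cosh \<mu>\<close> and \<open>E * sinh \<mu>\<close> times \<open>sin \<theta>\<close>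
  with \<open>\<mu>\<close> depending on \<open>X\<close> only. In their divergence \<open>F\<close>
  appears once, as \<open>cosh \<mu> * F\<close>, and its definition cancels everything but
  \<open>c0\<close>.\<close>

lemma mean_curvature_sol:
  assumes I: "open I" and s: "sol I f \<mu>" and X: "X \<in> I" and \<theta>: "\<theta> \<in> {0<..<pi}"
  shows "mean_curvature M e f (vector [f X, X, \<theta>, \<phi>]) = H"
proof -
  define x :: "real ^ 4" where "x = vector [f X, X, \<theta>, \<phi>]"
  have x: "x $ 1 = f X" "x $ 2 = X" "x $ 3 = \<theta>" "x $ 4 = \<phi>" by (simp_all add: x_def)
  have 4: "(2::4) \<noteq> 1" "(3::4) \<noteq> 1" "(4::4) \<noteq> 1" "(3::4) \<noteq> 2" "(4::4) \<noteq> 2" "(4::4) \<noteq> 3" by simp_all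
  have ax: "(x + t *\<^sub>R axis 1 1) $ 1 = f X + t" "(x + t *\<^sub>R axis 1 1) $ 2 = X" "(x + t *\<^sub>R axis 1 1) $ 3 = \<theta>"
    "(x + t *\<^sub>R axis 2 1) $ 1 = f X" "(x + t *\<^sub>R axis 2 1) $ 2 = X + t" "(x + t *\<^sub>R axis 2 1) $ 3 = \<theta>" for t
    using 4 by (simp_all add: x axis_def)
  note so = s[unfolded sol_open[OF I]]
  have xD: "(f X, X) \<in> D" using so X by blast
  have df: "deriv f Y = tanh (\<mu> Y)" if "Y \<in> I" for Y using so that by (intro DERIV_imp_deriv) blast
  have sth: "sin \<theta> > 0" using \<theta> by (simp add: sin_gt_zero)
  have root: "sqrt (1 - (tanh u)\<^sup>2) = 1 / cosh u" for u :: real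
  proof -
    have "1 - (tanh u)\<^sup>2 = ((cosh u)\<^sup>2 - (sinh u)\<^sup>2) / (cosh u)\<^sup>2"
      by (simp add: tanh_def power_divide diff_divide_distrib)
    also have "\<dots> = (1 / cosh u)\<^sup>2" using cosh_square_eq[of u] by (simp add: power_divide)
    finally show ?thesis by (simp add: real_sqrt_abs)
  qed
  define V where "V y = unit_normal M e f y" for y
  have comp: "sqrt \<bar>det (rn_metric M e y)\<bar> * V y $ 1 = E (y $ 1, y $ 2) * \<bar>sin (y $ 3)\<bar> * cosh (\<mu> (y $ 2))"
     "sqrt \<bar>det (rn_metric M e y)\<bar> * V y $ 2 = E (y $ 1, y $ 2) * \<bar>sin (y $ 3)\<bar> * sinh (\<mu> (y $ 2))"
    if "(y $ 1, y $ 2) \<in> D" "y $ 2 \<in> I" for y :: "real ^ 4"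
  proof -
    define \<omega> where "\<omega> = sqrt (N (y $ 1, y $ 2))"
    have \<Omega>: "conformal_factor M e (y $ 1, y $ 2) = \<omega>" "\<omega> > 0" "E (y $ 1, y $ 2) = \<omega> * (\<rho> (y $ 1, y $ 2))\<^sup>2"
      using conformal_factor_eq[OF that(1)] N_pos by (simp_all add: \<omega>_def E_def)
    show "sqrt \<bar>det (rn_metric M e y)\<bar> * V y $ 1 = E (y $ 1, y $ 2) * \<bar>sin (y $ 3)\<bar> * cosh (\<mu> (y $ 2))"
      "sqrt \<bar>det (rn_metric M e y)\<bar> * V y $ 2 = E (y $ 1, y $ 2) * \<bar>sin (y $ 3)\<bar> * sinh (\<mu> (y $ 2))"
      unfolding sqrt_det_metric V_def unit_normal_def df[OF that(2)] root \<Omega>(1,3)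
      using \<Omega>(2) by (simp_all add: tanh_def power2_eq_square)
  qed
  have E_T: "((\<lambda>t. E (f X + t, X)) has_real_derivative - c1 (f X, X) * E (f X, X)) (at 0)"
    and E_X: "((\<lambda>t. E (f X, X + t)) has_real_derivative - c2 (f X, X) * E (f X, X)) (at 0)"
  proof -
    have E: "(E has_derivative (\<lambda>d. - c1 (f X, X) * E (f X, X) * fst d + - c2 (f X, X) * E (f X, X) * snd d)) (at (f X, X))"
      using E_c1 xD by (simp add: c1_on_def)
    have "((\<lambda>t::real. (f X + t, X)) has_derivative (\<lambda>t. (t, 0))) (at 0)" by (auto intro!: derivative_eq_intros)
    then have "((\<lambda>t. E (f X + t, X)) has_derivative (\<lambda>t. - c1 (f X, X) * E (f X, X) * fst (t, 0) + - c2 (f X, X) * E (f X, X) * snd (t, 0))) (at 0)"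
      using has_derivative_compose[where g = E and f = "\<lambda>t. (f X + t, X)" and x = 0] E
      by fastforce
    then show "((\<lambda>t. E (f X + t, X)) has_real_derivative - c1 (f X, X) * E (f X, X)) (at 0)"
      unfolding has_field_derivative_def by (rule has_derivative_eq_rhs) (simp add: fun_eq_iff)
    have "((\<lambda>t::real. (f X, X + t)) has_derivative (\<lambda>t. (0, t))) (at 0)" by (auto intro!: derivative_eq_intros)
    then have "((\<lambda>t. E (f X, X + t)) has_derivative (\<lambda>t. - c1 (f X, X) * E (f X, X) * fst (0, t) + - c2 (f X, X) * E (f X, X) * snd (0, t))) (at 0)"
      using has_derivative_compose[where g = E and f = "\<lambda>t. (f X, X + t)" and x = 0] E
      by fastforce
    then show "((\<lambda>t. E (f X, X + t)) has_real_derivative - c2 (f X, X) * E (f X, X)) (at 0)"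
      unfolding has_field_derivative_def by (rule has_derivative_eq_rhs) (simp add: fun_eq_iff)
  qed
  obtain \<delta> where \<delta>: "\<delta> > 0" "ball (f X, X) \<delta> \<subseteq> D" using open_D xD open_contains_ball by metis
  obtain \<delta>' where \<delta>': "\<delta>' > 0" "ball X \<delta>' \<subseteq> I" using I X open_contains_ball by metis
  \<comment> \<open>\<open>comp\<close> holds where the point lies in \<open>D\<close> and the slope
    is known to be \<open>tanh \<mu>\<close>; the partial derivatives need it only for such small
    displacements.\<close>
  have near: "(f X + t, X) \<in> D" "(f X, X + t) \<in> D" "X + t \<in> I" if "t \<in> ball 0 (min \<delta> \<delta>')" for t
  proof -
    have "dist (f X, X) (f X + t, X) < \<delta>" "dist (f X, X) (f X, X + t) < \<delta>" "dist X (X + t) < \<delta>'"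
      using that by (simp_all add: dist_Pair_Pair dist_real_def)
    then show "(f X + t, X) \<in> D" "(f X, X + t) \<in> D" "X + t \<in> I" using \<delta>(2) \<delta>'(2) by auto
  qed
  have d1: "partial_deriv 1 (\<lambda>y. sqrt \<bar>det (rn_metric M e y)\<bar> * V y $ 1) x
     = - c1 (f X, X) * E (f X, X) * (sin \<theta> * cosh (\<mu> X))"
    unfolding partial_deriv_def
  proof (rule DERIV_imp_deriv)
    have "((\<lambda>t. E (f X + t, X) * (sin \<theta> * cosh (\<mu> X))) has_real_derivative - c1 (f X, X) * E (f X, X) * (sin \<theta> * cosh (\<mu> X))) (at 0)"
      by (rule DERIV_cmult_right[OF E_T])
    then show "((\<lambda>t. sqrt \<bar>det (rn_metric M e (x + t *\<^sub>R axis 1 1))\<bar> * V (x + t *\<^sub>R axis 1 1) $ 1) has_real_derivative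
        - c1 (f X, X) * E (f X, X) * (sin \<theta> * cosh (\<mu> X))) (at 0)"
    proof (rule has_field_derivative_transform_within_open[where S = "ball 0 (min \<delta> \<delta>')"])
      fix t :: real assume "t \<in> ball 0 (min \<delta> \<delta>')"
      then show "E (f X + t, X) * (sin \<theta> * cosh (\<mu> X)) = sqrt \<bar>det (rn_metric M e (x + t *\<^sub>R axis 1 1))\<bar> * V (x + t *\<^sub>R axis 1 1) $ 1"
        using comp(1)[of "x + t *\<^sub>R axis 1 1"] near(1)[of t] X sth unfolding ax by simp
    qed (use \<delta> \<delta>' in auto)
  qed
  have m: "((\<lambda>t. sinh (\<mu> (X + t))) has_real_derivative cosh (\<mu> X) * F (f X, X) (\<mu> X)) (at 0)"
  proof -
    have "(\<mu> has_real_derivative F (f X, X) (\<mu> X)) (at (X + 0))" using so X by simp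
    moreover have "((\<lambda>t. X + t) has_real_derivative 1) (at 0)" by (auto intro!: derivative_eq_intros)
    ultimately have "((\<lambda>t. \<mu> (X + t)) has_real_derivative F (f X, X) (\<mu> X) * 1) (at 0)" by (rule DERIV_chain2)
    then show ?thesis by (auto intro!: derivative_eq_intros)
  qed
  have d2: "partial_deriv 2 (\<lambda>y. sqrt \<bar>det (rn_metric M e y)\<bar> * V y $ 2) x
     = sin \<theta> * (- c2 (f X, X) * E (f X, X) * sinh (\<mu> X) + cosh (\<mu> X) * F (f X, X) (\<mu> X) * E (f X, X))"
    unfolding partial_deriv_def
  proof (rule DERIV_imp_deriv)
    have "((\<lambda>t. sin \<theta> * (E (f X, X + t) * sinh (\<mu> (X + t)))) has_real_derivative
        sin \<theta> * (- c2 (f X, X) * E (f X, X) * sinh (\<mu> (X + 0)) + cosh (\<mu> X) * F (f X, X) (\<mu> X) * E (f X, X + 0))) (at 0)"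
      by (intro DERIV_cmult DERIV_mult E_X m)
    then have "((\<lambda>t. sin \<theta> * (E (f X, X + t) * sinh (\<mu> (X + t)))) has_real_derivative
        sin \<theta> * (- c2 (f X, X) * E (f X, X) * sinh (\<mu> X) + cosh (\<mu> X) * F (f X, X) (\<mu> X) * E (f X, X))) (at 0)" by simp
    then show "((\<lambda>t. sqrt \<bar>det (rn_metric M e (x + t *\<^sub>R axis 2 1))\<bar> * V (x + t *\<^sub>R axis 2 1) $ 2) has_real_derivative
        sin \<theta> * (- c2 (f X, X) * E (f X, X) * sinh (\<mu> X) + cosh (\<mu> X) * F (f X, X) (\<mu> X) * E (f X, X))) (at 0)"
    proof (rule has_field_derivative_transform_within_open[where S = "ball 0 (min \<delta> \<delta>')"])
      fix t :: real assume "t \<in> ball 0 (min \<delta> \<delta>')"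
      then show "sin \<theta> * (E (f X, X + t) * sinh (\<mu> (X + t))) = sqrt \<bar>det (rn_metric M e (x + t *\<^sub>R axis 2 1))\<bar> * V (x + t *\<^sub>R axis 2 1) $ 2"
        using comp(2)[of "x + t *\<^sub>R axis 2 1"] near(2,3)[of t] X sth unfolding ax by simp
    qed (use \<delta> \<delta>' in auto)
  qed
  have d3: "partial_deriv 3 (\<lambda>y. sqrt \<bar>det (rn_metric M e y)\<bar> * V y $ 3) x = 0"
    "partial_deriv 4 (\<lambda>y. sqrt \<bar>det (rn_metric M e y)\<bar> * V y $ 4) x = 0"
    by (simp_all add: partial_deriv_def V_def unit_normal_def)
  have E0: "E (f X, X) \<noteq> 0" "sqrt (N (f X, X)) \<noteq> 0"
    using \<rho>_pos[OF xD] N_pos[of "(f X, X)"] by (simp_all add: E_def)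
  have det: "sqrt \<bar>det (rn_metric M e x)\<bar> = sqrt (N (f X, X)) * E (f X, X) * sin \<theta>"
    unfolding sqrt_det_metric x conformal_factor_eq[OF xD] E_def using sth by (simp add: power2_eq_square)
  have cF: "cosh (\<mu> X) * F (f X, X) (\<mu> X) = c0 (f X, X) + c1 (f X, X) * cosh (\<mu> X) + c2 (f X, X) * sinh (\<mu> X)"
    unfolding F_def by (simp add: tanh_def field_simps)
  have "divergence (rn_metric M e) V x = (- c1 (f X, X) * E (f X, X) * (sin \<theta> * cosh (\<mu> X))
     + sin \<theta> * (- c2 (f X, X) * E (f X, X) * sinh (\<mu> X) + cosh (\<mu> X) * F (f X, X) (\<mu> X) * E (f X, X)))
     / (sqrt (N (f X, X)) * E (f X, X) * sin \<theta>)"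
    unfolding divergence_def sum_4 d1 d2 d3 det by simp
  also have "\<dots> = c0 (f X, X) * (E (f X, X) * sin \<theta>) / (sqrt (N (f X, X)) * (E (f X, X) * sin \<theta>))"
    unfolding cF by (simp add: algebra_simps)
  also have "\<dots> = 3 * H" using E0 sth by (simp add: c0_def)
  finally show ?thesis unfolding mean_curvature_def x_def[symmetric] V_def by simp
qed

section \<open>The leaves as TSS-CMC hypersurfaces and the foliation\<close>

lemma spacelike_leaf: "spacelike_graph M e (leaf_domain T0) (leaf_height T0)"
proof -
  let ?J = "leaf_domain T0" and ?f = "leaf_height T0" and ?m = "leaf_boost T0"
  note J = open_leaf_domain[of T0]
  note so = leaf_sol[of T0, unfolded sol_open[OF J]]
  have df: "deriv ?f X = tanh (?m X)" if "X \<in> ?J" for X using so that by (intro DERIV_imp_deriv) blast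
  have d1: "(deriv ?f has_real_derivative 1 / (cosh (?m X))\<^sup>2 * F (?f X, X) (?m X)) (at X)" if "X \<in> ?J" for X
  proof -
    have "((\<lambda>X. tanh (?m X)) has_real_derivative 1 / (cosh (?m X))\<^sup>2 * F (?f X, X) (?m X)) (at X)"
      by (rule DERIV_chain2[where f = tanh, OF tanh_has_derivative]) (use so that in blast)
    then show ?thesis
      by (rule has_field_derivative_transform_within_open[OF _ J that]) (simp add: df)
  qed
  have cont: "continuous_on ?J ?m" "continuous_on ?J ?f"
    using leaf_sol[of T0] unfolding sol_def by (auto intro: DERIV_continuous_on)
  have "continuous_on ?J (\<lambda>X. F (?f X, X) (?m X))"
    using F_along[OF leaf_sol] by (rule DERIV_continuous_on)
  then have "continuous_on ?J (\<lambda>X. 1 / (cosh (?m X))\<^sup>2 * F (?f X, X) (?m X))"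
    by (intro continuous_intros cont) auto
  then have "continuous_on ?J (deriv (deriv ?f))"
    by (rule continuous_on_eq) (rule DERIV_imp_deriv[OF d1, symmetric])
  moreover have "?f differentiable_on ?J" "deriv ?f differentiable_on ?J"
    unfolding differentiable_on_def using so d1 real_differentiable_def differentiable_at_withinI by blast+
  moreover have "1 - (deriv ?f X)\<^sup>2 > 0" if "X \<in> ?J" for X
  proof -
    have "\<bar>tanh (?m X)\<bar> < 1" using tanh_real_bounds[of "?m X"] by auto
    then show ?thesis unfolding df[OF that] using abs_square_less_1[of "tanh (?m X)"] by linarith
  qed
  moreover have "?J \<noteq> {}" using leaf_zero(1)[of T0] by blast
  ultimately show ?thesis
    unfolding spacelike_graph_def using J leaf_domain_interval so by blast
qed

lemma leaf_tss_cmc: "tss_cmc_hypersurface M e H (graph_hypersurface (leaf_domain T0) (leaf_height T0))"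
proof -
  have cmc: "cmc_graph M e H (leaf_domain T0) (leaf_height T0)"
    unfolding cmc_graph_def using spacelike_leaf mean_curvature_sol[OF open_leaf_domain leaf_sol] by blast
  have "maximally_extended M e H (leaf_domain T0) (leaf_height T0)"
    unfolding maximally_extended_def
  proof (intro allI impI)
    fix J g assume *: "cmc_graph M e H J g \<and> leaf_domain T0 \<subseteq> J \<and> (\<forall>X\<in>leaf_domain T0. g X = leaf_height T0 X)"
    then have sp: "spacelike_graph M e J g" by (simp add: cmc_graph_def)
    show "J = leaf_domain T0"
      by (rule leaf_maximal[of J T0 g])
        (use * sp in \<open>auto simp: spacelike_graph_def intro: differentiable_imp_continuous_on\<close>)
  qed
  moreover have "T_axisymmetric (leaf_domain T0) (leaf_height T0)"
    unfolding T_axisymmetric_def using leaf_domain_neg leaf_even(1) by blast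
  ultimately show ?thesis unfolding tss_cmc_hypersurface_def using cmc by blast
qed

text \<open>The index of a leaf is its height on the axis; covering and disjointness come from
  \<open>leaf_through\<close> and \<open>leaf_disjoint\<close>, with the sphere factor carried
  along.\<close>

lemma leaf_foliation:
  "tss_cmc_foliation M e UNIV (\<lambda>T0. graph_hypersurface (leaf_domain T0) (leaf_height T0))"
  unfolding tss_cmc_foliation_def
proof (intro conjI ballI impI)
  fix T0 show "\<exists>H. tss_cmc_hypersurface M e H (graph_hypersurface (leaf_domain T0) (leaf_height T0))"
    using leaf_tss_cmc by blast
next
  fix T1 T2 :: real assume "T1 \<noteq> T2"
  then show "graph_hypersurface (leaf_domain T1) (leaf_height T1) \<inter> graph_hypersurface (leaf_domain T2) (leaf_height T2) = {}"
    unfolding graph_hypersurface_def using leaf_disjoint by auto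
next
  have "(\<Union>T0. (\<lambda>X. (leaf_height T0 X, X)) ` leaf_domain T0) = D"
  proof
    show "(\<Union>T0. (\<lambda>X. (leaf_height T0 X, X)) ` leaf_domain T0) \<subseteq> D"
      using leaf_sol unfolding sol_def by blast
    show "D \<subseteq> (\<Union>T0. (\<lambda>X. (leaf_height T0 X, X)) ` leaf_domain T0)"
    proof
      fix x assume "x \<in> D"
      then obtain T0 where "snd x \<in> leaf_domain T0" "leaf_height T0 (snd x) = fst x"
        using leaf_through[of "fst x" "snd x"] by auto
      then show "x \<in> (\<Union>T0. (\<lambda>X. (leaf_height T0 X, X)) ` leaf_domain T0)"
        by (intro UN_I[of T0] image_eqI[of _ _ "snd x"]) auto
    qed
  qed
  then show "(\<Union>T0\<in>UNIV. graph_hypersurface (leaf_domain T0) (leaf_height T0)) = rn_spacetime M e"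
    unfolding graph_hypersurface_def rn_spacetime_def by blast
qed

end

theorem theorem3:
  fixes M e H :: real
  assumes "0 < M" and "0 < e\<^sup>2" and "e\<^sup>2 < M\<^sup>2"
  shows "\<exists>(S :: real set) \<Sigma>. tss_cmc_foliation M e S \<Sigma> \<and>
           (\<forall>s\<in>S. tss_cmc_hypersurface M e H (\<Sigma> s))"
proof -
  interpret reissner_nordstrom_cmc M e H by unfold_locales (use assms in auto)
  show ?thesis using leaf_foliation leaf_tss_cmc by blast
qed

end
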